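(* Let $d\in\mathbb{N}$ and let $V$ be a simple $\mathcal{T}_d$-module on which $C_1,C_2$ act as scalars $c_1,c_2\in\mathbb{C}$. Suppose there exists $t\in\mathbb{N}$ satisfying the following two conditions: (a) if $t>0$, the action of $W_t$ on $V$ is injective; if $t=0$, then $c_2\neq 0$; (b) $W_iV=0$ for all $i>t$ and $L_jV=0$ for all $j>t+d$. Then: (i) $G_{i-\frac12}V=0$ for all integers $i>t$; (ii) the induced module $\mathrm{Ind}(V)=\mathcal{U}(\mathcal{S})\otimes_{\mathcal{U}(\mathcal{T}_d)}V$ is a simple $\mathcal{S}$-module.
   Context: Everything is over $\mathbb{C}$; $\mathbb{N}=\{0,1,2,\dots\}$. The super extended Ovsienko--Roger algebra $\mathcal{S}$ is the Lie superalgebra with basis $\{L_m,W_m,G_r,C_1,C_2 : m\in\mathbb{Z},\ r\in\mathbb{Z}+\frac12\}$, where $L_m,W_m,C_1,C_2$ are even and $G_r$ is odd, with super-brackets (for $m,n\in\mathbb{Z}$, $r,s\in\mathbb{Z}+\frac12$) $$[L_m,L_n]=(n-m)L_{m+n}+\tfrac{m^3-m}{12}\delta_{m+n,0}C_1,\quad [L_m,W_n]=(m+n)W_{m+n}+\delta_{m+n,0}C_2,$$ $$[L_m,G_r]=rG_{m+r},\quad [G_r,G_s]=(r+s)W_{r+s}+\delta_{r+s,0}C_2,\quad [W_m,W_n]=[W_m,G_r]=[\mathcal{S},C_1]=[\mathcal{S},C_2]=0.$$ For $d\in\mathbb{N}$, $\mathcal{T}_d$ is the subalgebra $\mathcal{T}_d=\bigoplus_{i\ge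 0}(\mathbb{C}L_i\oplus\mathbb{C}W_{i-d})\oplus\bigoplus_{i\ge1}\mathbb{C}G_{i-\frac12}\oplus\mathbb{C}C_1\oplus\mathbb{C}C_2$. $\mathcal{U}(\cdot)$ denotes the universal enveloping (super)algebra. Conventions: all modules over Lie superalgebras are $\mathbb{Z}_2$-graded (with $\mathfrak{g}_{\bar i}V_{\bar j}\subseteq V_{\bar i+\bar j}$), all simple modules are assumed non-trivial, and the central elements $C_1,C_2$ are always assumed to act on the modules considered as scalars $c_1,c_2$. *)

theory Defs
  imports
    "HOL-Algebra.Algebraic_Closure_Type"
    "HOL-Algebra.Free_Abelian_Groups"
    "HOL-Library.Poly_Mapping"
    "HOL-Library.Z2"
begin

lemma sum_monomials:
  "(\<Sum>b\<in>Poly_Mapping.keys x. Poly_Mapping.single b (Poly_Mapping.lookup x b)) = x"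
  by (rule poly_mapping_eqI) (simp add: lookup_sum lookup_single when_def in_keys_iff)

lemma poly_mapping_induct_single [case_names zero single add]:
  fixes x :: "'b \<Rightarrow>\<^sub>0 'c::comm_monoid_add"
  assumes "P 0" and "\<And>b c. P (Poly_Mapping.single b c)"
    and "\<And>x y. P x \<Longrightarrow> P y \<Longrightarrow> P (x + y)"
  shows "P x"
proof -
  have "P (\<Sum>b\<in>A. Poly_Mapping.single b (Poly_Mapping.lookup x b))" for A
    by (induction A rule: infinite_finite_induct) (use assms in auto)
  from this[of "Poly_Mapping.keys x"] show ?thesis
    by (simp add: sum_monomials)
qed


section \<open>Lie superalgebras over the complex numbers and their modules\<close>

abbreviation complex_ring :: "complex ring" where
  "complex_ring \<equiv> ring_of_type_algebra"

text \<open>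
  Parities live in the two-element field \<^typ>\<open>bit\<close>, whose addition is addition mod 2.  As usual
  in HOL-Algebra, the fields \<open>mult\<close> and \<open>one\<close> of a module record carry no meaning.
\<close>

definition koszul_sign :: "bit \<Rightarrow> bit \<Rightarrow> complex" where
  "koszul_sign i j = (if i = 1 \<and> j = 1 then -1 else 1)"

record 'a super_space = "(complex, 'a) module" +
  parity_part :: "bit \<Rightarrow> 'a set"

record 'g lie_superalgebra = "'g super_space" +
  bracket :: "'g \<Rightarrow> 'g \<Rightarrow> 'g"

record ('g, 'v) supermodule = "'v super_space" +
  act :: "'g \<Rightarrow> 'v \<Rightarrow> 'v"

locale super_space = module complex_ring V for V :: "('a, 'm) super_space_scheme" (structure) +
  assumes part_submodule: "submodule (parity_part V i) complex_ring V"
    and part_decomp: "x \<in> carrier V \<Longrightarrow>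
      \<exists>!p. p \<in> parity_part V 0 \<times> parity_part V 1 \<and> x = fst p \<oplus> snd p"

locale lie_superalgebra = super_space g for g :: "('g, 'm) lie_superalgebra_scheme" (structure) +
  assumes bracket_closed:
      "\<lbrakk>x \<in> carrier g; y \<in> carrier g\<rbrakk> \<Longrightarrow> bracket g x y \<in> carrier g"
    and bracket_add_left:
      "\<lbrakk>x \<in> carrier g; x' \<in> carrier g; y \<in> carrier g\<rbrakk> \<Longrightarrow>
        bracket g (x \<oplus> x') y = bracket g x y \<oplus> bracket g x' y"
    and bracket_add_right:
      "\<lbrakk>x \<in> carrier g; y \<in> carrier g; y' \<in> carrier g\<rbrakk> \<Longrightarrow>
        bracket g x (y \<oplus> y') = bracket g x y \<oplus> bracket g x y'"
    and bracket_smult_left: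
      "\<lbrakk>x \<in> carrier g; y \<in> carrier g\<rbrakk> \<Longrightarrow> bracket g (c \<odot> x) y = c \<odot> bracket g x y"
    and bracket_smult_right:
      "\<lbrakk>x \<in> carrier g; y \<in> carrier g\<rbrakk> \<Longrightarrow> bracket g x (c \<odot> y) = c \<odot> bracket g x y"
    and bracket_part:
      "\<lbrakk>x \<in> parity_part g i; y \<in> parity_part g j\<rbrakk> \<Longrightarrow> bracket g x y \<in> parity_part g (i + j)"
    and bracket_skew:
      "\<lbrakk>x \<in> parity_part g i; y \<in> parity_part g j\<rbrakk> \<Longrightarrow>
        bracket g x y = (- koszul_sign i j) \<odot> bracket g y x"
    and bracket_jacobi:
      "\<lbrakk>x \<in> parity_part g i; y \<in> parity_part g j; z \<in> parity_part g k\<rbrakk> \<Longrightarrow>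
        bracket g x (bracket g y z) =
          bracket g (bracket g x y) z \<oplus> koszul_sign i j \<odot> bracket g y (bracket g x z)"

definition sub_superalgebra :: "'g lie_superalgebra \<Rightarrow> 'g set \<Rightarrow> 'g lie_superalgebra" where
  "sub_superalgebra g H = g\<lparr>carrier := H, parity_part := (\<lambda>i. parity_part g i \<inter> H)\<rparr>"

locale supermodule = super_space V
  for g :: "'g lie_superalgebra" and V :: "('g, 'v) supermodule" (structure) +
  assumes act_closed:
      "\<lbrakk>x \<in> carrier g; v \<in> carrier V\<rbrakk> \<Longrightarrow> act V x v \<in> carrier V"
    and act_add_left:
      "\<lbrakk>x \<in> carrier g; y \<in> carrier g; v \<in> carrier V\<rbrakk> \<Longrightarrow>
        act V (x \<oplus>\<^bsub>g\<^esub> y) v = act V x v \<oplus> act V y v"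
    and act_add_right:
      "\<lbrakk>x \<in> carrier g; v \<in> carrier V; w \<in> carrier V\<rbrakk> \<Longrightarrow>
        act V x (v \<oplus> w) = act V x v \<oplus> act V x w"
    and act_smult_left:
      "\<lbrakk>x \<in> carrier g; v \<in> carrier V\<rbrakk> \<Longrightarrow> act V (c \<odot>\<^bsub>g\<^esub> x) v = c \<odot> act V x v"
    and act_smult_right:
      "\<lbrakk>x \<in> carrier g; v \<in> carrier V\<rbrakk> \<Longrightarrow> act V x (c \<odot> v) = c \<odot> act V x v"
    and act_part:
      "\<lbrakk>x \<in> parity_part g i; v \<in> parity_part V j\<rbrakk> \<Longrightarrow> act V x v \<in> parity_part V (i + j)"
    and act_bracket:
      "\<lbrakk>x \<in> parity_part g i; y \<in> parity_part g j; v \<in> carrier V\<rbrakk> \<Longrightarrow>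
        act V (bracket g x y) v =
          act V x (act V y v) \<ominus> koszul_sign i j \<odot> act V y (act V x v)"

text \<open>All submodules are graded: they contain the homogeneous components of their elements.\<close>

definition sub_supermodule ::
    "'g lie_superalgebra \<Rightarrow> ('g, 'v) supermodule \<Rightarrow> 'v set \<Rightarrow> bool" where
  "sub_supermodule g V N \<longleftrightarrow>
     submodule N complex_ring V \<and>
     (\<forall>x\<in>carrier g. \<forall>v\<in>N. act V x v \<in> N) \<and>
     (\<forall>v0\<in>parity_part V 0. \<forall>v1\<in>parity_part V 1. v0 \<oplus>\<^bsub>V\<^esub> v1 \<in> N \<longrightarrow> v0 \<in> N \<and> v1 \<in> N)"

text \<open>Simple modules are by convention non-trivial, i.e. the algebra does not act by zero.\<close>

definition simple_supermodule :: "'g lie_superalgebra \<Rightarrow> ('g, 'v) supermodule \<Rightarrow> bool" where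
  "simple_supermodule g V \<longleftrightarrow>
     supermodule g V \<and>
     carrier V \<noteq> {\<zero>\<^bsub>V\<^esub>} \<and>
     (\<exists>x\<in>carrier g. \<exists>v\<in>carrier V. act V x v \<noteq> \<zero>\<^bsub>V\<^esub>) \<and>
     (\<forall>N. sub_supermodule g V N \<longrightarrow> N = {\<zero>\<^bsub>V\<^esub>} \<or> N = carrier V)"


section \<open>The universal enveloping algebra\<close>

text \<open>
  The free associative unital complex algebra on a set \<open>S\<close>: finitely supported linear
  combinations of words over \<open>S\<close>, multiplied by concatenating words.
\<close>

definition free_alg_mult ::
    "('x list \<Rightarrow>\<^sub>0 complex) \<Rightarrow> ('x list \<Rightarrow>\<^sub>0 complex) \<Rightarrow> 'x list \<Rightarrow>\<^sub>0 complex" where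
  "free_alg_mult p q =
     (\<Sum>u\<in>Poly_Mapping.keys p. \<Sum>w\<in>Poly_Mapping.keys q.
        Poly_Mapping.single (u @ w) (Poly_Mapping.lookup p u * Poly_Mapping.lookup q w))"

definition free_alg :: "'x set \<Rightarrow> ('x list \<Rightarrow>\<^sub>0 complex) ring" where
  "free_alg S = \<lparr>carrier = {p. Poly_Mapping.keys p \<subseteq> lists S}, monoid.mult = free_alg_mult,
     one = Poly_Mapping.single [] 1, ring.zero = 0, add = (+)\<rparr>"

lemma free_alg_mult_eq:
  assumes "finite A" "finite B" "Poly_Mapping.keys p \<subseteq> A" "Poly_Mapping.keys q \<subseteq> B"
  shows "free_alg_mult p q = (\<Sum>u\<in>A. \<Sum>w\<in>B.
    Poly_Mapping.single (u @ w) (Poly_Mapping.lookup p u * Poly_Mapping.lookup q w))"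
proof -
  have "free_alg_mult p q = (\<Sum>u\<in>Poly_Mapping.keys p. \<Sum>w\<in>B.
    Poly_Mapping.single (u @ w) (Poly_Mapping.lookup p u * Poly_Mapping.lookup q w))"
    unfolding free_alg_mult_def using assms
    by (intro sum.cong sum.mono_neutral_left) (auto simp: in_keys_iff)
  also have "\<dots> = (\<Sum>u\<in>A. \<Sum>w\<in>B.
    Poly_Mapping.single (u @ w) (Poly_Mapping.lookup p u * Poly_Mapping.lookup q w))"
    using assms by (intro sum.mono_neutral_left) (auto simp: in_keys_iff)
  finally show ?thesis .
qed

lemma free_alg_mult_add:
  "free_alg_mult (p + p') q = free_alg_mult p q + free_alg_mult p' q" (is ?l)
  "free_alg_mult p (q + q') = free_alg_mult p q + free_alg_mult p q'" (is ?r)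
proof -
  have "Poly_Mapping.keys (p + p') \<subseteq> Poly_Mapping.keys p \<union> Poly_Mapping.keys p'"
    "Poly_Mapping.keys (q + q') \<subseteq> Poly_Mapping.keys q \<union> Poly_Mapping.keys q'"
    by (rule Poly_Mapping.keys_add)+
  then show ?l ?r
    by (subst (1 2 3) free_alg_mult_eq[of "Poly_Mapping.keys p \<union> Poly_Mapping.keys p'"
          "Poly_Mapping.keys q \<union> Poly_Mapping.keys q'"];
        auto simp: lookup_add distrib_left distrib_right single_add sum.distrib)+
qed

lemma free_alg_mult_zero: "free_alg_mult 0 q = 0" "free_alg_mult p 0 = 0"
  by (simp_all add: free_alg_mult_def)

lemma free_alg_mult_single:
  "free_alg_mult (Poly_Mapping.single u a) (Poly_Mapping.single w b) =
     Poly_Mapping.single (u @ w) (a * b)"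
  by (subst free_alg_mult_eq[of "{u}" "{w}"]) auto

lemma free_alg_mult_one:
  "free_alg_mult (Poly_Mapping.single [] 1) p = p" "free_alg_mult p (Poly_Mapping.single [] 1) = p"
  by (induction p rule: poly_mapping_induct_single;
      simp add: free_alg_mult_zero free_alg_mult_add free_alg_mult_single)+

lemma free_alg_mult_assoc: "free_alg_mult (free_alg_mult p q) r = free_alg_mult p (free_alg_mult q r)"
proof (induction p rule: poly_mapping_induct_single)
  case (single u a)
  show ?case
  proof (induction q rule: poly_mapping_induct_single)
    case (single w b)
    show ?case
      by (induction r rule: poly_mapping_induct_single)
        (simp_all add: free_alg_mult_zero free_alg_mult_add free_alg_mult_single mult.assoc)
  qed (simp_all add: free_alg_mult_zero free_alg_mult_add)
qed (simp_all add: free_alg_mult_zero free_alg_mult_add)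

lemma keys_free_alg_mult:
  assumes "Poly_Mapping.keys p \<subseteq> lists S" "Poly_Mapping.keys q \<subseteq> lists S"
  shows "Poly_Mapping.keys (free_alg_mult p q) \<subseteq> lists S"
  unfolding free_alg_mult_def using assms
  by (intro order.trans[OF keys_sum] UN_least) (auto split: if_splits)

lemma free_alg_ring: "ring (free_alg S)"
proof -
  have closed: "Poly_Mapping.keys (p + q) \<subseteq> lists S"
    if "Poly_Mapping.keys p \<subseteq> lists S" "Poly_Mapping.keys q \<subseteq> lists S"
    for p q :: "'a list \<Rightarrow>\<^sub>0 complex"
    using Poly_Mapping.keys_add[of p q] that by blast
  show ?thesis
  proof (intro ringI abelian_groupI monoidI)
    show "\<exists>q\<in>carrier (free_alg S). q \<oplus>\<^bsub>free_alg S\<^esub> p = \<zero>\<^bsub>free_alg S\<^esub>"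
      if "p \<in> carrier (free_alg S)" for p
      using that by (intro bexI[of _ "- p"]) (auto simp: free_alg_def)
  qed (auto simp: free_alg_def ac_simps free_alg_mult_one free_alg_mult_assoc free_alg_mult_add
      split: if_splits dest: subsetD[OF keys_free_alg_mult] subsetD[OF closed])
qed

text \<open>
  The first two families of relators turn the free algebra on the underlying set of \<open>g\<close> into the
  tensor algebra of the vector space \<open>g\<close>; the third imposes
  \<open>x y - (-1)\<^bsup>i j\<^esup> y x = [x, y]\<close> for homogeneous \<open>x\<close>, \<open>y\<close> of parities \<open>i\<close>, \<open>j\<close>.
\<close>

definition uea_relators :: "'g lie_superalgebra \<Rightarrow> ('g list \<Rightarrow>\<^sub>0 complex) set" where
  "uea_relators g =
     {Poly_Mapping.single [x \<oplus>\<^bsub>g\<^esub> y] 1 - Poly_Mapping.single [x] 1 - Poly_Mapping.single [y] 1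
        | x y. x \<in> carrier g \<and> y \<in> carrier g} \<union>
     {Poly_Mapping.single [c \<odot>\<^bsub>g\<^esub> x] 1 - Poly_Mapping.single [x] c | c x. x \<in> carrier g} \<union>
     {Poly_Mapping.single [x, y] 1 - Poly_Mapping.single [y, x] (koszul_sign i j)
          - Poly_Mapping.single [bracket g x y] 1
        | x y i j. x \<in> parity_part g i \<and> y \<in> parity_part g j}"

definition uea_ideal :: "'g lie_superalgebra \<Rightarrow> ('g list \<Rightarrow>\<^sub>0 complex) set" where
  "uea_ideal g = Idl\<^bsub>free_alg (carrier g)\<^esub> (uea_relators g)"

definition uea :: "'g lie_superalgebra \<Rightarrow> ('g list \<Rightarrow>\<^sub>0 complex) set ring" where
  "uea g = free_alg (carrier g) Quot uea_ideal g"

lemma uea_relators_closed: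
  assumes "lie_superalgebra g"
  shows "uea_relators g \<subseteq> carrier (free_alg (carrier g))"
proof -
  interpret lie_superalgebra g by fact
  have part: "x \<in> carrier g" if "x \<in> parity_part g i" for x i
    using submoduleE(1)[OF part_submodule] that by blast
  have bracket: "bracket g x y \<in> carrier g"
    if "x \<in> parity_part g i" "y \<in> parity_part g j" for x y i j
    by (rule bracket_closed) (fact part[OF that(1)] part[OF that(2)])+
  show ?thesis
    unfolding uea_relators_def free_alg_def
    by (auto dest!: subsetD[OF keys_diff] simp: part ring_of_type_algebra_def
         intro!: smult_closed intro: bracket split: if_splits)
qed

lemma uea_ring:
  assumes "lie_superalgebra g"
  shows "ring (uea g)"
  unfolding uea_def uea_ideal_def
  by (intro ideal.quotient_is_ring ring.genideal_ideal free_alg_ring uea_relators_closed assms)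

definition uea_class ::
    "'g lie_superalgebra \<Rightarrow> ('g list \<Rightarrow>\<^sub>0 complex) \<Rightarrow> ('g list \<Rightarrow>\<^sub>0 complex) set" where
  "uea_class g p = uea_ideal g +>\<^bsub>free_alg (carrier g)\<^esub> p"

definition uea_part :: "'g lie_superalgebra \<Rightarrow> bit \<Rightarrow> ('g list \<Rightarrow>\<^sub>0 complex) set set" where
  "uea_part g i = generate (add_monoid (uea g))
     {uea_class g (Poly_Mapping.single xs c)
        | xs c js. list_all2 (\<lambda>x j. x \<in> parity_part g j) xs js \<and> sum_list js = i}"

text \<open>
  The homomorphism \<open>U(h) \<rightarrow> U(g)\<close> induced by the inclusion of a subalgebra \<open>h\<close> of \<open>g\<close>.  It sends the
  class of \<open>p\<close> to the class of \<open>p\<close>; \<open>the_elem\<close> picks the value common to all representatives.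
\<close>

definition uea_incl ::
    "'g lie_superalgebra \<Rightarrow> 'g lie_superalgebra \<Rightarrow>
     ('g list \<Rightarrow>\<^sub>0 complex) set \<Rightarrow> ('g list \<Rightarrow>\<^sub>0 complex) set" where
  "uea_incl h g a = the_elem (uea_class g ` a)"

text \<open>The action of \<open>U(g)\<close> on a \<open>g\<close>-module: a word \<open>[x\<^sub>1, \<dots>, x\<^sub>n]\<close> sends \<open>v\<close> to \<open>x\<^sub>1 (\<dots> (x\<^sub>n v))\<close>.\<close>

definition free_alg_act ::
    "('g, 'v) supermodule \<Rightarrow> ('g list \<Rightarrow>\<^sub>0 complex) \<Rightarrow> 'v \<Rightarrow> 'v" where
  "free_alg_act V p v =
     (\<Oplus>\<^bsub>V\<^esub>xs\<in>Poly_Mapping.keys p. Poly_Mapping.lookup p xs \<odot>\<^bsub>V\<^esub> foldr (act V) xs v)"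

definition uea_act ::
    "('g, 'v) supermodule \<Rightarrow> ('g list \<Rightarrow>\<^sub>0 complex) set \<Rightarrow> 'v \<Rightarrow> 'v" where
  "uea_act V a v = the_elem ((\<lambda>p. free_alg_act V p v) ` a)"


section \<open>Tensor products over a noncommutative ring\<close>

text \<open>
  \<open>M \<otimes>\<^sub>R N\<close> for a right \<open>R\<close>-module \<open>M\<close> (action \<open>ract\<close>) and a left \<open>R\<close>-module \<open>N\<close> (action \<open>lact\<close>):
  the free abelian group on \<open>M \<times> N\<close> modulo the usual relators.  Only the additive structure of
  \<open>M\<close> and \<open>N\<close> and the carrier of \<open>R\<close> are used.
\<close>

definition tensor_relators ::
    "('r, 'k) ring_scheme \<Rightarrow> ('m, 'k1) ring_scheme \<Rightarrow> ('n, 'k2) ring_scheme \<Rightarrow>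
     ('m \<Rightarrow> 'r \<Rightarrow> 'm) \<Rightarrow> ('r \<Rightarrow> 'n \<Rightarrow> 'n) \<Rightarrow> ('m \<times> 'n \<Rightarrow>\<^sub>0 int) set" where
  "tensor_relators R M N ract lact =
     {frag_of (m \<oplus>\<^bsub>M\<^esub> m', n) - frag_of (m, n) - frag_of (m', n)
        | m m' n. m \<in> carrier M \<and> m' \<in> carrier M \<and> n \<in> carrier N} \<union>
     {frag_of (m, n \<oplus>\<^bsub>N\<^esub> n') - frag_of (m, n) - frag_of (m, n')
        | m n n'. m \<in> carrier M \<and> n \<in> carrier N \<and> n' \<in> carrier N} \<union>
     {frag_of (ract m r, n) - frag_of (m, lact r n)
        | m r n. m \<in> carrier M \<and> r \<in> carrier R \<and> n \<in> carrier N}"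

definition tensor_kernel ::
    "('r, 'k) ring_scheme \<Rightarrow> ('m, 'k1) ring_scheme \<Rightarrow> ('n, 'k2) ring_scheme \<Rightarrow>
     ('m \<Rightarrow> 'r \<Rightarrow> 'm) \<Rightarrow> ('r \<Rightarrow> 'n \<Rightarrow> 'n) \<Rightarrow> ('m \<times> 'n \<Rightarrow>\<^sub>0 int) set" where
  "tensor_kernel R M N ract lact =
     generate (free_Abelian_group (carrier M \<times> carrier N)) (tensor_relators R M N ract lact)"

definition tensor_group ::
    "('r, 'k) ring_scheme \<Rightarrow> ('m, 'k1) ring_scheme \<Rightarrow> ('n, 'k2) ring_scheme \<Rightarrow>
     ('m \<Rightarrow> 'r \<Rightarrow> 'm) \<Rightarrow> ('r \<Rightarrow> 'n \<Rightarrow> 'n) \<Rightarrow> ('m \<times> 'n \<Rightarrow>\<^sub>0 int) set monoid" where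
  "tensor_group R M N ract lact =
     free_Abelian_group (carrier M \<times> carrier N) Mod tensor_kernel R M N ract lact"


section \<open>Induced modules\<close>

text \<open>
  \<open>U(g) \<otimes>\<^bsub>U(h)\<^esub> V\<close> for an \<open>h\<close>-module \<open>V\<close>, where \<open>U(h)\<close> acts on \<open>U(g)\<close> from the right by
  multiplication through \<open>uea_incl\<close>.
\<close>

type_synonym ('g, 'v) ind_type = "((('g list \<Rightarrow>\<^sub>0 complex) set \<times> 'v) \<Rightarrow>\<^sub>0 int) set"

definition ind_kernel ::
    "'g lie_superalgebra \<Rightarrow> 'g lie_superalgebra \<Rightarrow> ('g, 'v) supermodule \<Rightarrow> ('g, 'v) ind_type" where
  "ind_kernel g h V =
     tensor_kernel (uea h) (uea g) V (\<lambda>u a. u \<otimes>\<^bsub>uea g\<^esub> uea_incl h g a) (uea_act V)"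

definition ind_group ::
    "'g lie_superalgebra \<Rightarrow> 'g lie_superalgebra \<Rightarrow> ('g, 'v) supermodule \<Rightarrow>
     ('g, 'v) ind_type monoid" where
  "ind_group g h V =
     tensor_group (uea h) (uea g) V (\<lambda>u a. u \<otimes>\<^bsub>uea g\<^esub> uea_incl h g a) (uea_act V)"

definition ind_class ::
    "'g lie_superalgebra \<Rightarrow> 'g lie_superalgebra \<Rightarrow> ('g, 'v) supermodule \<Rightarrow>
     ((('g list \<Rightarrow>\<^sub>0 complex) set \<times> 'v) \<Rightarrow>\<^sub>0 int) \<Rightarrow> ('g, 'v) ind_type" where
  "ind_class g h V f =
     ind_kernel g h V #>\<^bsub>free_Abelian_group (carrier (uea g) \<times> carrier V)\<^esub> f"

text \<open>Left multiplication by \<open>u \<in> U(g)\<close>, determined by \<open>w \<otimes> v \<mapsto> u w \<otimes> v\<close>.\<close>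

definition ind_lmult ::
    "'g lie_superalgebra \<Rightarrow> 'g lie_superalgebra \<Rightarrow> ('g, 'v) supermodule \<Rightarrow>
     ('g list \<Rightarrow>\<^sub>0 complex) set \<Rightarrow> ('g, 'v) ind_type \<Rightarrow> ('g, 'v) ind_type" where
  "ind_lmult g h V u Z =
     the_elem ((\<lambda>f. ind_class g h V (frag_extend (\<lambda>(w, v). frag_of (u \<otimes>\<^bsub>uea g\<^esub> w, v)) f)) ` Z)"

definition ind_module ::
    "'g lie_superalgebra \<Rightarrow> 'g lie_superalgebra \<Rightarrow> ('g, 'v) supermodule \<Rightarrow>
     ('g, ('g, 'v) ind_type) supermodule" where
  "ind_module g h V =
     \<lparr>carrier = carrier (ind_group g h V),
      monoid.mult = undefined, one = undefined,
      ring.zero = \<one>\<^bsub>ind_group g h V\<^esub>,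
      add = (\<lambda>Y Z. Y \<otimes>\<^bsub>ind_group g h V\<^esub> Z),
      module.smult = (\<lambda>c. ind_lmult g h V (uea_class g (Poly_Mapping.single [] c))),
      parity_part = (\<lambda>k. generate (ind_group g h V)
        {ind_class g h V (frag_of (u, v))
           | u v i j. u \<in> uea_part g i \<and> v \<in> parity_part V j \<and> i + j = k}),
      act = (\<lambda>x. ind_lmult g h V (uea_class g (Poly_Mapping.single [x] 1)))\<rparr>"


section \<open>The super extended Ovsienko--Roger algebra\<close>

text \<open>
  \<open>Ggen k\<close> stands for the odd basis vector with half-integral index \<open>k - 1/2\<close>.
\<close>

datatype osr_basis = Lgen int | Wgen int | Ggen int | Cgen1 | Cgen2

fun osr_basis_parity :: "osr_basis \<Rightarrow> bit" where
  "osr_basis_parity (Ggen k) = 1"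
| "osr_basis_parity _ = 0"

fun osr_basis_bracket :: "osr_basis \<Rightarrow> osr_basis \<Rightarrow> (osr_basis \<Rightarrow>\<^sub>0 complex)" where
  "osr_basis_bracket (Lgen m) (Lgen n) =
     Poly_Mapping.single (Lgen (m + n)) (of_int (n - m)) +
     (if m + n = 0 then Poly_Mapping.single Cgen1 (of_int (m ^ 3 - m) / 12) else 0)"
| "osr_basis_bracket (Lgen m) (Wgen n) =
     Poly_Mapping.single (Wgen (m + n)) (of_int (m + n)) +
     (if m + n = 0 then Poly_Mapping.single Cgen2 1 else 0)"
| "osr_basis_bracket (Wgen n) (Lgen m) =
     - (Poly_Mapping.single (Wgen (m + n)) (of_int (m + n)) +
        (if m + n = 0 then Poly_Mapping.single Cgen2 1 else 0))"
| "osr_basis_bracket (Lgen m) (Ggen k) =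
     Poly_Mapping.single (Ggen (m + k)) (of_int k - 1 / 2)"
| "osr_basis_bracket (Ggen k) (Lgen m) =
     - Poly_Mapping.single (Ggen (m + k)) (of_int k - 1 / 2)"
| "osr_basis_bracket (Ggen k) (Ggen l) =
     Poly_Mapping.single (Wgen (k + l - 1)) (of_int (k + l - 1)) +
     (if k + l - 1 = 0 then Poly_Mapping.single Cgen2 1 else 0)"
| "osr_basis_bracket _ _ = 0"

definition osr_scale :: "complex \<Rightarrow> (osr_basis \<Rightarrow>\<^sub>0 complex) \<Rightarrow> (osr_basis \<Rightarrow>\<^sub>0 complex)" where
  "osr_scale c x = Poly_Mapping.map (\<lambda>a. c * a) x"

definition osr_bracket ::
    "(osr_basis \<Rightarrow>\<^sub>0 complex) \<Rightarrow> (osr_basis \<Rightarrow>\<^sub>0 complex) \<Rightarrow> (osr_basis \<Rightarrow>\<^sub>0 complex)" where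
  "osr_bracket x y =
     (\<Sum>a\<in>Poly_Mapping.keys x. \<Sum>b\<in>Poly_Mapping.keys y.
        osr_scale (Poly_Mapping.lookup x a * Poly_Mapping.lookup y b) (osr_basis_bracket a b))"

definition osr_homogeneous :: "bit \<Rightarrow> (osr_basis \<Rightarrow>\<^sub>0 complex) set" where
  "osr_homogeneous i = {x. \<forall>b\<in>Poly_Mapping.keys x. osr_basis_parity b = i}"

definition osr_algebra :: "(osr_basis \<Rightarrow>\<^sub>0 complex) lie_superalgebra" where
  "osr_algebra =
     \<lparr>carrier = UNIV, monoid.mult = undefined, one = undefined, ring.zero = 0, add = (+),
      module.smult = osr_scale,
      parity_part = osr_homogeneous,
      bracket = osr_bracket\<rparr>"

definition osr_T_basis :: "nat \<Rightarrow> osr_basis set" where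
  "osr_T_basis d =
     {Lgen i | i. i \<ge> 0} \<union> {Wgen (i - int d) | i. i \<ge> 0} \<union> {Ggen i | i. i \<ge> 1} \<union> {Cgen1, Cgen2}"

definition osr_T :: "nat \<Rightarrow> (osr_basis \<Rightarrow>\<^sub>0 complex) lie_superalgebra" where
  "osr_T d = sub_superalgebra osr_algebra {x. Poly_Mapping.keys x \<subseteq> osr_T_basis d}"

abbreviation osr_L :: "int \<Rightarrow> osr_basis \<Rightarrow>\<^sub>0 complex" where
  "osr_L m \<equiv> Poly_Mapping.single (Lgen m) 1"

abbreviation osr_W :: "int \<Rightarrow> osr_basis \<Rightarrow>\<^sub>0 complex" where
  "osr_W m \<equiv> Poly_Mapping.single (Wgen m) 1"

text \<open>\<open>osr_G i\<close> is \<open>G\<close> with index \<open>i - 1/2\<close>.\<close>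

abbreviation osr_G :: "int \<Rightarrow> osr_basis \<Rightarrow>\<^sub>0 complex" where
  "osr_G i \<equiv> Poly_Mapping.single (Ggen i) 1"

abbreviation osr_C1 :: "osr_basis \<Rightarrow>\<^sub>0 complex" where
  "osr_C1 \<equiv> Poly_Mapping.single Cgen1 1"

abbreviation osr_C2 :: "osr_basis \<Rightarrow>\<^sub>0 complex" where
  "osr_C2 \<equiv> Poly_Mapping.single Cgen2 1"


subsection \<open>The Lie superalgebra axioms\<close>

lemma lookup_osr_scale [simp]:
  "Poly_Mapping.lookup (osr_scale c x) b = c * Poly_Mapping.lookup x b"
  by (simp add: osr_scale_def Poly_Mapping.map.rep_eq when_def)

lemma osr_scale_linear:
  "osr_scale c (x + y) = osr_scale c x + osr_scale c y"
  "osr_scale c (x - y) = osr_scale c x - osr_scale c y"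
  "osr_scale c (- x) = - osr_scale c x"
  "osr_scale (c + e) x = osr_scale c x + osr_scale e x"
  "osr_scale (- c) x = - osr_scale c x"
  "osr_scale c (osr_scale e x) = osr_scale (c * e) x"
  "osr_scale 1 x = x" "osr_scale 0 x = 0" "osr_scale c 0 = 0"
  "osr_scale c (Poly_Mapping.single b e) = Poly_Mapping.single b (c * e)"
  by (rule poly_mapping_eqI; simp add: lookup_add lookup_minus lookup_single when_def algebra_simps)+

lemma osr_scale_sum: "osr_scale c (sum f A) = (\<Sum>a\<in>A. osr_scale c (f a))"
  by (induction A rule: infinite_finite_induct) (auto simp: osr_scale_linear)

lemma osr_bracket_eq:
  assumes "finite A" "finite B" "Poly_Mapping.keys x \<subseteq> A" "Poly_Mapping.keys y \<subseteq> B"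
  shows "osr_bracket x y = (\<Sum>a\<in>A. \<Sum>b\<in>B.
    osr_scale (Poly_Mapping.lookup x a * Poly_Mapping.lookup y b) (osr_basis_bracket a b))"
proof -
  have "osr_bracket x y = (\<Sum>a\<in>Poly_Mapping.keys x. \<Sum>b\<in>B.
    osr_scale (Poly_Mapping.lookup x a * Poly_Mapping.lookup y b) (osr_basis_bracket a b))"
    unfolding osr_bracket_def using assms
    by (intro sum.cong sum.mono_neutral_left) (auto simp: in_keys_iff osr_scale_linear)
  also have "\<dots> = (\<Sum>a\<in>A. \<Sum>b\<in>B.
    osr_scale (Poly_Mapping.lookup x a * Poly_Mapping.lookup y b) (osr_basis_bracket a b))"
    using assms
    by (intro sum.mono_neutral_left) (auto simp: in_keys_iff osr_scale_linear)
  finally show ?thesis .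
qed

lemma osr_bracket_add_left: "osr_bracket (x + x') y = osr_bracket x y + osr_bracket x' y"
proof -
  let ?A = "Poly_Mapping.keys x \<union> Poly_Mapping.keys x'" and ?B = "Poly_Mapping.keys y"
  have "Poly_Mapping.keys (x + x') \<subseteq> ?A" by (rule Poly_Mapping.keys_add)
  then show ?thesis
    by (subst (1 2 3) osr_bracket_eq[of ?A ?B])
      (auto simp: lookup_add distrib_right osr_scale_linear sum.distrib)
qed

lemma osr_bracket_add_right: "osr_bracket x (y + y') = osr_bracket x y + osr_bracket x y'"
proof -
  let ?A = "Poly_Mapping.keys x" and ?B = "Poly_Mapping.keys y \<union> Poly_Mapping.keys y'"
  have "Poly_Mapping.keys (y + y') \<subseteq> ?B" by (rule Poly_Mapping.keys_add)
  then show ?thesis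
    by (subst (1 2 3) osr_bracket_eq[of ?A ?B])
      (auto simp: lookup_add distrib_left osr_scale_linear sum.distrib)
qed

lemma keys_osr_scale: "Poly_Mapping.keys (osr_scale c x) \<subseteq> Poly_Mapping.keys x"
  by (auto simp: in_keys_iff)

lemma osr_bracket_scale_left: "osr_bracket (osr_scale c x) y = osr_scale c (osr_bracket x y)"
  by (subst (1 2) osr_bracket_eq[of "Poly_Mapping.keys x" "Poly_Mapping.keys y"])
    (use keys_osr_scale[of c x] in \<open>auto simp: osr_scale_linear osr_scale_sum mult.assoc\<close>)

lemma osr_bracket_scale_right: "osr_bracket x (osr_scale c y) = osr_scale c (osr_bracket x y)"
  by (subst (1 2) osr_bracket_eq[of "Poly_Mapping.keys x" "Poly_Mapping.keys y"])
    (use keys_osr_scale[of c y] in \<open>auto simp: osr_scale_linear osr_scale_sum mult_ac\<close>)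

lemma osr_bracket_single:
  "osr_bracket (Poly_Mapping.single a c) (Poly_Mapping.single b e) =
     osr_scale (c * e) (osr_basis_bracket a b)"
  by (subst osr_bracket_eq[of "{a}" "{b}"]) auto

lemma osr_bracket_zero [simp]: "osr_bracket 0 y = 0" "osr_bracket x 0 = 0"
  by (simp_all add: osr_bracket_def)

lemma osr_bracket_minus: "osr_bracket (- x) y = - osr_bracket x y"
    "osr_bracket x (- y) = - osr_bracket x y"
  using osr_bracket_scale_left[of "-1" x y] osr_bracket_scale_right[of x "-1" y]
  by (simp_all add: osr_scale_linear)

lemma osr_bracket_diff: "osr_bracket (x - x') y = osr_bracket x y - osr_bracket x' y"
    "osr_bracket x (y - y') = osr_bracket x y - osr_bracket x y'"
  using osr_bracket_add_left[of x "- x'" y] osr_bracket_add_right[of x y "- y'"]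
  by (simp_all add: osr_bracket_minus)

lemma osr_homogeneous_induct [consumes 1, case_names zero single add]:
  assumes "x \<in> osr_homogeneous i"
    and "P 0"
    and "\<And>b c. osr_basis_parity b = i \<Longrightarrow> P (Poly_Mapping.single b c)"
    and add: "\<And>x y. P x \<Longrightarrow> P y \<Longrightarrow> P (x + y)"
  shows "P x"
proof -
  have "P (\<Sum>b\<in>A. Poly_Mapping.single b (Poly_Mapping.lookup x b))"
    if "finite A" "A \<subseteq> Poly_Mapping.keys x" for A
    using that by (induction A rule: finite_induct)
      (use assms in \<open>auto simp: osr_homogeneous_def intro!: add\<close>)
  from this[of "Poly_Mapping.keys x"] show ?thesis
    by (simp add: sum_monomials)
qed

lemma osr_homogeneous_add: "x \<in> osr_homogeneous i \<Longrightarrow> y \<in> osr_homogeneous i \<Longrightarrow> x + y \<in> osr_homogeneous i"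
  using Poly_Mapping.keys_add[of x y] by (auto simp: osr_homogeneous_def)

lemma osr_homogeneous_scale: "x \<in> osr_homogeneous i \<Longrightarrow> osr_scale c x \<in> osr_homogeneous i"
  using keys_osr_scale[of c x] by (auto simp: osr_homogeneous_def)

lemma osr_homogeneous_single: "Poly_Mapping.single b c \<in> osr_homogeneous (osr_basis_parity b)"
  by (auto simp: osr_homogeneous_def split: if_splits)

lemma osr_homogeneous_zero: "0 \<in> osr_homogeneous i"
  by (auto simp: osr_homogeneous_def)

lemma osr_homogeneous_minus: "x \<in> osr_homogeneous i \<Longrightarrow> - x \<in> osr_homogeneous i"
  using osr_homogeneous_scale[of x i "-1"] by (simp add: osr_scale_linear)

lemma osr_basis_bracket_part:
  "osr_basis_bracket a b \<in> osr_homogeneous (osr_basis_parity a + osr_basis_parity b)"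
  by (cases "(a, b)" rule: osr_basis_bracket.cases)
    (auto simp: osr_homogeneous_def split: if_splits dest!: subsetD[OF Poly_Mapping.keys_add] subsetD[OF keys_diff])

lemma osr_bracket_part:
  assumes "x \<in> osr_homogeneous i" "y \<in> osr_homogeneous j"
  shows "osr_bracket x y \<in> osr_homogeneous (i + j)"
  using assms
proof (induction x rule: osr_homogeneous_induct)
  case (single b c)
  show ?case using single(2)
  proof (induction y rule: osr_homogeneous_induct)
    case (single b' c')
    then show ?case using osr_basis_bracket_part[of b b'] \<open>osr_basis_parity b = i\<close>
      by (auto simp: osr_bracket_single osr_homogeneous_scale)
  qed (auto simp: osr_bracket_add_right osr_homogeneous_zero osr_homogeneous_add)
qed (auto simp: osr_bracket_add_left osr_homogeneous_zero osr_homogeneous_add)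

lemma osr_basis_bracket_skew:
  "osr_basis_bracket a b =
     osr_scale (- koszul_sign (osr_basis_parity a) (osr_basis_parity b)) (osr_basis_bracket b a)"
  by (cases a; cases b; rule poly_mapping_eqI)
   (auto simp: koszul_sign_def lookup_add lookup_single when_def algebra_simps lookup_minus power3_eq_cube add_eq_0_iff)

lemma osr_bracket_skew:
  assumes "x \<in> osr_homogeneous i" "y \<in> osr_homogeneous j"
  shows "osr_bracket x y = osr_scale (- koszul_sign i j) (osr_bracket y x)"
  using assms
proof (induction x rule: osr_homogeneous_induct)
  case (single b c)
  show ?case using single(2)
  proof (induction y rule: osr_homogeneous_induct)
    case (single b' c')
    then show ?case using osr_basis_bracket_skew[of b b'] \<open>osr_basis_parity b = i\<close>
      by (auto simp: osr_bracket_single osr_scale_linear mult_ac)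
  qed (auto simp: osr_bracket_add_right osr_bracket_add_left osr_scale_linear)
qed (auto simp: osr_bracket_add_right osr_bracket_add_left osr_scale_linear)

lemma osr_single_eq_scale: "Poly_Mapping.single a c = osr_scale c (Poly_Mapping.single a 1)"
  by (simp add: osr_scale_linear)

lemma if_single: "(if P then Poly_Mapping.single b c else 0) = Poly_Mapping.single b (if P then c else 0)"
  by simp

lemma virasoro_cocycle:
  fixes p q :: complex
  shows "q * q / 12 + (q * (- p - q) / 12 + (p * (p * (p * q)) / 4 + (p * (q * (q * q)) / 6 +
      (p * (p * (p * p)) / 12 + p * (p * (p * (- p - q))) / 12)))) =
    p * p / 12 + (p * (- p - q) / 12 + (p * (p * (p * q)) / 6 + (p * (q * (q * q)) / 4 +
      (q * (q * (q * q)) / 12 + q * (q * (q * (- p - q))) / 12))))" (is "?l = ?r")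
proof -
  have quarter: "x / 4 = 3 * (x / 12)" and sixth: "x / 6 = 2 * (x / 12)" for x :: complex
    by simp_all
  have "12 * ?l = 12 * ?r"
    unfolding quarter sixth distrib_left by (simp add: algebra_simps diff_divide_distrib)
  then show ?thesis by (rule mult_left_cancel[THEN iffD1, rotated]) (rule zero_neq_numeral[symmetric])
qed

lemma osr_basis_jacobi:
  "osr_bracket (Poly_Mapping.single a 1) (osr_basis_bracket b c) =
     osr_bracket (osr_basis_bracket a b) (Poly_Mapping.single c 1) +
     osr_scale (koszul_sign (osr_basis_parity a) (osr_basis_parity b))
       (osr_bracket (Poly_Mapping.single b 1) (osr_basis_bracket a c))"
  apply (cases a; cases b; cases c; rule poly_mapping_eqI)
  apply (simp_all add: koszul_sign_def osr_bracket_add_right osr_bracket_add_left osr_bracket_minus osr_bracket_diff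
       osr_bracket_single lookup_add lookup_minus lookup_single osr_scale_linear if_single
        split del: if_split cong: if_cong)
  apply (auto simp: algebra_simps power3_eq_cube when_def add_eq_0_iff add_divide_distrib diff_divide_distrib)
  subgoal for p q r
  proof -
    assume "q + r = - p"
    then have r: "complex_of_int r = - of_int p - of_int q"
      by (metis add_diff_cancel_left' of_int_diff of_int_minus)
    show ?thesis
      unfolding r by (rule virasoro_cocycle)
  qed
  done

lemma osr_bracket_jacobi:
  assumes "x \<in> osr_homogeneous i" "y \<in> osr_homogeneous j" "z \<in> osr_homogeneous k"
  shows "osr_bracket x (osr_bracket y z) = osr_bracket (osr_bracket x y) z +
    osr_scale (koszul_sign i j) (osr_bracket y (osr_bracket x z))"
  using assms
proof (induction x rule: osr_homogeneous_induct)
  case (single b c)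
  show ?case using single(2,3)
  proof (induction y rule: osr_homogeneous_induct)
    case (single b' c')
    show ?case using single(2)
    proof (induction z rule: osr_homogeneous_induct)
      case (single b'' c'')
      have "osr_scale (c * (c' * c'')) (osr_bracket (Poly_Mapping.single b 1) (osr_basis_bracket b' b'')) =
        osr_scale (c * (c' * c'')) (osr_bracket (osr_basis_bracket b b') (Poly_Mapping.single b'' 1) +
          osr_scale (koszul_sign i j) (osr_bracket (Poly_Mapping.single b' 1) (osr_basis_bracket b b'')))"
        using osr_basis_jacobi[of b b' b''] \<open>osr_basis_parity b = i\<close> \<open>osr_basis_parity b' = j\<close> by simp
      then show ?case
        by (simp add: osr_single_eq_scale[of b c] osr_single_eq_scale[of b' c']
           osr_single_eq_scale[of b'' c''] osr_bracket_scale_left osr_bracket_scale_right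
           osr_bracket_single osr_scale_linear(1,6,7) mult_ac)
    qed (auto simp: osr_bracket_add_right osr_bracket_add_left osr_scale_linear)
  qed (auto simp: osr_bracket_add_right osr_bracket_add_left osr_scale_linear)
qed (auto simp: osr_bracket_add_right osr_bracket_add_left osr_scale_linear)

lemma osr_T_bracket_closed:
  assumes "Poly_Mapping.keys x \<subseteq> osr_T_basis d" "Poly_Mapping.keys y \<subseteq> osr_T_basis d"
  shows "Poly_Mapping.keys (osr_bracket x y) \<subseteq> osr_T_basis d"
proof -
  have mem: "Lgen i \<in> osr_T_basis d \<longleftrightarrow> i \<ge> 0" "Wgen i \<in> osr_T_basis d \<longleftrightarrow> i \<ge> - int d"
    "Ggen i \<in> osr_T_basis d \<longleftrightarrow> i \<ge> 1" "Cgen1 \<in> osr_T_basis d" "Cgen2 \<in> osr_T_basis d" for i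
    by (auto simp: osr_T_basis_def intro: exI[of _ "i + int d"])
  have "Poly_Mapping.keys (osr_basis_bracket a b) \<subseteq> osr_T_basis d"
    if "a \<in> osr_T_basis d" "b \<in> osr_T_basis d" for a b
    using that by (cases "(a, b)" rule: osr_basis_bracket.cases)
      (auto simp: mem split: if_splits dest!: subsetD[OF Poly_Mapping.keys_add] subsetD[OF keys_diff])
  then have "Poly_Mapping.keys (osr_scale c (osr_basis_bracket a b)) \<subseteq> osr_T_basis d"
    if "a \<in> osr_T_basis d" "b \<in> osr_T_basis d" for a b c
    using that keys_osr_scale by blast
  then show ?thesis using assms unfolding osr_bracket_def
    by (intro order.trans[OF keys_sum] UN_least) blast
qed

lemma osr_sub_lie_superalgebra:
  assumes B: "\<And>x y. Poly_Mapping.keys x \<subseteq> B \<Longrightarrow> Poly_Mapping.keys y \<subseteq> B \<Longrightarrow>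
    Poly_Mapping.keys (osr_bracket x y) \<subseteq> B"
  shows "lie_superalgebra (sub_superalgebra osr_algebra {x. Poly_Mapping.keys x \<subseteq> B})"
proof -
  let ?H = "{x :: osr_basis \<Rightarrow>\<^sub>0 complex. Poly_Mapping.keys x \<subseteq> B}"
  let ?g = "sub_superalgebra osr_algebra ?H"
  have sel: "carrier ?g = ?H" "add ?g = (+)" "ring.zero ?g = 0" "module.smult ?g = osr_scale"
    "bracket ?g = osr_bracket" "parity_part ?g = (\<lambda>i. osr_homogeneous i \<inter> ?H)"
    by (simp_all add: sub_superalgebra_def osr_algebra_def osr_homogeneous_def)
  have H: "0 \<in> ?H" "\<And>x y. x \<in> ?H \<Longrightarrow> y \<in> ?H \<Longrightarrow> x + y \<in> ?H" "\<And>x c. x \<in> ?H \<Longrightarrow> osr_scale c x \<in> ?H"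
     "\<And>x. x \<in> ?H \<Longrightarrow> - x \<in> ?H"
    by (auto dest!: subsetD[OF Poly_Mapping.keys_add] subsetD[OF keys_osr_scale])
  interpret R: cring complex_ring by (rule cring_from_type_algebra)
  interpret A: abelian_group ?g
  proof (rule abelian_groupI)
    show "\<exists>y\<in>carrier ?g. y \<oplus>\<^bsub>?g\<^esub> x = \<zero>\<^bsub>?g\<^esub>" if "x \<in> carrier ?g" for x
      using that by (intro bexI[of _ "- x"]) (auto simp: sel)
  qed (use H in \<open>auto simp: sel ac_simps\<close>)
  interpret M: module complex_ring ?g
    by unfold_locales (use H in \<open>auto simp: sel osr_scale_linear ring_of_type_algebra_def\<close>)
  have inv: "\<ominus>\<^bsub>?g\<^esub> x = - x" if "x \<in> ?H" for x
    using that H by (intro A.minus_equality) (auto simp: sel)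
  have sub: "submodule (osr_homogeneous i \<inter> ?H) complex_ring ?g" for i
    by (rule M.submoduleI) (use H in \<open>auto simp: inv sel osr_homogeneous_zero osr_homogeneous_minus
        osr_homogeneous_add osr_homogeneous_scale\<close>)
  have dec: "\<exists>!p. p \<in> (osr_homogeneous 0 \<inter> ?H) \<times> (osr_homogeneous 1 \<inter> ?H) \<and> x = fst p + snd p"
    if "x \<in> ?H" for x
  proof -
    define q where "q i = (\<Sum>b\<in>{b\<in>Poly_Mapping.keys x. osr_basis_parity b = i}.
      Poly_Mapping.single b (Poly_Mapping.lookup x b))" for i
    have lq: "Poly_Mapping.lookup (q i) b = (if osr_basis_parity b = i then Poly_Mapping.lookup x b else 0)" for i b
      by (auto simp: q_def lookup_sum lookup_single when_def in_keys_iff)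
    have mem: "q i \<in> osr_homogeneous i \<inter> ?H" for i
      using that by (auto simp: osr_homogeneous_def in_keys_iff lq split: if_splits)
    have eq: "x = q 0 + q 1"
      by (rule poly_mapping_eqI) (auto simp: lookup_add lq)
    have uniq: "x0 = q 0 \<and> x1 = q 1" if "x0 \<in> osr_homogeneous 0" "x1 \<in> osr_homogeneous 1" "x = x0 + x1" for x0 x1
    proof -
      have "Poly_Mapping.lookup x0 b = 0" if "osr_basis_parity b = 1" for b
        using \<open>x0 \<in> osr_homogeneous 0\<close> that unfolding osr_homogeneous_def
        by (metis (mono_tags, lifting) in_keys_iff mem_Collect_eq zero_neq_one)
      moreover have "Poly_Mapping.lookup x1 b = 0" if "osr_basis_parity b = 0" for b
        using \<open>x1 \<in> osr_homogeneous 1\<close> that unfolding osr_homogeneous_def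
        by (metis (mono_tags, lifting) in_keys_iff mem_Collect_eq zero_neq_one)
      moreover have "osr_basis_parity b = 0 \<or> osr_basis_parity b = 1" for b
        by (cases b) auto
      ultimately show ?thesis
        unfolding poly_mapping_eq_iff fun_eq_iff lq \<open>x = x0 + x1\<close> lookup_add
        by (metis add.left_neutral add.right_neutral zero_neq_one)
    qed
    show ?thesis
      by (rule ex1I[of _ "(q 0, q 1)"]) (use mem eq uniq in \<open>auto\<close>)
  qed
  show ?thesis
  proof (intro lie_superalgebra.intro super_space.intro super_space_axioms.intro
      lie_superalgebra_axioms.intro M.module_axioms)
    show "submodule (parity_part ?g i) complex_ring ?g" for i
      unfolding sel by (rule sub)
    show "\<exists>!p. p \<in> parity_part ?g 0 \<times> parity_part ?g 1 \<and> x = fst p \<oplus>\<^bsub>?g\<^esub> snd p"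
      if "x \<in> carrier ?g" for x
      using dec that unfolding sel by blast
    show "bracket ?g x y \<in> parity_part ?g (i + j)"
      if "x \<in> parity_part ?g i" "y \<in> parity_part ?g j" for x y i j
      using that B osr_bracket_part unfolding sel by blast
    show "bracket ?g x y = (- koszul_sign i j) \<odot>\<^bsub>?g\<^esub> bracket ?g y x"
      if "x \<in> parity_part ?g i" "y \<in> parity_part ?g j" for x y i j
      using that osr_bracket_skew unfolding sel by blast
    show "bracket ?g x (bracket ?g y z) = bracket ?g (bracket ?g x y) z \<oplus>\<^bsub>?g\<^esub>
        koszul_sign i j \<odot>\<^bsub>?g\<^esub> bracket ?g y (bracket ?g x z)"
      if "x \<in> parity_part ?g i" "y \<in> parity_part ?g j" "z \<in> parity_part ?g k" for x y z i j k
      using that osr_bracket_jacobi unfolding sel by blast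
  qed (simp_all add: sel B osr_bracket_add_left osr_bracket_add_right
      osr_bracket_scale_left osr_bracket_scale_right)
qed

lemma osr_algebra_lie_superalgebra: "lie_superalgebra osr_algebra"
  using osr_sub_lie_superalgebra[of UNIV] by (simp add: sub_superalgebra_def osr_algebra_def)

lemma osr_T_lie_superalgebra: "lie_superalgebra (osr_T d)"
  unfolding osr_T_def by (rule osr_sub_lie_superalgebra) (rule osr_T_bracket_closed)

end

(*
Write y for the basis elements of S outside T_d: W_{-d-k}, G_{-k+1/2} and L_{-k} with k > 0.  Each of them
has a partner D in T_d (L_{t+d+k}, G_{t+k-1/2}, W_{t+k}) that annihilates V, with [D, y] acting on V as
plus or minus the injective operator t W_t + delta_{t,0} c_2, while [D, y'] vanishes on V for the letters y'
of smaller index.  A nonzero combination of monomials in the W's, then the G's, then the L's applied to V is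
therefore brought down by the partners of its largest letters to a nonzero element of 1 (x) V; for the
L's this holds modulo monomials of lower degree.  Hence every nonzero submodule of Ind(V) meets 1 (x) V,
and simplicity of V gives simplicity of Ind(V).

That V embeds into Ind(V), compatibly with the parities, is the Poincare-Birkhoff-Witt theorem.  It is
proved in dual form: a functional on the words whose letters in T_d act on V, extended by zero to the
other ordered words, extends uniquely to a functional on all words that respects the relations of U(S).
*)

theory Submission
  imports Defs
begin

section \<open>Normal forms of words\<close>

text \<open>Conclusion (i) comes before the lowering, which relies on it. For large i, G_{i-1/2} is
  a multiple of the bracket of an L that kills V with a G in T_d. The remaining ones with i > t
  anticommute on V and have square zero there, since their brackets are multiples of W_s with s > t.
  Hence they have a common nonzero null vector, and the vectors killed by all of them form a graded
  submodule.

  The order of the three layers comes from the partners, each of which has to kill all that lies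
  inside its own layer. W_{t+k} commutes with every W and G, so it kills whatever these build from
  V; G_{t+k-1/2} passes freely through the W only; L_{t+d+k} is known to kill just V. So the L are
  stripped off first and the W last.

  The parity parts of Ind(V) are defined by generators, and that they meet in zero, which is part of
  Ind(V) being a supermodule, is no formality: descent carries a common element to V, where
  functionals that vanish on one parity part of V decide the question.\<close>

definition lin :: "('b \<Rightarrow>\<^sub>0 complex) \<Rightarrow> ('b \<Rightarrow> complex) \<Rightarrow> complex" where
  "lin x f = (\<Sum>b\<in>Poly_Mapping.keys x. Poly_Mapping.lookup x b * f b)"

lemma lin_eq_sum:
  assumes "finite A" "Poly_Mapping.keys x \<subseteq> A"
  shows "lin x f = (\<Sum>b\<in>A. Poly_Mapping.lookup x b * f b)"
  unfolding lin_def using assms by (intro sum.mono_neutral_left) (auto simp: in_keys_iff)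

lemma lin_zero [simp]: "lin 0 f = 0"
  by (simp add: lin_def)

lemma lin_single [simp]: "lin (Poly_Mapping.single b c) f = c * f b"
  by (subst lin_eq_sum[of "{b}"]) auto

lemma lin_add: "lin (x + y) f = lin x f + lin y f"
proof -
  let ?A = "Poly_Mapping.keys x \<union> Poly_Mapping.keys y"
  have "Poly_Mapping.keys (x + y) \<subseteq> ?A" by (rule Poly_Mapping.keys_add)
  then show ?thesis
    by (subst (1 2 3) lin_eq_sum[of ?A]) (auto simp: lookup_add distrib_right sum.distrib)
qed

lemma lin_add_fun: "lin x (\<lambda>b. f b + g b) = lin x f + lin x g"
  by (simp add: lin_def distrib_left sum.distrib)

lemma lin_scale_fun: "lin x (\<lambda>b. c * f b) = c * lin x f"
  by (simp add: lin_def sum_distrib_left mult_ac)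

lemma lin_divide_fun: "lin x (\<lambda>b. f b / c) = lin x f / c"
  by (simp add: lin_def sum_divide_distrib)

lemma lin_zero_fun [simp]: "lin x (\<lambda>b. 0) = 0"
  by (simp add: lin_def)

lemma lin_cong: "(\<And>b. b \<in> Poly_Mapping.keys x \<Longrightarrow> f b = g b) \<Longrightarrow> lin x f = lin x g"
  by (simp add: lin_def)

lemma lin_swap: "lin x (\<lambda>a. lin y (\<lambda>b. f a b)) = lin y (\<lambda>b. lin x (\<lambda>a. f a b))"
  unfolding lin_def sum_distrib_left by (subst sum.swap) (simp add: mult_ac)

text \<open>A Lie superalgebra given by structure constants on a totally ordered homogeneous basis.
  Skew symmetry and the Jacobi identity are tested against an arbitrary functional \<open>f\<close>,
  the only form in which the straightening of functionals meets them.\<close>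

locale super_basis =
  fixes br :: "'b \<Rightarrow> 'b \<Rightarrow> 'b \<Rightarrow>\<^sub>0 complex" and par :: "'b \<Rightarrow> bit" and lt :: "'b \<Rightarrow> 'b \<Rightarrow> bool"
  assumes lt_irrefl: "\<not> lt a a"
    and lt_trans: "lt a b \<Longrightarrow> lt b c \<Longrightarrow> lt a c"
    and lt_total: "a \<noteq> b \<Longrightarrow> lt a b \<or> lt b a"
    and br_par: "c \<in> Poly_Mapping.keys (br a b) \<Longrightarrow> par c = par a + par b"
    and br_skew: "lin (br a b) f = - koszul_sign (par a) (par b) * lin (br b a) f"
    and br_jacobi: "lin (br b c) (\<lambda>e. lin (br a e) f) =
      lin (br a b) (\<lambda>e. lin (br e c) f) +
      koszul_sign (par a) (par b) * lin (br a c) (\<lambda>e. lin (br b e) f)"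
begin

abbreviation \<kappa> :: "'b \<Rightarrow> 'b \<Rightarrow> complex" where
  "\<kappa> a b \<equiv> koszul_sign (par a) (par b)"

lemma sign_mult_self [simp]: "\<kappa> a b * \<kappa> a b = 1"
  by (simp add: koszul_sign_def)

lemma sign_commute: "\<kappa> a b = \<kappa> b a"
  by (simp add: koszul_sign_def)

lemma sign_add:
  assumes "par e = par a + par b"
  shows "\<kappa> e c = \<kappa> a c * \<kappa> b c" "\<kappa> c e = \<kappa> a c * \<kappa> b c"
  using assms by (cases "par a"; cases "par b"; cases "par c"; simp add: koszul_sign_def)+

text \<open>Words without descents are the Poincare-Birkhoff-Witt monomials: letters increase
  weakly, and only even letters may repeat.\<close>

definition descent :: "'b \<Rightarrow> 'b \<Rightarrow> bool" where
  "descent a b \<longleftrightarrow> lt b a \<or> a = b \<and> par a = 1"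

section \<open>Termination of straightening\<close>

fun inv_count :: "'b list \<Rightarrow> nat" where
  "inv_count [] = 0"
| "inv_count (a # w) = length (filter (\<lambda>b. lt b a) w) + inv_count w"

lemma lt_asym: "lt a b \<Longrightarrow> \<not> lt b a"
  using lt_trans lt_irrefl by blast

lemma inv_count_swap:
  "lt b a \<Longrightarrow> inv_count (u @ a # b # v) = Suc (inv_count (u @ b # a # v))"
  by (induction u) (auto dest: lt_asym)

text \<open>Straightening a strict descent gives the swapped word, of equal length with one
  inversion fewer, and words one letter shorter. Length is compared first because the new letter may
  create inversions.\<close>

definition word_less :: "('b list \<times> 'b list) set" where
  "word_less = inv_image (less_than <*lex*> less_than) (\<lambda>w. (length w, inv_count w))"

lemma wf_word_less: "wf word_less"
  unfolding word_less_def by (intro wf_inv_image wf_lex_prod wf_less_than)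

lemma word_less_swap: "lt b a \<Longrightarrow> (u @ b # a # v, u @ a # b # v) \<in> word_less"
  by (simp add: word_less_def inv_count_swap)

lemma word_less_length: "length w < length w' \<Longrightarrow> (w, w') \<in> word_less"
  by (simp add: word_less_def)

text \<open>
  The value that the relation at a descent \<open>a b\<close> forces on a functional of words, in terms of its
  values \<open>F\<close> on words in which \<open>a b\<close> is replaced.  For \<open>a = b\<close> odd the relation reads
  \<open>2 a a = [a, a]\<close>.
\<close>

definition rewrite :: "('b list \<Rightarrow> complex) \<Rightarrow> 'b \<Rightarrow> 'b \<Rightarrow> complex" where
  "rewrite F a b = (if a = b then lin (br a b) (\<lambda>c. F [c]) / 2
     else \<kappa> a b * F [b, a] + lin (br a b) (\<lambda>c. F [c]))"

definition splits :: "'b list \<Rightarrow> ('b list \<times> 'b \<times> 'b \<times> 'b list) set" where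
  "splits w = {(u, a, b, v). w = u @ a # b # v \<and> descent a b}"

definition some_split :: "'b list \<Rightarrow> 'b list \<times> 'b \<times> 'b \<times> 'b list" where
  "some_split w = (SOME s. s \<in> splits w)"

lemma some_split: "splits w \<noteq> {} \<Longrightarrow> some_split w \<in> splits w"
  unfolding some_split_def by (rule someI_ex) blast

definition nf_step :: "('b list \<Rightarrow> complex) \<Rightarrow> ('b list \<Rightarrow> complex) \<Rightarrow> 'b list \<Rightarrow> complex" where
  "nf_step \<phi> F w = (if splits w = {} then \<phi> w
     else (case some_split w of (u, a, b, v) \<Rightarrow> rewrite (\<lambda>z. F (u @ z @ v)) a b))"

text \<open>The values on ordered words are prescribed by \<open>\<phi>\<close>; every other word is
  reduced at one descent picked by choice. That the pick does not matter is
  \<open>nf_split\<close>.\<close>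

definition nf :: "('b list \<Rightarrow> complex) \<Rightarrow> 'b list \<Rightarrow> complex" where
  "nf \<phi> = wfrec word_less (nf_step \<phi>)"

lemma rewrite_cong:
  assumes "\<And>c. c \<in> Poly_Mapping.keys (br a b) \<Longrightarrow> F [c] = G [c]" "a \<noteq> b \<Longrightarrow> F [b, a] = G [b, a]"
  shows "rewrite F a b = rewrite G a b"
  unfolding rewrite_def using assms by (auto cong: lin_cong)

lemma splits_rewrite_cong:
  assumes "(u, a, b, v) \<in> splits w" "\<And>w'. (w', w) \<in> word_less \<Longrightarrow> F w' = G w'"
  shows "rewrite (\<lambda>z. F (u @ z @ v)) a b = rewrite (\<lambda>z. G (u @ z @ v)) a b"
proof (rule rewrite_cong)
  from assms(1) have w: "w = u @ a # b # v" and d: "descent a b"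
    by (auto simp: splits_def)
  show "F (u @ [c] @ v) = G (u @ [c] @ v)" for c
    by (intro assms(2) word_less_length) (simp add: w)
  show "F (u @ [b, a] @ v) = G (u @ [b, a] @ v)" if "a \<noteq> b"
    using d that word_less_swap[of b a u v] by (intro assms(2)) (auto simp: w descent_def)
qed

lemma nf_unfold: "nf \<phi> w = nf_step \<phi> (nf \<phi>) w"
proof -
  have "nf \<phi> w = nf_step \<phi> (cut (nf \<phi>) word_less w) w"
    unfolding nf_def by (subst wfrec[OF wf_word_less]) simp
  also have "\<dots> = nf_step \<phi> (nf \<phi>) w"
  proof (cases "splits w = {}")
    case False
    obtain u a b v where s: "some_split w = (u, a, b, v)" by (cases "some_split w")
    have "(u, a, b, v) \<in> splits w" using some_split[OF False] s by simp
    from splits_rewrite_cong[OF this, of "cut (nf \<phi>) word_less w" "nf \<phi>"] False s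
    show ?thesis by (simp add: nf_step_def cut_apply)
  qed (simp add: nf_step_def)
  finally show ?thesis .
qed

lemma nf_sorted: "splits w = {} \<Longrightarrow> nf \<phi> w = \<phi> w"
  by (subst nf_unfold) (simp add: nf_step_def)

definition relation_at :: "('b list \<Rightarrow> complex) \<Rightarrow> 'b \<Rightarrow> 'b \<Rightarrow> bool" where
  "relation_at F a b \<longleftrightarrow> F [a, b] = \<kappa> a b * F [b, a] + lin (br a b) (\<lambda>c. F [c])"

lemma relation_at_rewrite: "descent a b \<Longrightarrow> F [a, b] = rewrite F a b \<longleftrightarrow> relation_at F a b"
  by (auto simp: descent_def relation_at_def rewrite_def lt_irrefl koszul_sign_def field_simps)

lemma br_skew': "lin (br b a) f = - \<kappa> a b * lin (br a b) f"
  by (subst br_skew) (simp add: sign_commute)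

lemma relation_at_swap: "relation_at F a b \<Longrightarrow> relation_at F b a"
  unfolding relation_at_def br_skew'[of b a]
  by (simp add: distrib_left sign_commute[of b a] flip: mult.assoc)

text \<open>Skew symmetry makes the relations at \<open>a b\<close> and at \<open>b a\<close>
  equivalent, and it forces \<open>[a, a] = 0\<close> for even \<open>a\<close>. So descents are the
  only pairs to be checked.\<close>

lemma relation_at_all:
  assumes "\<And>a b. descent a b \<Longrightarrow> relation_at F a b"
  shows "relation_at F a b"
proof -
  consider "descent a b" | "descent b a" | "a = b" "par a = 0"
    using lt_total[of a b] by (cases "par a") (auto simp: descent_def)
  then show ?thesis
  proof cases
    case 3
    have "lin (br a a) f = 0" for f
      using br_skew[of a a f] 3 by (simp add: koszul_sign_def)
    then show ?thesis using 3 by (simp add: relation_at_def koszul_sign_def)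
  qed (use assms relation_at_swap in auto)
qed

section \<open>Confluence of straightening\<close>

lemma rewrite_commute:
  "rewrite (\<lambda>z. rewrite (\<lambda>z'. F z z') c d) a b = rewrite (\<lambda>z'. rewrite (\<lambda>z. F z z') a b) c d"
  unfolding rewrite_def
  using lin_swap[of "br a b" "br c d" "\<lambda>e f. F [e] [f]"]
  by (auto simp: lin_add_fun lin_scale_fun lin_divide_fun algebra_simps add_divide_distrib)

text \<open>The overlap ambiguities \<open>a b c\<close> are resolved by the Jacobi identity.\<close>

lemma rewrite_overlap:
  assumes d: "descent a b" "descent b c"
    and short: "\<And>x y. relation_at F x y"
    and r1: "lt b a \<Longrightarrow> relation_at (\<lambda>z. F ([b] @ z)) a c" "lt b a \<Longrightarrow> relation_at (\<lambda>z. F (z @ [a])) b c"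
    and r2: "lt c b \<Longrightarrow> relation_at (\<lambda>z. F (z @ [b])) a c" "lt c b \<Longrightarrow> relation_at (\<lambda>z. F ([c] @ z)) a b"
  shows "rewrite (\<lambda>z. F (z @ [c])) a b = rewrite (\<lambda>z. F ([a] @ z)) b c"
proof -
  have short': "F [x, y] = \<kappa> x y * F [y, x] + lin (br x y) (\<lambda>c. F [c])" for x y
    using short unfolding relation_at_def by blast
  \<comment> \<open>All letters \<open>e\<close> of \<open>[a, b]\<close> have the parity of
    \<open>a\<close> plus that of \<open>b\<close>, so moving \<open>c\<close> past \<open>e\<close>
    costs the same sign for each of them and the sign leaves the sum.\<close>
  have P1: "lin (br a b) (\<lambda>e. F [e, c]) = \<kappa> a c * \<kappa> b c * lin (br a b) (\<lambda>e. F [c, e]) +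
      lin (br a b) (\<lambda>e. lin (br e c) (\<lambda>f. F [f]))" for a b c
    unfolding lin_scale_fun[symmetric] lin_add_fun[symmetric]
  proof (rule lin_cong)
    fix e assume "e \<in> Poly_Mapping.keys (br a b)"
    then show "F [e, c] = \<kappa> a c * \<kappa> b c * F [c, e] + lin (br e c) (\<lambda>f. F [f])"
      using short'[of e c] sign_add(1)[OF br_par, of e a b c] by simp
  qed
  have P2: "lin (br a c) (\<lambda>e. F [b, e]) = \<kappa> a b * \<kappa> b c * lin (br a c) (\<lambda>e. F [e, b]) +
      lin (br a c) (\<lambda>e. lin (br b e) (\<lambda>f. F [f]))" for a b c
    unfolding lin_scale_fun[symmetric] lin_add_fun[symmetric]
  proof (rule lin_cong)
    fix e assume "e \<in> Poly_Mapping.keys (br a c)"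
    then show "F [b, e] = \<kappa> a b * \<kappa> b c * F [e, b] + lin (br b e) (\<lambda>f. F [f])"
      using short'[of b e] sign_add(2)[OF br_par, of e a c b] sign_commute[of b c] by simp
  qed
  note J3 = br_jacobi[of b c a "\<lambda>f. F [f]"]
  have sgn: "\<kappa> x y = 1 \<or> \<kappa> x y = -1" for x y by (simp add: koszul_sign_def)
  consider "a = b" "b = c" | "a = b" "b \<noteq> c" | "a \<noteq> b" "b = c" | "a \<noteq> b" "b \<noteq> c" by blast
  then show ?thesis
  proof cases
    case 1
    with d lt_irrefl have "\<kappa> a a = -1" by (auto simp: descent_def koszul_sign_def)
    then have e: "lin (br a a) (\<lambda>e. F [e, a]) =
        lin (br a a) (\<lambda>e. F [a, e]) + lin (br a a) (\<lambda>e. lin (br e a) (\<lambda>f. F [f]))"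
      "lin (br a a) (\<lambda>e. F [a, e]) =
        lin (br a a) (\<lambda>e. F [e, a]) + lin (br a a) (\<lambda>e. lin (br a e) (\<lambda>f. F [f]))"
      "lin (br a a) (\<lambda>e. lin (br a e) (\<lambda>f. F [f])) =
        lin (br a a) (\<lambda>e. lin (br e a) (\<lambda>f. F [f])) - lin (br a a) (\<lambda>e. lin (br a e) (\<lambda>f. F [f]))"
      using P1[of a a a] P2[of a a a] J3 1 by simp_all
    \<comment> \<open>The two reductions differ by the double bracket of an odd \<open>a\<close>
      with itself, and the Jacobi identity says that three times this double bracket is
      zero.\<close>
    have "x = y" if "x = y + p" "y = x + q" "q = p - q" for x y p q :: complex
    proof -
      have p: "p = x - y" using that(1) by simp
      have q: "q = y - x" using that(2) by simp
      have "3 * (x - y) = 0" using that(3) unfolding p q by (simp add: algebra_simps)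
      then show ?thesis by simp
    qed
    from this[OF e] 1 show ?thesis by (simp add: rewrite_def)
  next
    case 2
    with d lt_irrefl have p: "lt c b" and s: "\<kappa> b b = -1" by (auto simp: descent_def koszul_sign_def)
    from r2[OF p] have q: "F [b, c, b] = \<kappa> b c * F [c, b, b] + lin (br b c) (\<lambda>e. F [e, b])"
       "F [c, b, b] = lin (br b b) (\<lambda>e. F [c, e]) / 2"
      by (auto simp: relation_at_def s 2 field_simps)
    have J: "lin (br b b) (\<lambda>e. lin (br e c) (\<lambda>f. F [f])) = 2 * lin (br b c) (\<lambda>e. lin (br b e) (\<lambda>f. F [f]))"
      using J3 by (simp add: 2 s)
    have *: "x / 2 = k * f + p"
      if "k = 1 \<or> k = -1" "x = k * k * z + 2 * j" "p = -1 * k * r + j" "f = k * g + r" "g = z / 2"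
      for x k f p z j g r :: complex
      using that(1) by (elim disjE) (simp_all add: that(2-5))
    show ?thesis
      using *[OF sgn[of b c] P1[of b b c, unfolded J] P2[of b c b, unfolded s] q] 2 by (simp add: rewrite_def)
  next
    case 3
    with d lt_irrefl have p: "lt b a" and s: "\<kappa> b b = -1" by (auto simp: descent_def koszul_sign_def)
    from r1[OF p, folded 3(2)] have q: "F [b, a, b] = \<kappa> a b * F [b, b, a] + lin (br a b) (\<lambda>e. F [b, e])"
       "F [b, b, a] = lin (br b b) (\<lambda>e. F [e, a]) / 2"
      by (auto simp: relation_at_def s field_simps)
    have "lin (br a b) (\<lambda>e. lin (br e b) (\<lambda>f. F [f])) = \<kappa> a b * lin (br a b) (\<lambda>e. lin (br b e) (\<lambda>f. F [f]))"
      using P1[of a b b] P2[of a b b] sgn[of a b] by (auto simp: s add_eq_0_iff2)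
    then have J: "lin (br b b) (\<lambda>e. lin (br a e) (\<lambda>f. F [f])) = 2 * lin (br a b) (\<lambda>e. lin (br e b) (\<lambda>f. F [f]))"
      using J3 by (simp add: 3(2)[symmetric])
    have *: "k * f + p = x / 2"
      if "k = 1 \<or> k = -1" "p = k * -1 * r + j" "f = k * g + r" "g = z / 2" "x = k * k * z + 2 * j"
      for x k f p z j g r :: complex
      using that(1) by (elim disjE) (simp_all add: that(2-5))
    show ?thesis
      using *[OF sgn[of a b] P1[of a b b, unfolded s] q P2[of b b a, unfolded J sign_commute[of b a]]] 3
      by (simp add: rewrite_def)
  next
    case 4
    with d have p: "lt c b" "lt b a" by (auto simp: descent_def)
    from r1[OF p(2)] r2[OF p(1)] have q:
       "F [b, a, c] = \<kappa> a c * F [b, c, a] + lin (br a c) (\<lambda>e. F [b, e])"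
       "F [b, c, a] = \<kappa> b c * F [c, b, a] + lin (br b c) (\<lambda>e. F [e, a])"
       "F [a, c, b] = \<kappa> a c * F [c, a, b] + lin (br a c) (\<lambda>e. F [e, b])"
       "F [c, a, b] = \<kappa> a b * F [c, b, a] + lin (br a b) (\<lambda>e. F [c, e])"
      by (auto simp: relation_at_def)
    \<comment> \<open>Both reductions end in \<open>c b a\<close>. The double brackets left over are
      \<open>j1\<close>, \<open>j2\<close> and \<open>j1 + x * j2\<close>, the three terms of the
      Jacobi identity; what remains is a scalar identity, checked for each choice of the three
      signs.\<close>
    have *: "x * bac + ab_c = z * acb + a_bc"
      if "x = 1 \<or> x = -1" "y = 1 \<or> y = -1" "z = 1 \<or> z = -1"
        "bac = y * bca + b_ac" "bca = z * cba + bc_a" "acb = y * cab + ac_b" "cab = x * cba + c_ab"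
        "ab_c = y * z * c_ab + j1" "b_ac = x * z * ac_b + j2" "a_bc = x * y * bc_a + (j1 + x * j2)"
      for x y z bac bca acb cab ab_c b_ac a_bc cba bc_a ac_b c_ab j1 j2 :: complex
      using that(1-3) by (elim disjE) (simp_all add: that(4-10))
    show ?thesis
      using *[OF sgn[of a b] sgn[of a c] sgn[of b c] q P1[of a b c] P2[of a c b]
          P2[of b c a, unfolded J3 sign_commute[of b a]]] 4
      by (simp add: rewrite_def)
  qed
qed

lemma trans_word_less: "trans word_less"
  unfolding word_less_def by (intro trans_inv_image trans_lex_prod trans_less_than)

text \<open>The diamond lemma. Two descents of a word coincide, overlap in one letter, or are
  disjoint; the last two cases are \<open>rewrite_overlap\<close> and
  \<open>rewrite_commute\<close>. The relations these need concern smaller words, where the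
  induction hypothesis supplies them.\<close>

lemma nf_split:
  assumes "(u, a, b, v) \<in> splits w"
  shows "nf \<phi> w = rewrite (\<lambda>z. nf \<phi> (u @ z @ v)) a b"
  using assms
proof (induction w arbitrary: u a b v rule: wf_induct_rule[OF wf_word_less])
  case (1 w)
  have rel: "relation_at (\<lambda>z. nf \<phi> (u @ z @ v)) x y"
    if "(u @ [x, y] @ v, w) \<in> word_less" "descent x y" for u v x y
    using "1.IH"[of "u @ [x, y] @ v" u x y v] that
    by (subst relation_at_rewrite[symmetric]) (auto simp: splits_def)
  have *: "rewrite (\<lambda>z. nf \<phi> (u @ z @ v)) a b = rewrite (\<lambda>z. nf \<phi> (u' @ z @ v')) c d"
    if s: "(u, a, b, v) \<in> splits w" "(u', c, d, v') \<in> splits w" and le: "length u \<le> length u'"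
    for u a b v u' c d v'
  proof -
    from s have w: "w = u @ a # b # v" "w = u' @ c # d # v'" and d: "descent a b" "descent c d"
      by (auto simp: splits_def)
    then obtain y where y: "u' = u @ y" "a # b # v = y @ c # d # v'"
      using le by (auto simp: append_eq_append_conv2)
    consider "y = []" | "y = [a]" | x where "y = a # b # x"
      using y(2) by (metis append_Cons append_Nil list.exhaust list.inject)
    then show ?thesis
    proof cases
      case 1
      then show ?thesis using y by simp
    next
      case 2
      with y have e: "c = b" "v = d # v'" "u' = u @ [a]" by simp_all
      let ?F = "\<lambda>z. nf \<phi> (u @ z @ v')"
      have w': "w = u @ [a, b, d] @ v'" using w e by simp
      have less1: "(u @ [b, a, d] @ v', w) \<in> word_less" if "lt b a"
        using word_less_swap[OF that, of u "d # v'"] w' by simp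
      have less2: "(u @ [a, d, b] @ v', w) \<in> word_less" if "lt d b"
        using word_less_swap[OF that, of "u @ [a]" v'] w' by simp
      \<comment> \<open>Of the two consecutive descents \<open>a b\<close> and \<open>b d\<close>,
        one strict descent suffices for \<open>lt d a\<close>. So exchanging \<open>a\<close> and
        \<open>d\<close> makes the word smaller as well.\<close>
      have lt: "lt b a \<or> lt d b \<Longrightarrow> lt d a"
        using d lt_trans e by (auto simp: descent_def)
      have less3: "(u @ [b, d, a] @ v', w) \<in> word_less" if "lt b a"
        using word_less_swap[of d a "u @ [b]" v'] lt that transD[OF trans_word_less _ less1[OF that]] by simp
      have less4: "(u @ [d, a, b] @ v', w) \<in> word_less" if "lt d b"
        using word_less_swap[of d a u "b # v'"] lt that transD[OF trans_word_less _ less2[OF that]] by simp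
      have "rewrite (\<lambda>z. ?F (z @ [d])) a b = rewrite (\<lambda>z. ?F ([a] @ z)) b d"
      proof (rule rewrite_overlap)
        show "relation_at ?F x y" for x y
          by (rule relation_at_all, rule rel) (auto intro!: word_less_length simp: w')
        show "relation_at (\<lambda>z. ?F ([b] @ z)) a d" if "lt b a"
          using rel[of "u @ [b]" a d v'] less1 that lt by (simp add: descent_def)
        show "relation_at (\<lambda>z. ?F (z @ [a])) b d" if "lt b a"
          using rel[of "u" b d "[a] @ v'"] less3 that lt d e by simp
        show "relation_at (\<lambda>z. ?F (z @ [b])) a d" if "lt d b"
          using rel[of "u" a d "[b] @ v'"] less2 that lt by (simp add: descent_def)
        show "relation_at (\<lambda>z. ?F ([d] @ z)) a b" if "lt d b"
          using rel[of "u @ [d]" a b v'] less4 that lt d by simp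
      qed (use d e in auto)
      then show ?thesis using e by simp
    next
      case (3 x)
      with y have e: "v = x @ c # d # v'" "u' = u @ a # b # x" by simp_all
      \<comment> \<open>Both descents get expanded, in either order: each word arising from one
        expansion is smaller than \<open>w\<close> and still contains the other descent.\<close>
      have "rewrite (\<lambda>z. nf \<phi> (u @ z @ v)) a b =
          rewrite (\<lambda>z. rewrite (\<lambda>z'. nf \<phi> (u @ z @ x @ z' @ v')) c d) a b"
      proof (rule rewrite_cong)
        fix e
        have "nf \<phi> (u @ [e] @ x @ c # d # v') = rewrite (\<lambda>z'. nf \<phi> ((u @ [e] @ x) @ z' @ v')) c d"
          using d by (intro "1.IH") (auto simp: splits_def w(1) e intro!: word_less_length)
        then show "nf \<phi> (u @ [e] @ v) = rewrite (\<lambda>z'. nf \<phi> (u @ [e] @ x @ z' @ v')) c d"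
          by (simp add: e(1))
      next
        assume "a \<noteq> b"
        then have "lt b a" using d by (auto simp: descent_def)
        from word_less_swap[OF this, of u v]
        have "nf \<phi> (u @ [b, a] @ x @ c # d # v') = rewrite (\<lambda>z'. nf \<phi> ((u @ [b, a] @ x) @ z' @ v')) c d"
          using d by (intro "1.IH") (auto simp: splits_def w(1) e)
        then show "nf \<phi> (u @ [b, a] @ v) = rewrite (\<lambda>z'. nf \<phi> (u @ [b, a] @ x @ z' @ v')) c d"
          by (simp add: e)
      qed
      also have "\<dots> = rewrite (\<lambda>z'. rewrite (\<lambda>z. nf \<phi> (u @ z @ x @ z' @ v')) a b) c d"
        by (rule rewrite_commute)
      also have "\<dots> = rewrite (\<lambda>z'. nf \<phi> (u' @ z' @ v')) c d"
      proof (rule rewrite_cong)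
        fix e
        have "nf \<phi> (u @ a # b # x @ [e] @ v') = rewrite (\<lambda>z. nf \<phi> (u @ z @ x @ [e] @ v')) a b"
          using d by (intro "1.IH") (auto simp: splits_def w(1) e intro!: word_less_length)
        then show "rewrite (\<lambda>z. nf \<phi> (u @ z @ x @ [e] @ v')) a b = nf \<phi> (u' @ [e] @ v')"
          by (simp add: e(2))
      next
        assume "c \<noteq> d"
        then have "lt d c" using d by (auto simp: descent_def)
        from word_less_swap[OF this, of u' v']
        have "nf \<phi> (u @ a # b # x @ [d, c] @ v') = rewrite (\<lambda>z. nf \<phi> (u @ z @ x @ [d, c] @ v')) a b"
          using d by (intro "1.IH") (auto simp: splits_def w(2) e)
        then show "rewrite (\<lambda>z. nf \<phi> (u @ z @ x @ [d, c] @ v')) a b = nf \<phi> (u' @ [d, c] @ v')"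
          by (simp add: e)
      qed
      finally show ?thesis .
    qed
  qed
  have ne: "splits w \<noteq> {}" using "1.prems" by blast
  obtain u0 a0 b0 v0 where s0: "some_split w = (u0, a0, b0, v0)" by (cases "some_split w")
  then have "(u0, a0, b0, v0) \<in> splits w" using some_split[OF ne] by simp
  from *[OF this "1.prems"] *[OF "1.prems" this]
  have "rewrite (\<lambda>z. nf \<phi> (u0 @ z @ v0)) a0 b0 = rewrite (\<lambda>z. nf \<phi> (u @ z @ v)) a b"
    by (metis nat_le_linear)
  then show ?case
    using ne s0 by (subst nf_unfold) (simp add: nf_step_def)
qed

text \<open>The linear independence half of Poincare-Birkhoff-Witt in dual form: together with
  \<open>nf_sorted\<close>, arbitrary values on the ordered words extend to a functional that
  respects all relations.\<close>

theorem nf_relation: "relation_at (\<lambda>z. nf \<phi> (u @ z @ v)) a b"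
proof (rule relation_at_all)
  fix a b assume "descent a b"
  then show "relation_at (\<lambda>z. nf \<phi> (u @ z @ v)) a b"
    using nf_split[of u a b v "u @ [a, b] @ v"]
    by (subst relation_at_rewrite[symmetric]) (auto simp: splits_def)
qed

lemma nf_induct [case_names sorted split]:
  assumes sorted: "\<And>w. splits w = {} \<Longrightarrow> P w"
    and split: "\<And>u a b v. descent a b \<Longrightarrow> (\<And>c. c \<in> Poly_Mapping.keys (br a b) \<Longrightarrow> P (u @ [c] @ v)) \<Longrightarrow>
      (a \<noteq> b \<Longrightarrow> P (u @ [b, a] @ v)) \<Longrightarrow> P (u @ [a, b] @ v)"
  shows "P w"
proof (induction w rule: wf_induct_rule[OF wf_word_less])
  case (1 w)
  show ?case
  proof (cases "splits w = {}")
    case False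
    then obtain u a b v where w: "w = u @ [a, b] @ v" "descent a b"
      by (auto simp: splits_def)
    have "P (u @ [b, a] @ v)" if "a \<noteq> b"
      using word_less_swap[of b a u v] w that by (intro 1) (auto simp: descent_def)
    moreover have "P (u @ [c] @ v)" for c
      using w by (intro 1 word_less_length) simp
    ultimately show ?thesis
      using w split by blast
  qed (rule sorted)
qed

text \<open>Straightening preserves the total parity of a word, because the letters of
  \<open>[a, b]\<close> have the summed parity of \<open>a\<close> and \<open>b\<close>.\<close>

lemma nf_parity:
  assumes "\<And>w. (\<Sum>b\<leftarrow>w. par b) \<noteq> k \<Longrightarrow> \<phi> w = 0" and "(\<Sum>b\<leftarrow>w. par b) \<noteq> k"
  shows "nf \<phi> w = 0"
  using assms(2)
proof (induction w rule: nf_induct)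
  case (sorted w)
  then show ?case using assms(1) by (simp add: nf_sorted)
next
  case (split u a b v)
  have "nf \<phi> (u @ [a, b] @ v) = rewrite (\<lambda>z. nf \<phi> (u @ z @ v)) a b"
    using split.hyps by (intro nf_split) (auto simp: splits_def)
  also have "\<dots> = rewrite (\<lambda>z. 0) a b"
  proof (rule rewrite_cong)
    show "nf \<phi> (u @ [c] @ v) = 0" if "c \<in> Poly_Mapping.keys (br a b)" for c
      using split.prems br_par[OF that] by (intro split.IH(1) that) (simp add: ac_simps del: add_bit_eq_xor)
    show "nf \<phi> (u @ [b, a] @ v) = 0" if "a \<noteq> b"
      using split.prems by (intro split.IH(2) that) (simp add: ac_simps del: add_bit_eq_xor)
  qed
  finally show ?case by (simp add: rewrite_def)
qed

section \<open>Functionals coming from a subalgebra\<close>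

definition restrict_to :: "'b set \<Rightarrow> ('b list \<Rightarrow> complex) \<Rightarrow> 'b list \<Rightarrow> complex" where
  "restrict_to T \<psi> w = (if set w \<subseteq> T then \<psi> w else 0)"

text \<open>The prefix \<open>n\<close> is ordered and its letters precede \<open>T\<close>, so all
  straightening takes place inside \<open>w\<close>. It stays within \<open>T\<close>, where
  \<open>\<psi>\<close> satisfies the relations already.\<close>

lemma nf_append_subalgebra:
  assumes T_low: "\<And>a b. a \<notin> T \<Longrightarrow> b \<in> T \<Longrightarrow> lt a b"
    and T_br: "\<And>a b. a \<in> T \<Longrightarrow> b \<in> T \<Longrightarrow> Poly_Mapping.keys (br a b) \<subseteq> T"
    and \<psi>_rel: "\<And>u a b v. set (u @ [a, b] @ v) \<subseteq> T \<Longrightarrow> relation_at (\<lambda>z. \<psi> (u @ z @ v)) a b"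
    and n: "splits n = {}" "set n \<inter> T = {}" and w: "set w \<subseteq> T"
  shows "nf (restrict_to T \<psi>) (n @ w) = (if n = [] then \<psi> w else 0)"
  using w
proof (induction w rule: nf_induct)
  case (sorted w)
  have "splits (n @ w) = {}"
  proof -
    have False if "n @ w = u @ a # b # v'" "descent a b" for u a b v'
    proof -
      from that(1) obtain y where y: "n = u @ y \<and> y @ w = a # b # v' \<or> n @ y = u \<and> w = y @ a # b # v'"
        unfolding append_eq_append_conv2 by blast
      \<comment> \<open>A descent lies within \<open>n\<close>, straddles the seam, or lies within
        \<open>w\<close>; at the seam the left letter is the smaller one.\<close>
      consider "n = u @ a # b # tl (tl y)" | "n = u @ [a]" "w = b # v'" | y where "w = y @ a # b # v'" "u = n @ y"
        using y by (cases y rule: remdups_adj.cases) auto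
      then show False
      proof cases
        case 2
        then have "a \<notin> T" "b \<in> T" using n sorted.prems by auto
        then show False using T_low[of a b] that(2) lt_asym by (auto simp: descent_def)
      next
        case (3 y)
        then have "(y, a, b, v') \<in> splits w" using that(2) by (simp add: splits_def)
        then show False using sorted.hyps by simp
      qed (use n that(2) in \<open>auto simp: splits_def\<close>)
    qed
    then show ?thesis by (auto simp: splits_def)
  qed
  then show ?case using sorted.prems n
    by (cases n) (auto simp: nf_sorted restrict_to_def)
next
  case (split u a b v')
  have T: "c \<in> T" if "c \<in> Poly_Mapping.keys (br a b)" for c
    using split.prems T_br[of a b] that by auto
  have "nf (restrict_to T \<psi>) ((n @ u) @ [a, b] @ v') = rewrite (\<lambda>z. nf (restrict_to T \<psi>) ((n @ u) @ z @ v')) a b"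
    using split.hyps by (intro nf_split) (auto simp: splits_def)
  also have "\<dots> = rewrite (\<lambda>z. if n = [] then \<psi> (u @ z @ v') else 0) a b"
    using split.IH split.prems T by (intro rewrite_cong) auto
  also have "\<dots> = (if n = [] then \<psi> (u @ [a, b] @ v') else 0)"
    using \<psi>_rel[of u a b v'] split.prems split.hyps relation_at_rewrite[of a b "\<lambda>z. \<psi> (u @ z @ v')"]
    by (auto simp: rewrite_def)
  finally show ?case by simp
qed

lemma sorted_split:
  assumes T_low: "\<And>a b. a \<notin> T \<Longrightarrow> b \<in> T \<Longrightarrow> lt a b" and "splits u = {}"
  obtains n w where "u = n @ w" "splits n = {}" "set n \<inter> T = {}" "set w \<subseteq> T"
proof -
  have "\<exists>n w. u = n @ w \<and> splits n = {} \<and> set n \<inter> T = {} \<and> set w \<subseteq> T"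
    using assms(2)
  proof (induction u)
    case Nil
    then show ?case by simp
  next
    case (Cons a u)
    have sub: "(a # x, c, d, v) \<in> splits (a # w)" if "(x, c, d, v) \<in> splits w" for x c d v w
      using that by (simp add: splits_def)
    have "splits u = {}" using Cons.prems sub by fast
    with Cons.IH obtain n w where nw: "u = n @ w" "splits n = {}" "set n \<inter> T = {}" "set w \<subseteq> T"
      by blast
    have app: "(x, c, d, v @ w) \<in> splits (n @ w)" if "(x, c, d, v) \<in> splits n" for x c d v n w
      using that by (simp add: splits_def)
    show ?case
    proof (cases "a \<in> T")
      case True
      have "n = []"
      proof (cases n)
        case (Cons c n')
        then have "descent a c" using T_low[of c a] nw True by (simp add: descent_def)
        then have "([], a, c, n' @ w) \<in> splits (a # u)" using Cons nw by (simp add: splits_def)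
        then show ?thesis using Cons.prems by simp
      qed
      then show ?thesis using nw True by (intro exI[of _ "[]"] exI[of _ "a # w"]) (simp add: splits_def)
    next
      case False
      have "splits (a # n) = {}" using app[of _ _ _ _ "a # n" w] Cons.prems nw(1) by fastforce
      then show ?thesis using nw False by (intro exI[of _ "a # n"] exI[of _ w]) simp
    qed
  qed
  then show ?thesis using that by blast
qed

text \<open>Both sides obey the same recursion on \<open>w\<close>, and on ordered words the
  previous lemma applies, since the last letter only lengthens the part in \<open>T\<close>. This is
  the source of the equivariance of \<open>hom\<close> below.\<close>

theorem nf_snoc:
  assumes T: "\<And>a b. a \<notin> T \<Longrightarrow> b \<in> T \<Longrightarrow> lt a b"
      "\<And>a b. a \<in> T \<Longrightarrow> b \<in> T \<Longrightarrow> Poly_Mapping.keys (br a b) \<subseteq> T"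
    and rel: "\<And>u a b v. set (u @ [a, b] @ v) \<subseteq> T \<Longrightarrow> relation_at (\<lambda>z. \<psi> (u @ z @ v)) a b"
    and b: "b \<in> T"
  shows "nf (restrict_to T \<psi>) (w @ [b]) = nf (restrict_to T (\<lambda>w. \<psi> (w @ [b]))) w"
proof (induction w rule: nf_induct)
  case (sorted w)
  obtain n w' where nw: "w = n @ w'" "splits n = {}" "set n \<inter> T = {}" "set w' \<subseteq> T"
    using sorted_split[of T w] T(1) sorted by blast
  have rel': "relation_at (\<lambda>z. \<psi> ((u @ z @ v) @ [b])) x y" if "set (u @ [x, y] @ v) \<subseteq> T" for u x y v
    using rel[of u x y "v @ [b]"] that b by simp
  show ?case
    using nf_append_subalgebra[OF T rel nw(2,3), of "w' @ [b]"]
      nf_append_subalgebra[where \<psi> = "\<lambda>w. \<psi> (w @ [b])", OF T rel' nw(2-4)] nw b by simp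
next
  case (split u x y v)
  have "nf (restrict_to T \<psi>) (u @ [x, y] @ (v @ [b])) =
      rewrite (\<lambda>z. nf (restrict_to T \<psi>) (u @ z @ (v @ [b]))) x y"
    using split.hyps by (intro nf_split) (auto simp: splits_def)
  also have "\<dots> = rewrite (\<lambda>z. nf (restrict_to T (\<lambda>w. \<psi> (w @ [b]))) (u @ z @ v)) x y"
    using split.IH by (intro rewrite_cong) simp_all
  also have "\<dots> = nf (restrict_to T (\<lambda>w. \<psi> (w @ [b]))) (u @ [x, y] @ v)"
    using split.hyps by (intro nf_split[symmetric]) (auto simp: splits_def)
  finally show ?case by simp
qed

end

section \<open>Descent\<close>

locale complex_space = vector_space scale
  for scale :: "complex \<Rightarrow> 'e::ab_group_add \<Rightarrow> 'e" (infixr "*s" 75)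
begin

definition lin_op :: "('e \<Rightarrow> 'e) \<Rightarrow> bool" where
  "lin_op f \<longleftrightarrow> (\<forall>x y. f (x + y) = f x + f y) \<and> (\<forall>c x. f (c *s x) = c *s f x)"

lemma lin_op_add: "lin_op f \<Longrightarrow> f (x + y) = f x + f y"
  and lin_op_scale: "lin_op f \<Longrightarrow> f (c *s x) = c *s f x"
  by (simp_all add: lin_op_def)

lemma lin_op_zero: "lin_op f \<Longrightarrow> f 0 = 0"
  using lin_op_scale[of f 0 0] by simp

lemma lin_op_minus: "lin_op f \<Longrightarrow> f (- x) = - f x"
  using lin_op_scale[of f "-1" x] by simp

lemma lin_op_diff: "lin_op f \<Longrightarrow> f (x - y) = f x - f y"
  using lin_op_add[of f x "- y"] by (simp add: lin_op_minus)

lemma lin_op_sum: "lin_op f \<Longrightarrow> f (sum g A) = (\<Sum>a\<in>A. f (g a))"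
  by (induction A rule: infinite_finite_induct) (auto simp: lin_op_zero lin_op_add)

lemma lin_op_foldr: "(\<And>k. lin_op (y k)) \<Longrightarrow> lin_op (foldr y xs)"
  by (induction xs) (auto simp: lin_op_def)

lemma lin_op_span:
  assumes f: "lin_op f" and "\<And>x. x \<in> S \<Longrightarrow> f x \<in> U" "subspace U" "e \<in> span S"
  shows "f e \<in> U"
proof -
  have "subspace {x. f x \<in> U}"
    using \<open>subspace U\<close> by (auto simp: subspace_def lin_op_zero[OF f] lin_op_add[OF f] lin_op_scale[OF f])
  from span_induct[OF assms(4) this] assms(2) show ?thesis by blast
qed

text \<open>Monomials in the \<open>y k\<close>, with the largest letter acting last.\<close>

definition monom_op :: "(nat \<Rightarrow> 'e \<Rightarrow> 'e) \<Rightarrow> nat multiset \<Rightarrow> 'e \<Rightarrow> 'e" where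
  "monom_op y \<alpha> = foldr y (rev (sorted_list_of_multiset \<alpha>))"

lemma monom_op_empty [simp]: "monom_op y {#} e = e"
  by (simp add: monom_op_def)

lemma monom_op_add_max:
  assumes "\<And>j. j \<in># \<alpha> \<Longrightarrow> j \<le> k"
  shows "monom_op y (add_mset k \<alpha>) e = y k (monom_op y \<alpha> e)"
proof -
  have "insort k (sorted_list_of_multiset \<alpha>) = sorted_list_of_multiset \<alpha> @ [k]"
    using assms by (intro sorted_insort_is_snoc) auto
  then show ?thesis by (simp add: monom_op_def)
qed

lemma lin_op_monom: "(\<And>k. lin_op (y k)) \<Longrightarrow> lin_op (monom_op y \<alpha>)"
  unfolding monom_op_def by (rule lin_op_foldr)

lemma monom_induct [case_names empty add]:
  assumes "P {#}" and "\<And>k \<alpha>. (\<And>j. j \<in># \<alpha> \<Longrightarrow> j \<le> k) \<Longrightarrow> P \<alpha> \<Longrightarrow> P (add_mset k \<alpha>)"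
  shows "P (\<alpha> :: nat multiset)"
proof (induction "size \<alpha>" arbitrary: \<alpha>)
  case 0
  then show ?case using assms(1) by simp
next
  case (Suc n)
  define k where "k = Max (set_mset \<alpha>)"
  have "set_mset \<alpha> \<noteq> {}" using Suc.hyps(2) by auto
  then have k: "k \<in># \<alpha>" "\<And>j. j \<in># \<alpha> \<Longrightarrow> j \<le> k" by (auto simp: k_def)
  then have "P (add_mset k (\<alpha> - {#k#}))"
    using Suc by (intro assms(2)) (auto simp: size_Diff_singleton dest: in_diffD)
  then show ?case using k(1) by simp
qed

text \<open>Terms with the same monomial are collected and zero coefficients dropped, the shape that
  \<open>lowering\<close> expects. Uniqueness of the coefficients is not claimed here; it is a
  consequence of lowering.\<close>

lemma span_monom_rep:
  assumes "e \<in> span {Y \<alpha> b | \<alpha> b. \<alpha> \<in> A \<and> b \<in> B}" "subspace B" "\<And>\<alpha>. lin_op (Y \<alpha>)"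
  obtains S f where "finite S" "S \<subseteq> A" "\<forall>\<alpha>\<in>S. f \<alpha> \<in> B \<and> f \<alpha> \<noteq> 0" "e = (\<Sum>\<alpha>\<in>S. Y \<alpha> (f \<alpha>))"
proof -
  have "\<exists>S f. finite S \<and> S \<subseteq> A \<and> (\<forall>\<alpha>\<in>S. f \<alpha> \<in> B) \<and> e = (\<Sum>\<alpha>\<in>S. Y \<alpha> (f \<alpha>))"
    using assms(1)
  proof (induction rule: span_induct_alt)
    case base
    show ?case by (rule exI[of _ "{}"]) auto
  next
    case (step c x y)
    then obtain \<alpha> b S f where x: "x = Y \<alpha> b" "\<alpha> \<in> A" "b \<in> B"
      and y: "finite S" "S \<subseteq> A" "\<forall>\<alpha>\<in>S. f \<alpha> \<in> B" "y = (\<Sum>\<alpha>\<in>S. Y \<alpha> (f \<alpha>))" by blast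
    define g where "g = f(\<alpha> := c *s b + (if \<alpha> \<in> S then f \<alpha> else 0))"
    have "y = (\<Sum>\<beta>\<in>insert \<alpha> S. Y \<beta> (if \<beta> \<in> S then f \<beta> else 0))"
      using y(1) by (simp add: y(4) sum.insert_if insert_absorb lin_op_zero[OF assms(3)])
    also have "\<dots> = Y \<alpha> (if \<alpha> \<in> S then f \<alpha> else 0) + (\<Sum>\<beta>\<in>S - {\<alpha>}. Y \<beta> (f \<beta>))"
      using y(1) by (subst sum.insert_remove) auto
    finally have "c *s x + y = (\<Sum>\<beta>\<in>insert \<alpha> S. Y \<beta> (g \<beta>))"
      using y(1) by (simp add: g_def x sum.insert_remove lin_op_add[OF assms(3)] lin_op_scale[OF assms(3)])
    moreover have "\<forall>\<beta>\<in>insert \<alpha> S. g \<beta> \<in> B"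
      using x y \<open>subspace B\<close> by (auto simp: g_def subspace_def)
    ultimately show ?case using x y by (intro exI[of _ "insert \<alpha> S"] exI[of _ g]) auto
  qed
  then obtain S f where S: "finite S" "S \<subseteq> A" "\<forall>\<alpha>\<in>S. f \<alpha> \<in> B" "e = (\<Sum>\<alpha>\<in>S. Y \<alpha> (f \<alpha>))" by blast
  have "e = (\<Sum>\<alpha>\<in>{\<alpha>\<in>S. f \<alpha> \<noteq> 0}. Y \<alpha> (f \<alpha>))"
    unfolding S(4) using S(1) by (intro sum.mono_neutral_right) (auto simp: lin_op_zero[OF assms(3)])
  then show ?thesis using S by (intro that[of "{\<alpha>\<in>S. f \<alpha> \<noteq> 0}" f]) auto
qed

text \<open>
  \<open>D k\<close> lowers the degree in the letter \<open>k\<close> when \<open>k\<close> is the largest letter involved, up to error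
  terms in \<open>Z\<close>.  Applying suitable \<open>D k\<close> therefore brings down a nonzero combination of monomials
  to a nonzero element of \<open>B\<close>.
\<close>

lemma lowering:
  fixes A :: "nat \<Rightarrow> nat multiset set"
  assumes D: "\<And>k. lin_op (D k)" and Z: "\<And>n. subspace (Z n)" "\<And>n k z. z \<in> Z n \<Longrightarrow> D k z \<in> Z (n - 1)"
    and base: "\<And>n. {#} \<in> A n \<Longrightarrow> Z n = {0}" "\<And>b. Y {#} b = b"
    and top: "\<And>n \<alpha> k b. add_mset k \<alpha> \<in> A n \<Longrightarrow> (\<And>j. j \<in># \<alpha> \<Longrightarrow> j \<le> k) \<Longrightarrow> b \<in> B \<Longrightarrow>
        \<alpha> \<in> A (n - 1) \<and> \<Psi> \<alpha> k b \<in> B \<and> (b \<noteq> 0 \<longrightarrow> \<Psi> \<alpha> k b \<noteq> 0) \<and>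
        D k (Y (add_mset k \<alpha>) b) - Y \<alpha> (\<Psi> \<alpha> k b) \<in> Z (n - 1)"
    and other: "\<And>n \<alpha> k b. \<alpha> \<in> A n \<Longrightarrow> (\<And>j. j \<in># \<alpha> \<Longrightarrow> j < k) \<Longrightarrow> b \<in> B \<Longrightarrow>
        D k (Y \<alpha> b) \<in> Z (n - 1)"
    and S: "finite S" "S \<subseteq> A n" "S \<noteq> {}" "\<And>\<alpha>. \<alpha> \<in> S \<Longrightarrow> f \<alpha> \<in> B \<and> f \<alpha> \<noteq> 0"
      "e - (\<Sum>\<alpha>\<in>S. Y \<alpha> (f \<alpha>)) \<in> Z n"
  obtains ks where "foldr D ks e \<in> B" "foldr D ks e \<noteq> 0"
proof -
  have "\<exists>ks. foldr D ks e \<in> B \<and> foldr D ks e \<noteq> 0"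
    using S
  \<comment> \<open>\<open>n\<close> is the degree to which \<open>A\<close> and \<open>Z\<close>
    refer. It matters for the L only; for the W and the G both families are constant and
    \<open>Z\<close> is zero.\<close>
  proof (induction "\<Sum>\<alpha>\<in>S. size \<alpha>" arbitrary: S f e n rule: less_induct)
    case less
    show ?case
    proof (cases "S = {{#}}")
      case True
      then have "e = f {#}" "f {#} \<in> B" "f {#} \<noteq> 0"
        using less.prems base(1)[of n] base(2) by auto
      then show ?thesis by (intro exI[of _ "[]"]) simp
    next
      case False
      define L where "L = (\<Union>\<alpha>\<in>S. set_mset \<alpha>)"
      have L: "finite L" "L \<noteq> {}"
        using False less.prems(1,3) by (auto simp: L_def)
      define k where "k = Max L"
      have k: "k \<in> L" "\<And>j. j \<in> L \<Longrightarrow> j \<le> k" using L by (auto simp: k_def)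
      \<comment> \<open>With \<open>k\<close> the largest letter of all monomials,
        \<open>D k\<close> takes one \<open>k\<close> from the members of \<open>S1\<close> and
        sends the other monomials into the error space. The members of \<open>S1\<close> shrink, so
        the total size drops.\<close>
      define S1 where "S1 = {\<alpha>\<in>S. k \<in># \<alpha>}"
      define S' where "S' = (\<lambda>\<alpha>. \<alpha> - {#k#}) ` S1"
      define g where "g \<alpha> = \<Psi> \<alpha> k (f (add_mset k \<alpha>))" for \<alpha>
      have S'_iff: "\<alpha> \<in> S' \<longleftrightarrow> add_mset k \<alpha> \<in> S" for \<alpha>
        unfolding S'_def S1_def by (force simp: image_iff)
      have inj: "inj_on (\<lambda>\<alpha>. \<alpha> - {#k#}) S1"
        unfolding S1_def by (rule inj_onI) (metis (no_types, lifting) insert_DiffM mem_Collect_eq)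
      have le: "j \<le> k" if "\<alpha> \<in> S" "j \<in># \<alpha>" for \<alpha> j
        using k(2)[of j] that by (auto simp: L_def)
      have T: "\<alpha> \<in> A (n - 1) \<and> g \<alpha> \<in> B \<and> g \<alpha> \<noteq> 0 \<and>
          D k (Y (add_mset k \<alpha>) (f (add_mset k \<alpha>))) - Y \<alpha> (g \<alpha>) \<in> Z (n - 1)" if "\<alpha> \<in> S'" for \<alpha>
      proof -
        have a: "add_mset k \<alpha> \<in> S" using that S'_iff by simp
        show ?thesis
          using top[of k \<alpha> n "f (add_mset k \<alpha>)"] le[OF a] less.prems(2) less.prems(4)[OF a] a
          by (auto simp: g_def)
      qed
      have sz: "(\<Sum>\<alpha>\<in>S'. size \<alpha>) < (\<Sum>\<alpha>\<in>S. size \<alpha>)"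
      proof -
        have "(\<Sum>\<alpha>\<in>S'. size \<alpha>) = (\<Sum>\<alpha>\<in>S1. size (\<alpha> - {#k#}))"
          unfolding S'_def by (subst sum.reindex[OF inj]) simp
        also have "\<dots> < (\<Sum>\<alpha>\<in>S1. size \<alpha>)"
          using k(1) less.prems(1) unfolding S1_def L_def
          by (intro sum_strict_mono) (auto intro!: size_Diff1_less)
        also have "\<dots> \<le> (\<Sum>\<alpha>\<in>S. size \<alpha>)"
          using less.prems(1) by (intro sum_mono2) (auto simp: S1_def)
        finally show ?thesis .
      qed
      have "D k e - (\<Sum>\<alpha>\<in>S'. Y \<alpha> (g \<alpha>)) \<in> Z (n - 1)"
      proof -
        have eq: "(\<Sum>\<alpha>\<in>S. D k (Y \<alpha> (f \<alpha>))) =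
            (\<Sum>\<alpha>\<in>S - S1. D k (Y \<alpha> (f \<alpha>))) + (\<Sum>\<alpha>\<in>S'. D k (Y (add_mset k \<alpha>) (f (add_mset k \<alpha>))))"
        proof -
          have "(\<Sum>\<alpha>\<in>S'. D k (Y (add_mset k \<alpha>) (f (add_mset k \<alpha>)))) = (\<Sum>\<alpha>\<in>S1. D k (Y \<alpha> (f \<alpha>)))"
            unfolding S'_def by (subst sum.reindex[OF inj]) (auto simp: S1_def intro!: sum.cong)
          moreover have "S1 \<subseteq> S" by (auto simp: S1_def)
          ultimately show ?thesis using less.prems(1) by (simp add: sum.subset_diff)
        qed
        have "D k e - (\<Sum>\<alpha>\<in>S'. Y \<alpha> (g \<alpha>)) = D k (e - (\<Sum>\<alpha>\<in>S. Y \<alpha> (f \<alpha>))) +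
            ((\<Sum>\<alpha>\<in>S - S1. D k (Y \<alpha> (f \<alpha>))) +
             (\<Sum>\<alpha>\<in>S'. D k (Y (add_mset k \<alpha>) (f (add_mset k \<alpha>))) - Y \<alpha> (g \<alpha>)))"
          by (simp add: lin_op_diff[OF D] lin_op_sum[OF D] eq sum_subtractf)
        also have "\<dots> \<in> Z (n - 1)"
        proof (intro subspace_add[OF Z(1)] subspace_sum[OF Z(1)])
          show "D k (e - (\<Sum>\<alpha>\<in>S. Y \<alpha> (f \<alpha>))) \<in> Z (n - 1)" by (rule Z(2)) (rule less.prems(5))
          show "D k (Y \<alpha> (f \<alpha>)) \<in> Z (n - 1)" if "\<alpha> \<in> S - S1" for \<alpha>
          proof (rule other)
            show "\<alpha> \<in> A n" "f \<alpha> \<in> B" using that less.prems(2,4) by auto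
            show "j < k" if "j \<in># \<alpha>" for j
              using le[of \<alpha> j] that \<open>\<alpha> \<in> S - S1\<close> by (cases "j = k") (auto simp: S1_def)
          qed
          show "D k (Y (add_mset k \<alpha>) (f (add_mset k \<alpha>))) - Y \<alpha> (g \<alpha>) \<in> Z (n - 1)" if "\<alpha> \<in> S'" for \<alpha>
            using T[OF that] by blast
        qed
        finally show ?thesis .
      qed
      moreover have "S' \<noteq> {}" using k(1) unfolding S'_def S1_def L_def by blast
      moreover have "finite S'" using less.prems(1) by (simp add: S'_def S1_def)
      ultimately obtain ks where "foldr D ks (D k e) \<in> B" "foldr D ks (D k e) \<noteq> 0"
        using less.hyps[OF sz, of "n - 1" g "D k e"] T by blast
      then show ?thesis by (intro exI[of _ "ks @ [k]"]) simp
    qed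
  qed
  then show ?thesis using that by blast
qed

end

text \<open>\<open>opr\<close> stands for the action of the basis of S on the induced module and
  \<open>B0\<close> for the image of V in it, transported to a type on which addition is total.
  \<open>G_B0\<close> is conclusion (i).\<close>

locale osr_operators = complex_space scale
  for scale :: "complex \<Rightarrow> 'e::ab_group_add \<Rightarrow> 'e" (infixr "*s" 75) +
  fixes opr :: "osr_basis \<Rightarrow> 'e \<Rightarrow> 'e" and B0 :: "'e set" and d t :: nat and c2 :: complex
  assumes lin_X: "lin_op (opr a)"
    and X_bracket: "opr a (opr a' e) = koszul_sign (osr_basis_parity a) (osr_basis_parity a') *s opr a' (opr a e) +
      (\<Sum>c\<in>Poly_Mapping.keys (osr_basis_bracket a a'). Poly_Mapping.lookup (osr_basis_bracket a a') c *s opr c e)"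
    and subspace_B0: "subspace B0"
    and X_B0: "a \<in> osr_T_basis d \<Longrightarrow> b \<in> B0 \<Longrightarrow> opr a b \<in> B0"
    and W_B0: "i > int t \<Longrightarrow> b \<in> B0 \<Longrightarrow> opr (Wgen i) b = 0"
    and L_B0: "i > int t + int d \<Longrightarrow> b \<in> B0 \<Longrightarrow> opr (Lgen i) b = 0"
    and G_B0: "i > int t \<Longrightarrow> b \<in> B0 \<Longrightarrow> opr (Ggen i) b = 0"
    and C2_B0: "b \<in> B0 \<Longrightarrow> opr Cgen2 b = c2 *s b"
    and inj_pos: "t > 0 \<Longrightarrow> b \<in> B0 \<Longrightarrow> opr (Wgen (int t)) b = 0 \<Longrightarrow> b = 0"
    and inj_zero: "t = 0 \<Longrightarrow> c2 \<noteq> 0"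
begin

abbreviation "L i \<equiv> opr (Lgen i)"
abbreviation "W i \<equiv> opr (Wgen i)"
abbreviation "G i \<equiv> opr (Ggen i)"
abbreviation "C1 \<equiv> opr Cgen1"
abbreviation "C2 \<equiv> opr Cgen2"

lemmas X_add = lin_op_add[OF lin_X] and X_scale = lin_op_scale[OF lin_X] and X_zero = lin_op_zero[OF lin_X]
  and X_minus = lin_op_minus[OF lin_X] and X_diff = lin_op_diff[OF lin_X]

definition X_ext :: "(osr_basis \<Rightarrow>\<^sub>0 complex) \<Rightarrow> 'e \<Rightarrow> 'e" where
  "X_ext x e = (\<Sum>c\<in>Poly_Mapping.keys x. Poly_Mapping.lookup x c *s opr c e)"

lemma X_ext_eq:
  "finite A \<Longrightarrow> Poly_Mapping.keys x \<subseteq> A \<Longrightarrow> X_ext x e = (\<Sum>c\<in>A. Poly_Mapping.lookup x c *s opr c e)"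
  unfolding X_ext_def by (intro sum.mono_neutral_left) (auto simp: in_keys_iff)

lemma X_ext_single: "X_ext (Poly_Mapping.single b c) e = c *s opr b e"
  by (subst X_ext_eq[of "{b}"]) auto

lemma X_ext_add: "X_ext (x + y) e = X_ext x e + X_ext y e"
proof -
  let ?A = "Poly_Mapping.keys x \<union> Poly_Mapping.keys y"
  have "Poly_Mapping.keys (x + y) \<subseteq> ?A" by (rule Poly_Mapping.keys_add)
  then show ?thesis
    by (subst (1 2 3) X_ext_eq[of ?A]) (auto simp: lookup_add scale_left_distrib sum.distrib)
qed

lemma X_ext_zero: "X_ext 0 e = 0"
  by (simp add: X_ext_def)

lemmas comm = X_bracket[folded X_ext_def]

lemma L_L: "L m (L n e) = L n (L m e) + (of_int (n - m) *s L (m + n) e +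
    (if m + n = 0 then (of_int (m ^ 3 - m) / 12) *s C1 e else 0))"
  by (subst comm) (simp add: koszul_sign_def X_ext_add X_ext_single X_ext_zero)

lemma L_W: "L m (W n e) = W n (L m e) + (of_int (m + n) *s W (m + n) e + (if m + n = 0 then C2 e else 0))"
  by (subst comm) (simp add: koszul_sign_def X_ext_add X_ext_single X_ext_zero)

lemma L_G: "L m (G k e) = G k (L m e) + (of_int k - 1 / 2) *s G (m + k) e"
  by (subst comm) (simp add: koszul_sign_def X_ext_single)

lemma G_G: "G k (G l e) = - G l (G k e) +
    (of_int (k + l - 1) *s W (k + l - 1) e + (if k + l - 1 = 0 then C2 e else 0))"
  by (subst comm) (simp add: koszul_sign_def X_ext_add X_ext_single X_ext_zero)

lemma W_W: "W m (W n e) = W n (W m e)"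
  by (subst comm) (simp add: koszul_sign_def X_ext_zero)

lemma W_G: "W m (G n e) = G n (W m e)"
  by (subst comm) (simp add: koszul_sign_def X_ext_zero)

lemma C_X: "C1 (opr b e) = opr b (C1 e)" "C2 (opr b e) = opr b (C2 e)"
  by (subst comm, simp add: koszul_sign_def X_ext_zero)+

lemma in_T: "L i b \<in> B0" if "i \<ge> 0" "b \<in> B0" for i
  using that by (intro X_B0) (auto simp: osr_T_basis_def)

lemma W_in_T: "W i b \<in> B0" if "i \<ge> - int d" "b \<in> B0" for i
  using that by (intro X_B0) (auto simp: osr_T_basis_def intro: exI[of _ "i + int d"])

lemma G_in_T: "G i b \<in> B0" if "i \<ge> 1" "b \<in> B0" for i
  using that by (intro X_B0) (auto simp: osr_T_basis_def)

lemma C_in_T: "C1 b \<in> B0" "C2 b \<in> B0" if "b \<in> B0"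
  using that by (auto intro!: X_B0 simp: osr_T_basis_def)

text \<open>\<open>\<Phi>\<close> is the value on \<open>B0\<close>, up to sign, of the brackets \<open>[D k, y k]\<close> in all three lowering steps.\<close>

definition \<Phi> :: "'e \<Rightarrow> 'e" where
  "\<Phi> e = of_nat t *s W (int t) e + (if t = 0 then C2 e else 0)"

lemma lin_\<Phi>: "lin_op \<Phi>"
  by (auto simp: lin_op_def \<Phi>_def X_add X_scale algebra_simps)

text \<open>W_t and C_2 commute with every W and every G, so \<Phi> acts on the coefficients of
  monomials in these letters. Past an L it moves only modulo shorter words; see
  \<open>llow_monom\<close>.\<close>

lemma \<Phi>_commute: "\<Phi> (W i e) = W i (\<Phi> e)" "\<Phi> (G i e) = G i (\<Phi> e)"
  by (auto simp: \<Phi>_def X_add X_scale X_zero W_W[of "int t"] W_G C_X)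

lemma \<Phi>_B0: "b \<in> B0 \<Longrightarrow> \<Phi> b \<in> B0"
  using subspace_B0 by (auto simp: \<Phi>_def intro!: subspace_add subspace_scale W_in_T C_in_T subspace_0)

text \<open>Condition (a) enters here: on \<open>B0\<close>, \<Phi> is the scalar c_2 if t = 0 and
  the injective operator t W_t otherwise.\<close>

lemma \<Phi>_B0_eq_0:
  assumes "b \<in> B0" "\<Phi> b = 0" shows "b = 0"
proof (cases "t = 0")
  case True
  then have "\<Phi> b = c2 *s b" using assms(1) unfolding \<Phi>_def by (simp add: C2_B0)
  then show ?thesis using assms(2) inj_zero True by simp
next
  case False
  then have "W (int t) b = 0" using assms(2) by (simp add: \<Phi>_def)
  then show ?thesis using inj_pos assms(1) False by simp
qed

subsection \<open>The letters W\<close>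

text \<open>The count starts at k = 0, whence the shift by one. The indices of \<open>wlet k\<close>
  and \<open>wlow k\<close> add up to t, and that of \<open>wlow k\<close> exceeds t + d.\<close>

definition wlet :: "nat \<Rightarrow> 'e \<Rightarrow> 'e" where "wlet k = W (- int d - 1 - int k)"
definition wlow :: "nat \<Rightarrow> 'e \<Rightarrow> 'e" where "wlow k = L (int t + int d + 1 + int k)"
definition M1 :: "'e set" where
  "M1 = span {monom_op wlet \<alpha> b | \<alpha> b. \<alpha> \<in> UNIV \<and> b \<in> B0}"

lemma lin_wlet: "lin_op (wlet k)" and lin_wlow: "lin_op (wlow k)"
  by (simp_all add: wlet_def wlow_def lin_X)

lemma W_monom: "W i (monom_op wlet \<alpha> e) = monom_op wlet \<alpha> (W i e)"
  by (induction \<alpha> rule: monom_induct) (simp_all add: monom_op_add_max wlet_def W_W[of i])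

lemma G_monom: "G i (monom_op wlet \<alpha> e) = monom_op wlet \<alpha> (G i e)"
  by (induction \<alpha> rule: monom_induct) (simp_all add: monom_op_add_max wlet_def W_G[symmetric])

lemma C_monom: "C1 (monom_op wlet \<alpha> e) = monom_op wlet \<alpha> (C1 e)" "C2 (monom_op wlet \<alpha> e) = monom_op wlet \<alpha> (C2 e)"
  by (induction \<alpha> rule: monom_induct) (simp_all add: monom_op_add_max wlet_def C_X)

lemma \<Phi>_monom: "\<Phi> (monom_op wlet \<alpha> e) = monom_op wlet \<alpha> (\<Phi> e)"
  by (induction \<alpha> rule: monom_induct) (simp_all add: monom_op_add_max wlet_def \<Phi>_commute)

text \<open>The W commute with one another, so a new letter can be moved to its place without
  correction terms.\<close>

lemma wlet_monom: "wlet k (monom_op wlet \<alpha> e) = monom_op wlet (add_mset k \<alpha>) e"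
proof (induction \<alpha> rule: monom_induct)
  case empty
  show ?case using monom_op_add_max[of "{#}" k wlet e] by simp
next
  case (add j \<alpha>)
  show ?case
  proof (cases "k \<le> j")
    case True
    have "wlet k (monom_op wlet (add_mset j \<alpha>) e) = wlet j (wlet k (monom_op wlet \<alpha> e))"
      using add.hyps by (simp add: monom_op_add_max wlet_def W_W[of "- int d - 1 - int k"])
    also have "\<dots> = monom_op wlet (add_mset j (add_mset k \<alpha>)) e"
      using add True by (subst monom_op_add_max) auto
    finally show ?thesis by (simp add: add_mset_commute)
  next
    case False
    then show ?thesis using add.hyps by (subst monom_op_add_max[of "add_mset j \<alpha>" k]) fastforce+
  qed
qed

lemma M1_gen: "b \<in> B0 \<Longrightarrow> monom_op wlet \<alpha> b \<in> M1"
  unfolding M1_def by (rule span_base) blast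

lemma subspace_M1: "subspace M1"
  by (simp add: M1_def subspace_span)

lemma M1_closed:
  assumes "e \<in> M1" "lin_op f" "\<And>\<alpha> b. b \<in> B0 \<Longrightarrow> f (monom_op wlet \<alpha> b) \<in> U" "subspace U"
  shows "f e \<in> U"
  by (rule lin_op_span[OF assms(2) _ assms(4) assms(1)[unfolded M1_def]]) (use assms(3) in blast)

lemma M1_W: "e \<in> M1 \<Longrightarrow> W i e \<in> M1"
proof (erule M1_closed[OF _ lin_X _ subspace_M1])
  fix \<alpha> b assume b: "b \<in> B0"
  show "W i (monom_op wlet \<alpha> b) \<in> M1"
  proof (cases "i \<ge> - int d")
    case True
    then show ?thesis by (simp add: W_monom M1_gen W_in_T b)
  next
    case False
    then have "W i (monom_op wlet \<alpha> b) = wlet (nat (- int d - 1 - i)) (monom_op wlet \<alpha> b)"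
      by (simp add: wlet_def)
    then show ?thesis by (simp add: wlet_monom M1_gen b)
  qed
qed

lemma M1_C: "e \<in> M1 \<Longrightarrow> C1 e \<in> M1" "e \<in> M1 \<Longrightarrow> C2 e \<in> M1"
  by (erule M1_closed[OF _ lin_X _ subspace_M1], simp add: C_monom M1_gen C_in_T)+

lemma M1_G: "i \<ge> 1 \<Longrightarrow> e \<in> M1 \<Longrightarrow> G i e \<in> M1"
  by (erule M1_closed[OF _ lin_X _ subspace_M1]) (simp add: G_monom M1_gen G_in_T)

lemma M1_\<Phi>: "e \<in> M1 \<Longrightarrow> \<Phi> e \<in> M1"
  by (erule M1_closed[OF _ lin_\<Phi> _ subspace_M1]) (simp add: \<Phi>_monom M1_gen \<Phi>_B0)

lemma M1_L: "i \<ge> 0 \<Longrightarrow> e \<in> M1 \<Longrightarrow> L i e \<in> M1"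
proof (erule M1_closed[OF _ lin_X _ subspace_M1])
  fix \<alpha> b assume i: "i \<ge> 0" and b: "b \<in> B0"
  show "L i (monom_op wlet \<alpha> b) \<in> M1"
  proof (induction \<alpha> rule: monom_induct)
    case empty
    show ?case using M1_gen[of "L i b" "{#}"] in_T i b by simp
  next
    case (add k \<alpha>)
    have "monom_op wlet \<alpha> b \<in> M1" using b by (rule M1_gen)
    then show ?case using b add
      by (auto simp: monom_op_add_max wlet_def[of k] L_W
          intro!: subspace_add[OF subspace_M1] subspace_scale[OF subspace_M1] M1_W M1_C M1_gen)
  qed
qed

lemma zero_on_M1:
  assumes "e \<in> M1" "lin_op f" "\<And>\<alpha> b. b \<in> B0 \<Longrightarrow> f (monom_op wlet \<alpha> b) = 0"
  shows "f e = 0"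
  using M1_closed[OF assms(1,2) _ subspace_single_0] assms(3) by simp

lemma W_M1: "i > int t \<Longrightarrow> e \<in> M1 \<Longrightarrow> W i e = 0"
  by (erule zero_on_M1[OF _ lin_X])
    (simp add: W_monom W_B0 lin_op_zero[OF lin_op_monom[OF lin_wlet]])

lemma G_M1: "i > int t \<Longrightarrow> e \<in> M1 \<Longrightarrow> G i e = 0"
  by (erule zero_on_M1[OF _ lin_X])
    (simp add: G_monom G_B0 lin_op_zero[OF lin_op_monom[OF lin_wlet]])

text \<open>\<open>wlow k\<close> acts as the formal derivative in the letter \<open>k\<close>,
  times \<Phi>: its bracket with that letter is \<Phi>, and its bracket with a smaller letter
  \<open>j\<close> is a multiple of W_{t+k-j}, which vanishes because t + k - j > t.\<close>

lemma wlow_monom: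
  assumes "b \<in> B0" "\<And>j. j \<in># \<alpha> \<Longrightarrow> j \<le> k"
  shows "wlow k (monom_op wlet \<alpha> b) = of_nat (count \<alpha> k) *s monom_op wlet (\<alpha> - {#k#}) (\<Phi> b)"
  using assms(2)
proof (induction \<alpha> rule: monom_induct)
  case empty
  then show ?case using L_B0 assms(1) by (simp add: wlow_def)
next
  case (add j \<alpha>)
  have IH: "wlow k (monom_op wlet \<alpha> b) = of_nat (count \<alpha> k) *s monom_op wlet (\<alpha> - {#k#}) (\<Phi> b)"
    using add by simp
  have "wlow k (monom_op wlet (add_mset j \<alpha>) b) = wlow k (wlet j (monom_op wlet \<alpha> b))"
    using add.hyps by (simp add: monom_op_add_max)
  also have "\<dots> = wlet j (wlow k (monom_op wlet \<alpha> b)) +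
      (of_int (int t + int k - int j) *s W (int t + int k - int j) (monom_op wlet \<alpha> b) +
       (if int t + int k - int j = 0 then C2 (monom_op wlet \<alpha> b) else 0))"
    unfolding wlow_def wlet_def L_W by (simp add: algebra_simps)
  finally have eq: "wlow k (monom_op wlet (add_mset j \<alpha>) b) = \<dots>" .
  show ?case
  proof (cases "j = k")
    case False
    then have j: "int t + int k - int j > int t" using add.prems[of j] by auto
    have "wlow k (monom_op wlet (add_mset j \<alpha>) b) = wlet j (wlow k (monom_op wlet \<alpha> b))"
      unfolding eq using j by (simp add: W_monom W_B0[OF _ assms(1)] lin_op_zero[OF lin_op_monom[OF lin_wlet]])
    then show ?thesis using False
      by (simp add: IH lin_op_scale[OF lin_wlet] wlet_monom)
  next
    case True
    have "wlow k (monom_op wlet (add_mset j \<alpha>) b) = wlet k (wlow k (monom_op wlet \<alpha> b)) +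
        \<Phi> (monom_op wlet \<alpha> b)"
      unfolding eq by (simp add: \<Phi>_def True)
    also have "wlet k (wlow k (monom_op wlet \<alpha> b)) = of_nat (count \<alpha> k) *s monom_op wlet \<alpha> (\<Phi> b)"
      by (cases "k \<in># \<alpha>") (simp_all add: IH lin_op_scale[OF lin_wlet] lin_op_zero[OF lin_wlet] wlet_monom not_in_iff)
    finally show ?thesis by (simp add: True \<Phi>_monom scale_left_distrib)
  qed
qed

text \<open>Commuting letters leave no error, so \<open>Z\<close> is zero, and the multiplicity
  \<open>Suc (count \<alpha> k)\<close> is invertible in characteristic zero. The form with explicit
  coefficients serves both \<open>descent_M1\<close> and \<open>\<Phi>_M1_eq_0\<close>.\<close>

lemma descent_sum_M1:
  assumes S: "finite S" "S \<noteq> {}" "\<And>\<alpha>. \<alpha> \<in> S \<Longrightarrow> f \<alpha> \<in> B0 \<and> f \<alpha> \<noteq> 0"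
  obtains ks where "foldr wlow ks (\<Sum>\<alpha>\<in>S. monom_op wlet \<alpha> (f \<alpha>)) \<in> B0"
    "foldr wlow ks (\<Sum>\<alpha>\<in>S. monom_op wlet \<alpha> (f \<alpha>)) \<noteq> 0"
proof (rule lowering[where D = wlow and Y = "monom_op wlet" and B = B0 and Z = "\<lambda>_. {0}" and A = "\<lambda>_. UNIV"
    and \<Psi> = "\<lambda>\<alpha> k b. of_nat (Suc (count \<alpha> k)) *s \<Phi> b" and n = 0 and S = S and f = f
    and e = "\<Sum>\<alpha>\<in>S. monom_op wlet \<alpha> (f \<alpha>)"])
  show "wlow k z \<in> {0}" if "z \<in> {0}" for k z
    using that lin_op_zero[OF lin_wlow] by simp
  show "\<alpha> \<in> UNIV \<and> of_nat (Suc (count \<alpha> k)) *s \<Phi> b \<in> B0 \<and>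
      (b \<noteq> 0 \<longrightarrow> of_nat (Suc (count \<alpha> k)) *s \<Phi> b \<noteq> 0) \<and>
      wlow k (monom_op wlet (add_mset k \<alpha>) b) - monom_op wlet \<alpha> (of_nat (Suc (count \<alpha> k)) *s \<Phi> b) \<in> {0}"
    if "b \<in> B0" "\<And>j. j \<in># \<alpha> \<Longrightarrow> j \<le> k" for \<alpha> k b
  proof (intro conjI impI)
    show "of_nat (Suc (count \<alpha> k)) *s \<Phi> b \<in> B0"
      using that by (intro subspace_scale[OF subspace_B0] \<Phi>_B0)
    show "of_nat (Suc (count \<alpha> k)) *s \<Phi> b \<noteq> 0" if "b \<noteq> 0"
      using \<Phi>_B0_eq_0[of b] that \<open>b \<in> B0\<close> by (auto simp del: of_nat_Suc)
    show "wlow k (monom_op wlet (add_mset k \<alpha>) b) - monom_op wlet \<alpha> (of_nat (Suc (count \<alpha> k)) *s \<Phi> b) \<in> {0}"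
      using that by (subst wlow_monom) (auto simp: lin_op_scale[OF lin_op_monom[OF lin_wlet]])
  qed simp
  show "wlow k (monom_op wlet \<alpha> b) \<in> {0}" if "b \<in> B0" "\<And>j. j \<in># \<alpha> \<Longrightarrow> j < k" for \<alpha> k b
  proof -
    have "k \<notin># \<alpha>" using that(2) by blast
    then show ?thesis using that(2) by (subst wlow_monom[OF that(1)]) (auto simp: not_in_iff less_imp_le)
  qed
qed (use S that lin_wlow in auto)

lemma M1_rep:
  assumes "e \<in> M1"
  obtains S f where "finite S" "\<forall>\<alpha>\<in>S. f \<alpha> \<in> B0 \<and> f \<alpha> \<noteq> 0" "e = (\<Sum>\<alpha>\<in>S. monom_op wlet \<alpha> (f \<alpha>))"
  using span_monom_rep[OF assms[unfolded M1_def] subspace_B0 lin_op_monom[OF lin_wlet]] that by metis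

lemma descent_M1:
  assumes "e \<in> M1" "e \<noteq> 0"
  obtains ks where "foldr wlow ks e \<in> B0" "foldr wlow ks e \<noteq> 0"
proof -
  obtain S f where S: "finite S" "\<forall>\<alpha>\<in>S. f \<alpha> \<in> B0 \<and> f \<alpha> \<noteq> 0" "e = (\<Sum>\<alpha>\<in>S. monom_op wlet \<alpha> (f \<alpha>))"
    by (rule M1_rep[OF assms(1)])
  moreover have "S \<noteq> {}" using assms(2) S(3) by auto
  ultimately show ?thesis using descent_sum_M1[of S f] that by metis
qed

text \<open>\<Phi> acts on the coefficients and keeps each of them nonzero, and a sum with nonzero
  coefficients can be lowered to something nonzero. With this, \<open>M1\<close> can take over the
  role of \<open>B0\<close> in the next layer.\<close>

lemma \<Phi>_M1_eq_0:
  assumes "e \<in> M1" "\<Phi> e = 0" shows "e = 0"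
proof -
  obtain S f where S: "finite S" "\<forall>\<alpha>\<in>S. f \<alpha> \<in> B0 \<and> f \<alpha> \<noteq> 0" "e = (\<Sum>\<alpha>\<in>S. monom_op wlet \<alpha> (f \<alpha>))"
    by (rule M1_rep[OF assms(1)])
  have \<Phi>e: "\<Phi> e = (\<Sum>\<alpha>\<in>S. monom_op wlet \<alpha> (\<Phi> (f \<alpha>)))"
    by (simp add: S(3) lin_op_sum[OF lin_\<Phi>] \<Phi>_monom)
  have "\<Phi> (f \<alpha>) \<in> B0 \<and> \<Phi> (f \<alpha>) \<noteq> 0" if "\<alpha> \<in> S" for \<alpha>
    using S(2) that \<Phi>_B0 \<Phi>_B0_eq_0 by blast
  then have "S = {}"
    using descent_sum_M1[OF S(1), of "\<lambda>\<alpha>. \<Phi> (f \<alpha>)"] assms(2) lin_op_zero[OF lin_op_foldr[of wlow]] lin_wlow \<Phi>e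
    by metis
  then show ?thesis using S(3) by simp
qed

subsection \<open>The letters G\<close>

text \<open>As \<open>Ggen i\<close> has index i - 1/2, \<open>glet k\<close> has index -k - 1/2 and
  \<open>glow k\<close> has index t + k + 1/2. They add up to t, so the bracket of the two is
  exactly \<Phi>.\<close>

definition glet :: "nat \<Rightarrow> 'e \<Rightarrow> 'e" where "glet k = G (- int k)"
definition glow :: "nat \<Rightarrow> 'e \<Rightarrow> 'e" where "glow k = G (int t + 1 + int k)"

text \<open>A repeated G would be redundant: its square is half of its bracket with itself, a
  multiple of a W, which already acts on \<open>M1\<close>.\<close>

definition strict_monoms :: "nat multiset set" where
  "strict_monoms = {\<alpha>. \<forall>k. count \<alpha> k \<le> 1}"

definition M0 :: "'e set" where
  "M0 = span {monom_op glet \<alpha> b | \<alpha> b. \<alpha> \<in> strict_monoms \<and> b \<in> M1}"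

lemma lin_glet: "lin_op (glet k)" and lin_glow: "lin_op (glow k)"
  by (simp_all add: glet_def glow_def lin_X)

lemma W_gmonom: "W i (monom_op glet \<alpha> e) = monom_op glet \<alpha> (W i e)"
  by (induction \<alpha> rule: monom_induct) (simp_all add: monom_op_add_max glet_def W_G)

lemma C_gmonom: "C1 (monom_op glet \<alpha> e) = monom_op glet \<alpha> (C1 e)" "C2 (monom_op glet \<alpha> e) = monom_op glet \<alpha> (C2 e)"
  by (induction \<alpha> rule: monom_induct) (simp_all add: monom_op_add_max glet_def C_X)

lemma \<Phi>_gmonom: "\<Phi> (monom_op glet \<alpha> e) = monom_op glet \<alpha> (\<Phi> e)"
  by (induction \<alpha> rule: monom_induct) (simp_all add: monom_op_add_max glet_def \<Phi>_commute)

lemma subspace_M0: "subspace M0"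
  by (simp add: M0_def subspace_span)

lemma M0_gen: "\<alpha> \<in> strict_monoms \<Longrightarrow> e \<in> M1 \<Longrightarrow> monom_op glet \<alpha> e \<in> M0"
  unfolding M0_def by (rule span_base) blast

lemma M0_closed:
  assumes "e \<in> M0" "lin_op f" "\<And>\<alpha> b. \<alpha> \<in> strict_monoms \<Longrightarrow> b \<in> M1 \<Longrightarrow> f (monom_op glet \<alpha> b) \<in> U" "subspace U"
  shows "f e \<in> U"
  by (rule lin_op_span[OF assms(2) _ assms(4) assms(1)[unfolded M0_def]]) (use assms(3) in blast)

lemma M0_W: "e \<in> M0 \<Longrightarrow> W i e \<in> M0"
  by (erule M0_closed[OF _ lin_X _ subspace_M0]) (simp add: W_gmonom M0_gen M1_W)

lemma M0_C: "e \<in> M0 \<Longrightarrow> C1 e \<in> M0" "e \<in> M0 \<Longrightarrow> C2 e \<in> M0"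
  by (erule M0_closed[OF _ lin_X _ subspace_M0], simp add: C_gmonom M0_gen M1_C)+

lemma M0_\<Phi>: "e \<in> M0 \<Longrightarrow> \<Phi> e \<in> M0"
  by (erule M0_closed[OF _ lin_\<Phi> _ subspace_M0]) (simp add: \<Phi>_gmonom M0_gen M1_\<Phi>)

lemma W_M0: "i > int t \<Longrightarrow> e \<in> M0 \<Longrightarrow> W i e = 0"
  using M0_closed[OF _ lin_X _ subspace_single_0, of e "Wgen i"]
  by (simp add: W_gmonom W_M1 lin_op_zero[OF lin_op_monom[OF lin_glet]])

lemma strict_monoms_add: "k \<notin># \<alpha> \<Longrightarrow> \<alpha> \<in> strict_monoms \<Longrightarrow> add_mset k \<alpha> \<in> strict_monoms"
  by (auto simp: strict_monoms_def not_in_iff)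

lemma strict_monoms_add_iff: "add_mset k \<alpha> \<in> strict_monoms \<longleftrightarrow> k \<notin># \<alpha> \<and> \<alpha> \<in> strict_monoms"
proof
  assume a: "add_mset k \<alpha> \<in> strict_monoms"
  then have "count \<alpha> j \<le> 1" for j
    using le_trans[of "count \<alpha> j" "count (add_mset k \<alpha>) j" 1] by (auto simp: strict_monoms_def)
  moreover have "count (add_mset k \<alpha>) k \<le> 1" using a unfolding strict_monoms_def by blast
  ultimately show "k \<notin># \<alpha> \<and> \<alpha> \<in> strict_monoms" by (simp add: strict_monoms_def not_in_iff)
qed (use strict_monoms_add in blast)

text \<open>The letters of the straightened product are tracked, so that a larger letter can be prepended.\<close>

lemma glet_monom:
  assumes "\<alpha> \<in> strict_monoms" "b \<in> M1"
  shows "glet k (monom_op glet \<alpha> b) \<in>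
    span {monom_op glet \<beta> b | \<beta> b. \<beta> \<in> strict_monoms \<and> set_mset \<beta> \<subseteq> insert k (set_mset \<alpha>) \<and> b \<in> M1}"
  using assms(1)
proof (induction \<alpha> rule: monom_induct)
  case empty
  show ?case
    by (rule span_base) (use assms monom_op_add_max[of "{#}" k glet b] in
        \<open>auto intro!: exI[of _ "{#k#}"] exI[of _ b] simp: strict_monoms_def\<close>)
next
  case (add j \<alpha>)
  have \<alpha>: "\<alpha> \<in> strict_monoms" "j \<notin># \<alpha>" using add.prems by (auto simp: strict_monoms_add_iff)
  let ?m = "monom_op glet \<alpha> b" and ?U = "\<lambda>k \<alpha>. span {monom_op glet \<beta> b | \<beta> b.
    \<beta> \<in> strict_monoms \<and> set_mset \<beta> \<subseteq> insert k (set_mset \<alpha>) \<and> b \<in> M1}"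
  have gen: "monom_op glet \<beta> b' \<in> ?U k (add_mset j \<alpha>)"
    if "\<beta> \<in> strict_monoms" "set_mset \<beta> \<subseteq> insert k (set_mset (add_mset j \<alpha>))" "b' \<in> M1" for \<beta> b'
    by (rule span_base) (use that in blast)
  have low: "c *s W i ?m + (if P then C2 ?m else 0) \<in> ?U k (add_mset j \<alpha>)" for c i P
    using gen[OF \<alpha>(1) _ M1_W[OF assms(2)]] gen[OF \<alpha>(1) _ M1_C(2)[OF assms(2)]]
    by (auto simp: W_gmonom C_gmonom intro!: span_add span_scale span_zero)
  have eq: "monom_op glet (add_mset j \<alpha>) b = glet j ?m"
    using add.hyps by (simp add: monom_op_add_max)
  consider "k > j" | "k = j" | "k < j" by linarith
  then show ?case
  proof cases
    case 1
    have le: "i \<le> k" if "i \<in># add_mset j \<alpha>" for i using 1 that add.hyps[of i] by auto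
    have "k \<notin># add_mset j \<alpha>" using 1 add.hyps[of k] by auto
    then have "monom_op glet (add_mset k (add_mset j \<alpha>)) b \<in> ?U k (add_mset j \<alpha>)"
      using add.prems assms(2) by (intro gen strict_monoms_add[of k]) auto
    moreover have "monom_op glet (add_mset k (add_mset j \<alpha>)) b = glet k (monom_op glet (add_mset j \<alpha>) b)"
      by (rule monom_op_add_max) (rule le)
    ultimately show ?thesis by simp
  next
    case 2
    \<comment> \<open>A repeated odd letter is resolved by 2 G G = [G, G]; the W on the right is
      absorbed into the element of \<open>M1\<close>.\<close>
    have "2 *s glet j (glet j ?m) = glet j (glet j ?m) + glet j (glet j ?m)"
      using scale_left_distrib[of 1 1] by simp
    also have "\<dots> = of_int (- int j + - int j - 1) *s W (- int j + - int j - 1) ?m +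
        (if - int j + - int j - 1 = 0 then C2 ?m else 0)"
      unfolding glet_def by (subst (2) G_G) simp
    finally have "2 *s glet j (glet j ?m) \<in> ?U k (add_mset j \<alpha>)" by (simp only: low)
    from span_scale[OF this, of "1/2"] show ?thesis using eq 2 by simp
  next
    case 3
    have "glet j x \<in> ?U k (add_mset j \<alpha>)" if "x \<in> ?U k \<alpha>" for x
    proof (rule lin_op_span[OF lin_glet _ subspace_span that])
      fix y assume "y \<in> {monom_op glet \<beta> b | \<beta> b.
        \<beta> \<in> strict_monoms \<and> set_mset \<beta> \<subseteq> insert k (set_mset \<alpha>) \<and> b \<in> M1}"
      then obtain \<beta> b' where y: "y = monom_op glet \<beta> b'" "\<beta> \<in> strict_monoms" "set_mset \<beta> \<subseteq> insert k (set_mset \<alpha>)" "b' \<in> M1"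
        by blast
      have "i < j" if "i \<in># \<beta>" for i
      proof -
        have "i = k \<or> i \<in># \<alpha>" using that y(3) by auto
        then show ?thesis using 3 add.hyps[of i] \<alpha>(2) by (metis le_neq_implies_less)
      qed
      then have "glet j y = monom_op glet (add_mset j \<beta>) b'" "j \<notin># \<beta>"
        using monom_op_add_max[of \<beta> j glet b'] by (auto simp: y(1) less_imp_le)
      then show "glet j y \<in> ?U k (add_mset j \<alpha>)"
        using gen[of "add_mset j \<beta>" b'] y strict_monoms_add[of j \<beta>] by auto
    qed
    from span_neg[OF this[OF add.IH[OF \<alpha>(1)]]]
    have "- glet j (glet k ?m) \<in> ?U k (add_mset j \<alpha>)" .
    moreover have "glet k (glet j ?m) = - glet j (glet k ?m) +
        (of_int (- int k + - int j - 1) *s W (- int k + - int j - 1) ?m + (if - int k + - int j - 1 = 0 then C2 ?m else 0))"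
      unfolding glet_def by (rule G_G)
    ultimately show ?thesis unfolding eq by (simp only: span_add low)
  qed
qed

lemma M0_glet: "e \<in> M0 \<Longrightarrow> glet k e \<in> M0"
proof (erule M0_closed[OF _ lin_glet _ subspace_M0])
  fix \<alpha> b assume "\<alpha> \<in> strict_monoms" "b \<in> M1"
  from glet_monom[OF this] show "glet k (monom_op glet \<alpha> b) \<in> M0"
    unfolding M0_def by (rule subsetD[OF span_mono, rotated]) blast
qed

lemma M0_G: "e \<in> M0 \<Longrightarrow> G i e \<in> M0"
proof (cases "i \<ge> 1")
  case True
  show "e \<in> M0 \<Longrightarrow> G i e \<in> M0"
  proof (erule M0_closed[OF _ lin_X _ subspace_M0])
    fix \<alpha> b assume "\<alpha> \<in> strict_monoms" and b: "b \<in> M1"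
    then show "G i (monom_op glet \<alpha> b) \<in> M0"
    proof (induction \<alpha> rule: monom_induct)
      case empty
      show ?case using M0_gen[of "{#}" "G i b"] M1_G[OF True b] by (simp add: strict_monoms_def)
    next
      case (add k \<alpha>)
      then have \<alpha>: "\<alpha> \<in> strict_monoms" by (simp add: strict_monoms_add_iff)
      have "glet k (G i (monom_op glet \<alpha> b)) \<in> M0"
        using add \<alpha> by (intro M0_glet) simp
      then show ?case
        using M0_W[OF M0_gen[OF \<alpha> b]] M0_C(2)[OF M0_gen[OF \<alpha> b]] add.hyps
        by (auto simp: monom_op_add_max glet_def[of k] G_G[of i "- int k"]
            intro!: subspace_add[OF subspace_M0] subspace_neg[OF subspace_M0] subspace_diff[OF subspace_M0]
              subspace_scale[OF subspace_M0])
    qed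
  qed
next
  case False
  then show "e \<in> M0 \<Longrightarrow> G i e \<in> M0"
    using M0_glet[of e "nat (- i)"] by (simp add: glet_def)
qed

lemma M0_L: "i \<ge> 0 \<Longrightarrow> e \<in> M0 \<Longrightarrow> L i e \<in> M0"
proof (erule M0_closed[OF _ lin_X _ subspace_M0])
  fix \<alpha> b assume "\<alpha> \<in> strict_monoms" and b: "b \<in> M1" and i: "i \<ge> 0"
  then show "L i (monom_op glet \<alpha> b) \<in> M0"
  proof (induction \<alpha> rule: monom_induct)
    case empty
    show ?case using M0_gen[of "{#}" "L i b"] M1_L[OF i b] by (simp add: strict_monoms_def)
  next
    case (add k \<alpha>)
    then have \<alpha>: "\<alpha> \<in> strict_monoms" by (simp add: strict_monoms_add_iff)
    then show ?case
      using M0_gen[OF \<alpha> b] add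
      by (auto simp: monom_op_add_max glet_def[of k] L_G
          intro!: subspace_add[OF subspace_M0] subspace_scale[OF subspace_M0] M0_G)
  qed
qed

text \<open>Passing a smaller letter \<open>j\<close> costs a multiple of W_{t+k-j} with t + k - j >
  t, which is zero on \<open>M0\<close>, and the innermost element of \<open>M1\<close> is killed by
  \<open>glow k\<close> itself.\<close>

lemma glow_monom_less:
  assumes "b \<in> M1" "\<alpha> \<in> strict_monoms" "\<And>j. j \<in># \<alpha> \<Longrightarrow> j < k"
  shows "glow k (monom_op glet \<alpha> b) = 0"
  using assms(2,3)
proof (induction \<alpha> rule: monom_induct)
  case empty
  then show ?case using assms(1) by (simp add: glow_def G_M1)
next
  case (add j \<alpha>)
  then have \<alpha>: "\<alpha> \<in> strict_monoms" and j: "j < k" by (auto simp: strict_monoms_add_iff)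
  from j have i: "int t + 1 + int k + - int j - 1 > int t" by simp
  have "glow k (monom_op glet (add_mset j \<alpha>) b) = - glet j (glow k (monom_op glet \<alpha> b))"
    using add.hyps i W_M0[OF i M0_gen[OF \<alpha> assms(1)]]
    by (simp add: monom_op_add_max glow_def glet_def[of j] G_G[of _ "- int j"])
  then show ?case using add \<alpha> by (simp add: lin_op_zero[OF lin_glet])
qed

lemma glow_monom:
  assumes "b \<in> M1" "add_mset k \<alpha> \<in> strict_monoms" "\<And>j. j \<in># \<alpha> \<Longrightarrow> j \<le> k"
  shows "glow k (monom_op glet (add_mset k \<alpha>) b) = monom_op glet \<alpha> (\<Phi> b)"
proof -
  have \<alpha>: "\<alpha> \<in> strict_monoms" "k \<notin># \<alpha>" using assms(2) by (auto simp: strict_monoms_add_iff)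
  have "glow k (monom_op glet (add_mset k \<alpha>) b) =
      - glet k (glow k (monom_op glet \<alpha> b)) + \<Phi> (monom_op glet \<alpha> b)"
    using assms(3) by (simp add: monom_op_add_max glow_def glet_def[of k] G_G[of _ "- int k"] \<Phi>_def)
  also have "glow k (monom_op glet \<alpha> b) = 0"
    using \<alpha> assms by (intro glow_monom_less) (auto simp: le_less)
  finally show ?thesis by (simp add: lin_op_zero[OF lin_glet] \<Phi>_gmonom)
qed

lemma descent_sum_M0:
  assumes S: "finite S" "S \<noteq> {}" "S \<subseteq> strict_monoms" "\<And>\<alpha>. \<alpha> \<in> S \<Longrightarrow> f \<alpha> \<in> M1 \<and> f \<alpha> \<noteq> 0"
  obtains ks where "foldr glow ks (\<Sum>\<alpha>\<in>S. monom_op glet \<alpha> (f \<alpha>)) \<in> M1"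
    "foldr glow ks (\<Sum>\<alpha>\<in>S. monom_op glet \<alpha> (f \<alpha>)) \<noteq> 0"
proof (rule lowering[where D = glow and Y = "monom_op glet" and B = M1 and Z = "\<lambda>_. {0}"
    and A = "\<lambda>_. strict_monoms" and \<Psi> = "\<lambda>\<alpha> k. \<Phi>" and n = 0 and S = S and f = f
    and e = "\<Sum>\<alpha>\<in>S. monom_op glet \<alpha> (f \<alpha>)"])
  show "glow k z \<in> {0}" if "z \<in> {0}" for k z
    using that lin_op_zero[OF lin_glow] by simp
  show "\<alpha> \<in> strict_monoms \<and> \<Phi> b \<in> M1 \<and> (b \<noteq> 0 \<longrightarrow> \<Phi> b \<noteq> 0) \<and>
      glow k (monom_op glet (add_mset k \<alpha>) b) - monom_op glet \<alpha> (\<Phi> b) \<in> {0}"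
    if "add_mset k \<alpha> \<in> strict_monoms" "b \<in> M1" "\<And>j. j \<in># \<alpha> \<Longrightarrow> j \<le> k" for \<alpha> k b
    using that M1_\<Phi> \<Phi>_M1_eq_0 glow_monom by (auto simp: strict_monoms_add_iff)
  show "glow k (monom_op glet \<alpha> b) \<in> {0}"
    if "\<alpha> \<in> strict_monoms" "b \<in> M1" "\<And>j. j \<in># \<alpha> \<Longrightarrow> j < k" for \<alpha> k b
    using glow_monom_less that by simp
qed (use S that lin_glow in auto)

lemma M0_rep:
  assumes "e \<in> M0"
  obtains S f where "finite S" "S \<subseteq> strict_monoms" "\<forall>\<alpha>\<in>S. f \<alpha> \<in> M1 \<and> f \<alpha> \<noteq> 0"
    "e = (\<Sum>\<alpha>\<in>S. monom_op glet \<alpha> (f \<alpha>))"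
  using span_monom_rep[OF assms[unfolded M0_def] subspace_M1 lin_op_monom[OF lin_glet]] that by metis

lemma descent_M0:
  assumes "e \<in> M0" "e \<noteq> 0"
  obtains ks where "foldr glow ks e \<in> M1" "foldr glow ks e \<noteq> 0"
proof -
  obtain S f where S: "finite S" "S \<subseteq> strict_monoms" "\<forall>\<alpha>\<in>S. f \<alpha> \<in> M1 \<and> f \<alpha> \<noteq> 0"
      "e = (\<Sum>\<alpha>\<in>S. monom_op glet \<alpha> (f \<alpha>))"
    by (rule M0_rep[OF assms(1)])
  moreover have "S \<noteq> {}" using assms(2) S(4) by auto
  ultimately show ?thesis using descent_sum_M0[of S f] that by metis
qed

lemma \<Phi>_M0_eq_0:
  assumes "e \<in> M0" "\<Phi> e = 0" shows "e = 0"
proof -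
  obtain S f where S: "finite S" "S \<subseteq> strict_monoms" "\<forall>\<alpha>\<in>S. f \<alpha> \<in> M1 \<and> f \<alpha> \<noteq> 0"
      "e = (\<Sum>\<alpha>\<in>S. monom_op glet \<alpha> (f \<alpha>))"
    by (rule M0_rep[OF assms(1)])
  have \<Phi>e: "\<Phi> e = (\<Sum>\<alpha>\<in>S. monom_op glet \<alpha> (\<Phi> (f \<alpha>)))"
    by (simp add: S(4) lin_op_sum[OF lin_\<Phi>] \<Phi>_gmonom)
  have "\<Phi> (f \<alpha>) \<in> M1 \<and> \<Phi> (f \<alpha>) \<noteq> 0" if "\<alpha> \<in> S" for \<alpha>
    using S(3) that M1_\<Phi> \<Phi>_M1_eq_0 by blast
  then have "S = {}"
    using descent_sum_M0[OF S(1) _ S(2), of "\<lambda>\<alpha>. \<Phi> (f \<alpha>)"] assms(2) lin_op_zero[OF lin_op_foldr[of glow]] lin_glow \<Phi>e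
    by metis
  then show ?thesis using S(4) by simp
qed

subsection \<open>The letters L\<close>

text \<open>Indices again add up to t. Here the W stands on the left of the bracket, so
  [\<open>llow k\<close>, \<open>llet k\<close>] is -\<Phi>, whence the signs in
  \<open>llow_monom\<close> and \<open>descent_Lo\<close>.\<close>

definition llet :: "nat \<Rightarrow> 'e \<Rightarrow> 'e" where "llet k = L (- 1 - int k)"
definition llow :: "nat \<Rightarrow> 'e \<Rightarrow> 'e" where "llow k = W (int t + 1 + int k)"

definition Lo :: "nat \<Rightarrow> 'e set" where
  "Lo n = span {foldr llet xs m | xs m. length xs \<le> n \<and> m \<in> M0}"

text \<open>The step of the filtration strictly below n. Writing \<open>Lo (n - 1)\<close> would
  give the wrong space for n = 0, where subtraction is truncated.\<close>

definition Zo :: "nat \<Rightarrow> 'e set" where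
  "Zo n = (case n of 0 \<Rightarrow> {0} | Suc m \<Rightarrow> Lo m)"

lemma lin_llet: "lin_op (llet k)" and lin_llow: "lin_op (llow k)"
  by (simp_all add: llet_def llow_def lin_X)

lemma lin_foldr_llet: "lin_op (foldr llet xs)"
  by (rule lin_op_foldr) (rule lin_llet)

lemma Zo_0 [simp]: "Zo 0 = {0}" and Zo_Suc [simp]: "Zo (Suc n) = Lo n"
  by (simp_all add: Zo_def)

lemma subspace_Lo: "subspace (Lo n)"
  by (simp add: Lo_def subspace_span)

lemma subspace_Zo: "subspace (Zo n)"
  by (cases n) (simp_all add: subspace_Lo subspace_single_0)

lemma Lo_mono: "m \<le> n \<Longrightarrow> Lo m \<subseteq> Lo n"
  unfolding Lo_def by (intro span_mono) (blast intro: le_trans)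

lemma Zo_mono: "m \<le> n \<Longrightarrow> Zo m \<subseteq> Zo n"
  using subspace_0[OF subspace_Zo[of n]] by (cases m; cases n) (auto dest: subsetD[OF Lo_mono])

lemma Zo_Lo: "e \<in> Zo n \<Longrightarrow> e \<in> Lo n"
  using Zo_mono[of n "Suc n"] by auto

lemma Lo_gen: "m \<in> M0 \<Longrightarrow> foldr llet xs m \<in> Lo (length xs)"
  unfolding Lo_def by (rule span_base) blast

lemma Lo_closed:
  assumes "e \<in> Lo n" "lin_op f" "\<And>xs m. length xs \<le> n \<Longrightarrow> m \<in> M0 \<Longrightarrow> f (foldr llet xs m) \<in> U" "subspace U"
  shows "f e \<in> U"
  by (rule lin_op_span[OF assms(2) _ assms(4) assms(1)[unfolded Lo_def]]) (use assms(3) in blast)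

lemma llet_Lo: "e \<in> Lo n \<Longrightarrow> llet k e \<in> Lo (Suc n)"
proof (erule Lo_closed[OF _ lin_llet _ subspace_Lo])
  fix xs :: "nat list" and m assume "length xs \<le> n" "m \<in> M0"
  then show "llet k (foldr llet xs m) \<in> Lo (Suc n)"
    using Lo_gen[of m "k # xs"] Lo_mono[of "length (k # xs)" "Suc n"] by auto
qed

lemma llet_Zo: "e \<in> Zo (n - 1) \<Longrightarrow> llet k e \<in> Zo n"
  by (cases "n - 1"; cases n) (auto simp: lin_op_zero[OF lin_llet] subspace_0[OF subspace_Lo] llet_Lo)

lemma C_foldr: "C1 (foldr llet xs e) = foldr llet xs (C1 e)" "C2 (foldr llet xs e) = foldr llet xs (C2 e)"
  by (induction xs) (simp_all add: llet_def C_X)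

lemma Lo_C: "m \<in> M0 \<Longrightarrow> C1 (foldr llet xs m) \<in> Lo (length xs)" "m \<in> M0 \<Longrightarrow> C2 (foldr llet xs m) \<in> Lo (length xs)"
  by (simp_all add: C_foldr Lo_gen M0_C)

lemma W_llet: "W i (llet k e) = llet k (W i e) -
    (of_int (i - 1 - int k) *s W (i - 1 - int k) e + (if i - 1 - int k = 0 then C2 e else 0))"
proof -
  have i: "- 1 - int k + i = i - 1 - int k" by simp
  show ?thesis
    unfolding llet_def L_W[of "- 1 - int k" i e, unfolded i] by (rule add_diff_cancel_right'[symmetric])
qed

text \<open>Each passage of a W through an L leaves a W or C_2 in place of that L, hence a word with
  one L fewer.\<close>

lemma W_foldr_llet:
  assumes "m \<in> M0"
  shows "W i (foldr llet xs m) - foldr llet xs (W i m) \<in> Zo (length xs)"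
proof (induction xs arbitrary: i)
  case (Cons k xs)
  let ?e = "foldr llet xs m"
  have W: "W j ?e \<in> Lo (length xs)" for j
    using subspace_add[OF subspace_Lo Zo_Lo[OF Cons.IH[of j]] Lo_gen[OF M0_W[OF assms, of j]]] by simp
  have "W i (foldr llet (k # xs) m) - foldr llet (k # xs) (W i m) =
      llet k (W i ?e - foldr llet xs (W i m)) -
      (of_int (i - 1 - int k) *s W (i - 1 - int k) ?e + (if i - 1 - int k = 0 then C2 ?e else 0))"
    by (simp add: W_llet lin_op_diff[OF lin_llet])
  moreover have "llet k (W i ?e - foldr llet xs (W i m)) \<in> Zo (Suc (length xs))"
    by (rule llet_Zo) (use Cons.IH in simp)
  ultimately show ?case
    using W Lo_C(2)[OF assms] subspace_0[OF subspace_Lo]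
    by (auto intro!: subspace_diff[OF subspace_Lo] subspace_add[OF subspace_Lo] subspace_scale[OF subspace_Lo])
qed simp

lemma Lo_W: "m \<in> M0 \<Longrightarrow> W i (foldr llet xs m) \<in> Lo (length xs)"
  using subspace_add[OF subspace_Lo Zo_Lo[OF W_foldr_llet[of m i xs]] Lo_gen[OF M0_W[of m i]]] by simp

lemma Lo_G: "m \<in> M0 \<Longrightarrow> G i (foldr llet xs m) \<in> Lo (length xs)"
proof (induction xs arbitrary: i)
  case Nil
  then show ?case using Lo_gen[of "G i m" "[]"] M0_G by simp
next
  case (Cons k xs)
  have "G i (foldr llet (k # xs) m) =
      llet k (G i (foldr llet xs m)) - (of_int i - 1 / 2) *s G (- 1 - int k + i) (foldr llet xs m)"
    by (simp add: llet_def[of k] L_G[of "- 1 - int k" i])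
  then show ?case
    using Cons Lo_mono[of "length xs" "Suc (length xs)"]
    by (auto intro!: subspace_diff[OF subspace_Lo] subspace_scale[OF subspace_Lo] llet_Lo)
qed

text \<open>The bracket of L_i with a letter may be another negative L, but it replaces the letter
  from which it arose, so the number of letters does not grow.\<close>

lemma Lo_L: "m \<in> M0 \<Longrightarrow> i \<ge> 0 \<Longrightarrow> L i (foldr llet xs m) \<in> Lo (length xs)"
proof (induction xs arbitrary: i)
  case Nil
  then show ?case using Lo_gen[of "L i m" "[]"] M0_L by simp
next
  case (Cons k xs)
  let ?e = "foldr llet xs m"
  have "L (i - 1 - int k) ?e \<in> Lo (Suc (length xs))"
  proof (cases "i - 1 - int k \<ge> 0")
    case True
    then show ?thesis using Cons Lo_mono[of "length xs" "Suc (length xs)"] by auto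
  next
    case False
    then have "- 1 - int (nat (int k - i)) = i - 1 - int k" by simp
    then have "L (i - 1 - int k) ?e = llet (nat (int k - i)) ?e" by (simp only: llet_def)
    then show ?thesis using llet_Lo[OF Lo_gen[OF Cons.prems(1)]] by simp
  qed
  moreover have "C1 ?e \<in> Lo (Suc (length xs))"
    using Lo_C(1)[OF Cons.prems(1)] Lo_mono[of "length xs" "Suc (length xs)"] by auto
  moreover have "llet k (L i ?e) \<in> Lo (Suc (length xs))"
    using Cons by (intro llet_Lo) auto
  moreover have e: "i + (- 1 - int k) = i - 1 - int k" by simp
  ultimately have "llet k (L i ?e) + (of_int (- 1 - int k - i) *s L (i - 1 - int k) ?e +
      (if i - 1 - int k = 0 then (of_int (i ^ 3 - i) / 12) *s C1 ?e else 0)) \<in> Lo (Suc (length xs))"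
    using subspace_0[OF subspace_Lo]
    by (intro subspace_add[OF subspace_Lo]) (auto intro!: subspace_scale[OF subspace_Lo])
  then show ?case
    using L_L[of i "- 1 - int k" ?e, unfolded e] by (simp add: llet_def[of k])
qed

lemma opr_Lo: "e \<in> Lo n \<Longrightarrow> opr b e \<in> Lo (Suc n)"
proof (erule Lo_closed[OF _ lin_X _ subspace_Lo])
  fix xs :: "nat list" and m assume xs: "length xs \<le> n" "m \<in> M0"
  show "opr b (foldr llet xs m) \<in> Lo (Suc n)"
  proof (cases "\<exists>i<0. b = Lgen i")
    case True
    then obtain i where "i < 0" "b = Lgen i" by blast
    moreover have "- 1 - int (nat (- 1 - i)) = i" using \<open>i < 0\<close> by simp
    ultimately have "opr b = llet (nat (- 1 - i))" by (simp only: llet_def)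
    then show ?thesis using llet_Lo[OF Lo_gen[OF xs(2), of xs]] Lo_mono[of "Suc (length xs)" "Suc n"] xs(1) by auto
  next
    case False
    then have "opr b (foldr llet xs m) \<in> Lo (length xs)"
      using Lo_L[OF xs(2)] Lo_W[OF xs(2)] Lo_G[OF xs(2)] Lo_C[OF xs(2)] by (cases b) auto
    then show ?thesis using Lo_mono[of "length xs" "Suc n"] xs(1) by auto
  qed
qed

text \<open>W_i passes through the letters modulo shorter words and then kills \<open>M0\<close>, so
  it lowers the filtration degree. This keeps the error terms under control when lowering is
  repeated.\<close>

lemma W_Zo: "i > int t \<Longrightarrow> e \<in> Zo n \<Longrightarrow> W i e \<in> Zo (n - 1)"
proof (cases n)
  case (Suc m)
  assume i: "i > int t" and "e \<in> Zo n"
  then have "e \<in> Lo m" by (simp add: Suc)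
  then have "W i e \<in> Zo m"
  proof (rule Lo_closed[OF _ lin_X _ subspace_Zo])
    fix xs :: "nat list" and x assume "length xs \<le> m" "x \<in> M0"
    then show "W i (foldr llet xs x) \<in> Zo m"
      using W_foldr_llet[of x i xs] W_M0[OF i] Zo_mono[of "length xs" m] lin_op_zero[OF lin_foldr_llet] by auto
  qed
  then show ?thesis by (simp add: Suc)
qed (simp add: X_zero)

lemma Lo_monom: "m \<in> M0 \<Longrightarrow> monom_op llet \<alpha> m \<in> Lo (size \<alpha>)"
  unfolding monom_op_def using Lo_gen[of m "rev (sorted_list_of_multiset \<alpha>)"]
  by (metis length_rev mset_sorted_list_of_multiset size_mset)

text \<open>Exchanging two letters costs their bracket, a multiple of a single L, and hence one
  letter. C_1 does not appear, as both indices are negative.\<close>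

lemma llet_monom:
  assumes "m \<in> M0"
  shows "llet k (monom_op llet \<alpha> m) - monom_op llet (add_mset k \<alpha>) m \<in> Lo (size \<alpha>)"
proof (induction \<alpha> rule: monom_induct)
  case empty
  show ?case using monom_op_add_max[of "{#}" k llet m] subspace_0[OF subspace_Lo] by simp
next
  case (add j \<alpha>)
  let ?e = "monom_op llet \<alpha> m"
  show ?case
  proof (cases "k < j")
    case False
    then show ?thesis using add.hyps subspace_0[OF subspace_Lo]
      by (subst monom_op_add_max[of "add_mset j \<alpha>" k]) fastforce+
  next
    case True
    have e: "- 1 - int k + (- 1 - int j) = - 1 - int (k + j + 1)" by simp
    have "monom_op llet (add_mset j \<alpha>) m = llet j ?e"
      by (rule monom_op_add_max) (rule add.hyps)
    moreover have "monom_op llet (add_mset j (add_mset k \<alpha>)) m = llet j (monom_op llet (add_mset k \<alpha>) m)"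
      using True add.hyps by (intro monom_op_add_max) (auto simp: less_imp_le)
    ultimately have "llet k (monom_op llet (add_mset j \<alpha>) m) - monom_op llet (add_mset k (add_mset j \<alpha>)) m =
        llet k (llet j ?e) - llet j (monom_op llet (add_mset k \<alpha>) m)"
      by (simp add: add_mset_commute[of k])
    also have "\<dots> = llet j (llet k ?e - monom_op llet (add_mset k \<alpha>) m) + of_int (int k - int j) *s llet (k + j + 1) ?e"
      using L_L[of "- 1 - int k" "- 1 - int j" ?e] unfolding e
      by (simp add: llet_def lin_op_diff[OF lin_X])
    also have "\<dots> \<in> Lo (size (add_mset j \<alpha>))"
      using llet_Lo[OF add.IH] llet_Lo[OF Lo_monom[OF assms]]
      by (auto intro!: subspace_add[OF subspace_Lo] subspace_scale[OF subspace_Lo])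
    finally show ?thesis .
  qed
qed

lemma foldr_llet_monom:
  assumes "m \<in> M0"
  shows "foldr llet xs m - monom_op llet (mset xs) m \<in> Zo (length xs)"
proof (induction xs)
  case (Cons k xs)
  have "foldr llet (k # xs) m - monom_op llet (mset (k # xs)) m =
      llet k (foldr llet xs m - monom_op llet (mset xs) m) +
      (llet k (monom_op llet (mset xs) m) - monom_op llet (add_mset k (mset xs)) m)"
    by (simp add: lin_op_diff[OF lin_llet])
  moreover have "llet k (foldr llet xs m - monom_op llet (mset xs) m) \<in> Zo (Suc (length xs))"
    by (rule llet_Zo) (use Cons in simp)
  moreover have "llet k (monom_op llet (mset xs) m) - monom_op llet (add_mset k (mset xs)) m \<in> Zo (Suc (length xs))"
    using llet_monom[OF assms, of k "mset xs"] by simp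
  ultimately show ?case by (simp only: subspace_add[OF subspace_Zo] list.size(4) add_Suc_right add_0_right)
qed simp

text \<open>Words of length exactly n can be sorted at the cost of elements of \<open>Zo n\<close>,
  and shorter ones lie in \<open>Zo n\<close> from the start.\<close>

lemma Lo_leading:
  assumes "e \<in> Lo n"
  obtains e' where "e' \<in> span {monom_op llet \<alpha> m | \<alpha> m. \<alpha> \<in> {\<alpha>. size \<alpha> = n} \<and> m \<in> M0}" "e - e' \<in> Zo n"
proof -
  let ?U = "span {monom_op llet \<alpha> m | \<alpha> m. \<alpha> \<in> {\<alpha>. size \<alpha> = n} \<and> m \<in> M0}"
  have "e \<in> {x + y | x y. x \<in> ?U \<and> y \<in> Zo n}"
  proof (rule lin_op_span[where f = id, simplified id_apply, OF _ _ _ assms[unfolded Lo_def]])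
    show "lin_op id" by (simp add: lin_op_def)
    show "subspace {x + y | x y. x \<in> ?U \<and> y \<in> Zo n}"
      by (rule subspace_sums) (simp_all add: subspace_span subspace_Zo)
    fix x assume "x \<in> {foldr llet xs m | xs m. length xs \<le> n \<and> m \<in> M0}"
    then obtain xs m where x: "x = foldr llet xs m" "length xs \<le> n" "m \<in> M0" by blast
    show "x \<in> {x + y | x y. x \<in> ?U \<and> y \<in> Zo n}"
    proof (cases "length xs = n")
      case True
      have "x = monom_op llet (mset xs) m + (x - monom_op llet (mset xs) m)" by simp
      moreover have "monom_op llet (mset xs) m \<in> ?U"
        using True x(3) by (intro span_base) force
      ultimately show ?thesis using foldr_llet_monom[OF x(3), of xs] True x(1) by blast
    next
      case False
      then have "x \<in> Zo n"
        using x Lo_gen[OF x(3), of xs] Zo_mono[of "Suc (length xs)" n] by auto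
      then have "x = 0 + x" "x \<in> Zo n" by simp_all
      then show ?thesis using span_zero by blast
    qed
  qed
  then show ?thesis using that by force
qed

text \<open>A formal derivative in the letter \<open>k\<close> times -\<Phi>, as in
  \<open>wlow_monom\<close>, but only up to an error: the W produced by a bracket has to pass the
  remaining L before it reaches \<open>M0\<close>.\<close>

lemma llow_monom:
  assumes "m \<in> M0" "\<And>j. j \<in># \<alpha> \<Longrightarrow> j \<le> k"
  shows "llow k (monom_op llet \<alpha> m) + of_nat (count \<alpha> k) *s monom_op llet (\<alpha> - {#k#}) (\<Phi> m) \<in> Zo (size \<alpha> - 1)"
  using assms(2)
proof (induction \<alpha> rule: monom_induct)
  case empty
  then show ?case using W_M0 assms(1) by (simp add: llow_def)
next
  case (add j \<alpha>)
  let ?e = "monom_op llet \<alpha> m"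
  have IH: "llow k ?e + of_nat (count \<alpha> k) *s monom_op llet (\<alpha> - {#k#}) (\<Phi> m) \<in> Zo (size \<alpha> - 1)"
    using add by simp
  have eq: "llow k (monom_op llet (add_mset j \<alpha>) m) = llet j (llow k ?e) -
      (of_int (int t + int k - int j) *s W (int t + int k - int j) ?e + (if int t + int k - int j = 0 then C2 ?e else 0))"
    using add.hyps by (simp add: monom_op_add_max llow_def W_llet algebra_simps)
  have W: "W i ?e - monom_op llet \<alpha> (W i m) \<in> Zo (size \<alpha>)" for i
    using W_foldr_llet[OF assms(1), of i "rev (sorted_list_of_multiset \<alpha>)"]
    unfolding monom_op_def by (metis length_rev mset_sorted_list_of_multiset size_mset)
  show ?case
  proof (cases "j = k")
    case False
    then have i: "int t + int k - int j > int t" and "k \<notin># \<alpha>" using add.prems[of j] add.hyps[of k] by auto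
    then have c: "count \<alpha> k = 0" by (simp add: not_in_iff)
    have "W (int t + int k - int j) ?e \<in> Zo (size \<alpha>)"
      using W[of "int t + int k - int j"] W_M0[OF i assms(1)] by (simp add: lin_op_zero[OF lin_op_monom[OF lin_llet]])
    then show ?thesis
      using c False llet_Zo[OF IH, of j] i unfolding eq
      by (auto intro!: subspace_diff[OF subspace_Zo] subspace_scale[OF subspace_Zo])
  next
    case True
    have eq': "llow k (monom_op llet (add_mset j \<alpha>) m) = llet k (llow k ?e) - \<Phi> ?e"
      unfolding eq by (simp add: \<Phi>_def True)
    have "\<Phi> ?e - monom_op llet \<alpha> (\<Phi> m) = of_nat t *s (W (int t) ?e - monom_op llet \<alpha> (W (int t) m))"
      by (simp add: \<Phi>_def lin_op_add[OF lin_op_monom[OF lin_llet]] lin_op_scale[OF lin_op_monom[OF lin_llet]]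
          lin_op_zero[OF lin_op_monom[OF lin_llet]] scale_right_diff_distrib C_foldr monom_op_def lin_op_scale[OF lin_foldr_llet])
    then have \<Phi>: "\<Phi> ?e - monom_op llet \<alpha> (\<Phi> m) \<in> Zo (size \<alpha>)"
      using W by (simp add: subspace_scale[OF subspace_Zo])
    have "of_nat (count \<alpha> k) *s llet k (monom_op llet (\<alpha> - {#k#}) (\<Phi> m)) = of_nat (count \<alpha> k) *s monom_op llet \<alpha> (\<Phi> m)"
    proof (cases "k \<in># \<alpha>")
      case in\<alpha>: True
      have "llet k (monom_op llet (\<alpha> - {#k#}) (\<Phi> m)) = monom_op llet (add_mset k (\<alpha> - {#k#})) (\<Phi> m)"
        using add.hyps True by (intro monom_op_add_max[symmetric]) (auto dest: in_diffD)
      then show ?thesis using in\<alpha> by simp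
    qed (simp add: not_in_iff)
    then have "llow k (monom_op llet (add_mset j \<alpha>) m) +
        of_nat (count (add_mset j \<alpha>) k) *s monom_op llet (add_mset j \<alpha> - {#k#}) (\<Phi> m) =
        llet k (llow k ?e + of_nat (count \<alpha> k) *s monom_op llet (\<alpha> - {#k#}) (\<Phi> m)) -
        (\<Phi> ?e - monom_op llet \<alpha> (\<Phi> m))"
      unfolding eq' by (auto simp add: True lin_op_add[OF lin_llet] lin_op_scale[OF lin_llet] scale_left_distrib)
    then show ?thesis using subspace_diff[OF subspace_Zo llet_Zo[OF IH] \<Phi>] by simp
  qed
qed

lemma descent_Lo:
  assumes "e \<in> Lo n" "e \<noteq> 0"
  obtains ks where "foldr llow ks e \<in> M0" "foldr llow ks e \<noteq> 0"
proof -
  \<comment> \<open>With the least possible degree, the leading part cannot vanish: otherwise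
    \<open>e\<close> would lie in \<open>Zo k\<close>, that is, in a smaller degree or be
    zero.\<close>
  define k where "k = (LEAST n. e \<in> Lo n)"
  have k: "e \<in> Lo k" unfolding k_def by (rule LeastI) (rule assms(1))
  have least: "e \<notin> Zo k"
  proof (cases k)
    case (Suc j)
    then show ?thesis using not_less_Least[of j "\<lambda>n. e \<in> Lo n"] by (simp add: k_def)
  qed (use assms(2) in simp)
  obtain e' where e': "e' \<in> span {monom_op llet \<alpha> m | \<alpha> m. \<alpha> \<in> {\<alpha>. size \<alpha> = k} \<and> m \<in> M0}" "e - e' \<in> Zo k"
    by (rule Lo_leading[OF k])
  obtain S f where S: "finite S" "S \<subseteq> {\<alpha>. size \<alpha> = k}" "\<forall>\<alpha>\<in>S. f \<alpha> \<in> M0 \<and> f \<alpha> \<noteq> 0"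
      "e' = (\<Sum>\<alpha>\<in>S. monom_op llet \<alpha> (f \<alpha>))"
    by (rule span_monom_rep[OF e'(1) subspace_M0 lin_op_monom[OF lin_llet]])
  have "S \<noteq> {}" using S(4) e'(2) least by auto
  obtain ks where "foldr llow ks e \<in> M0" "foldr llow ks e \<noteq> 0"
  proof (rule lowering[where D = llow and Y = "monom_op llet" and B = M0 and Z = Zo
      and A = "\<lambda>n. {\<alpha>. size \<alpha> = n}" and \<Psi> = "\<lambda>\<alpha> k b. - of_nat (Suc (count \<alpha> k)) *s \<Phi> b" and n = k and S = S and f = f and e = e])
    show "llow j z \<in> Zo (n - 1)" if "z \<in> Zo n" for j z n
      unfolding llow_def using that by (intro W_Zo) auto
    show "\<alpha> \<in> {\<alpha>. size \<alpha> = n - 1} \<and> - of_nat (Suc (count \<alpha> j)) *s \<Phi> b \<in> M0 \<and>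
        (b \<noteq> 0 \<longrightarrow> - of_nat (Suc (count \<alpha> j)) *s \<Phi> b \<noteq> 0) \<and>
        llow j (monom_op llet (add_mset j \<alpha>) b) - monom_op llet \<alpha> (- of_nat (Suc (count \<alpha> j)) *s \<Phi> b) \<in> Zo (n - 1)"
      if "add_mset j \<alpha> \<in> {\<alpha>. size \<alpha> = n}" "b \<in> M0" "\<And>i. i \<in># \<alpha> \<Longrightarrow> i \<le> j" for \<alpha> j b n
    proof (intro conjI impI)
      show "\<alpha> \<in> {\<alpha>. size \<alpha> = n - 1}" using that by auto
      show "- of_nat (Suc (count \<alpha> j)) *s \<Phi> b \<in> M0"
        using that by (intro subspace_scale[OF subspace_M0] M0_\<Phi>)
      show "- of_nat (Suc (count \<alpha> j)) *s \<Phi> b \<noteq> 0" if "b \<noteq> 0"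
        using \<Phi>_M0_eq_0[of b] that \<open>b \<in> M0\<close> by (auto simp del: of_nat_Suc)
      show "llow j (monom_op llet (add_mset j \<alpha>) b) - monom_op llet \<alpha> (- of_nat (Suc (count \<alpha> j)) *s \<Phi> b) \<in> Zo (n - 1)"
      proof -
        have "llow j (monom_op llet (add_mset j \<alpha>) b) +
            of_nat (count (add_mset j \<alpha>) j) *s monom_op llet (add_mset j \<alpha> - {#j#}) (\<Phi> b)
            \<in> Zo (size (add_mset j \<alpha>) - 1)"
          by (rule llow_monom[OF that(2)]) (use that(3) in auto)
        then show ?thesis using that(1)
          by (auto simp: lin_op_scale[OF lin_op_monom[OF lin_llet]] lin_op_minus[OF lin_op_monom[OF lin_llet]]
              simp del: of_nat_Suc)
      qed
    qed
    show "llow j (monom_op llet \<alpha> b) \<in> Zo (n - 1)"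
      if "\<alpha> \<in> {\<alpha>. size \<alpha> = n}" "b \<in> M0" "\<And>i. i \<in># \<alpha> \<Longrightarrow> i < j" for \<alpha> j b n
    proof -
      have "count \<alpha> j = 0" using that(3)[of j] by (auto simp: not_in_iff[symmetric])
      then show ?thesis using llow_monom[OF that(2), of \<alpha> j] that(1,3) by (auto simp: less_imp_le)
    qed
  qed (use S \<open>S \<noteq> {}\<close> e'(2) lin_llow subspace_Zo that in auto)
  then show ?thesis using that by blast
qed

text \<open>The hypothesis on \<open>e\<close> says that it lies in the subspace generated from
  \<open>B0\<close> by the operators, without naming that subspace. The union of the
  \<open>Lo n\<close> is stable under all operators, so \<open>e\<close> has some degree, and the
  three layers are removed in turn.\<close>

theorem word_descent:
  assumes e: "\<And>U. subspace U \<Longrightarrow> B0 \<subseteq> U \<Longrightarrow> (\<And>b x. x \<in> U \<Longrightarrow> opr b x \<in> U) \<Longrightarrow> e \<in> U" and "e \<noteq> 0"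
  obtains w where "foldr opr w e \<in> B0" "foldr opr w e \<noteq> 0"
proof -
  have "e \<in> (\<Union>n. Lo n)"
  proof (rule e)
    show "subspace (\<Union>n. Lo n)"
    proof (rule subspaceI)
      show "0 \<in> (\<Union>n. Lo n)" using subspace_0[OF subspace_Lo] by blast
      show "c *s x \<in> (\<Union>n. Lo n)" if "x \<in> (\<Union>n. Lo n)" for c x
        using subspace_scale[OF subspace_Lo] that by blast
      fix x y assume "x \<in> (\<Union>n. Lo n)" "y \<in> (\<Union>n. Lo n)"
      then obtain m n where "x \<in> Lo m" "y \<in> Lo n" by blast
      then have "x \<in> Lo (max m n)" "y \<in> Lo (max m n)"
        using Lo_mono[of m "max m n"] Lo_mono[of n "max m n"] by auto
      then show "x + y \<in> (\<Union>n. Lo n)" using subspace_add[OF subspace_Lo] by blast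
    qed
    show "B0 \<subseteq> (\<Union>n. Lo n)"
    proof
      fix b assume "b \<in> B0"
      then have "b \<in> M1" using M1_gen[of b "{#}"] by simp
      then have "b \<in> M0" using M0_gen[of "{#}" b] by (simp add: strict_monoms_def)
      then show "b \<in> (\<Union>n. Lo n)" using Lo_gen[of b "[]"] by auto
    qed
    show "opr b x \<in> (\<Union>n. Lo n)" if "x \<in> (\<Union>n. Lo n)" for b x
      using that opr_Lo by blast
  qed
  then obtain n where n: "e \<in> Lo n" by blast
  obtain ks where ks: "foldr llow ks e \<in> M0" "foldr llow ks e \<noteq> 0"
    using descent_Lo[OF n assms(2)] .
  obtain ks' where ks': "foldr glow ks' (foldr llow ks e) \<in> M1" "foldr glow ks' (foldr llow ks e) \<noteq> 0"
    using descent_M0[OF ks] .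
  obtain ks'' where ks'': "foldr wlow ks'' (foldr glow ks' (foldr llow ks e)) \<in> B0"
      "foldr wlow ks'' (foldr glow ks' (foldr llow ks e)) \<noteq> 0"
    using descent_M1[OF ks'] .
  define w where "w = map (\<lambda>k. Lgen (int t + int d + 1 + int k)) ks'' @
    map (\<lambda>k. Ggen (int t + 1 + int k)) ks' @ map (\<lambda>k. Wgen (int t + 1 + int k)) ks"
  have "foldr opr w e = foldr wlow ks'' (foldr glow ks' (foldr llow ks e))"
    by (simp add: w_def foldr_map comp_def wlow_def[abs_def] glow_def[abs_def] llow_def[abs_def])
  then show ?thesis using ks'' that[of w] by simp
qed

end

section \<open>Complex modules\<close>

lemma complex_ring_simps [simp]:
  "c \<in> carrier complex_ring" "x \<otimes>\<^bsub>complex_ring\<^esub> y = x * y" "x \<oplus>\<^bsub>complex_ring\<^esub> y = x + y"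
  "\<one>\<^bsub>complex_ring\<^esub> = 1" "\<zero>\<^bsub>complex_ring\<^esub> = 0"
  by (simp_all add: ring_of_type_algebra_def)

lemma complex_ring_a_inv [simp]: "\<ominus>\<^bsub>complex_ring\<^esub> c = - c"
proof -
  interpret R: cring complex_ring by (rule cring_from_type_algebra)
  show ?thesis by (rule R.minus_equality) simp_all
qed

section \<open>Complex modules in record form and linear sections of their quotients\<close>

locale complex_module = module complex_ring V for V :: "(complex, 'v, 'r) module_scheme" (structure)
begin

lemma sm_closed [simp, intro]: "x \<in> carrier V \<Longrightarrow> c \<odot> x \<in> carrier V"
  by (rule smult_closed) simp_all

lemma sm_l_distr: "x \<in> carrier V \<Longrightarrow> (a + b) \<odot> x = a \<odot> x \<oplus> b \<odot> x"
  using smult_l_distr[of a b x] by simp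

lemma sm_r_distr: "x \<in> carrier V \<Longrightarrow> y \<in> carrier V \<Longrightarrow> c \<odot> (x \<oplus> y) = c \<odot> x \<oplus> c \<odot> y"
  by (rule smult_r_distr) simp_all

lemma sm_assoc: "x \<in> carrier V \<Longrightarrow> (a * b) \<odot> x = a \<odot> (b \<odot> x)"
  using smult_assoc1[of a b x] by simp

lemma sm_one [simp]: "x \<in> carrier V \<Longrightarrow> 1 \<odot> x = x"
  using smult_one[of x] by simp

lemma sm_zero [simp]: "x \<in> carrier V \<Longrightarrow> 0 \<odot> x = \<zero>" "c \<odot> \<zero> = \<zero>"
  using smult_l_null[of x] smult_r_null[of c] by simp_all

lemma sm_minus: "x \<in> carrier V \<Longrightarrow> (- c) \<odot> x = \<ominus> (c \<odot> x)"
  using smult_l_minus[of c x] by simp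

lemma sm_neg_one: "x \<in> carrier V \<Longrightarrow> (- 1) \<odot> x = \<ominus> x"
  using sm_minus[of x 1] by simp

definition lin_ext :: "('k \<Rightarrow> 'v) \<Rightarrow> ('k \<Rightarrow>\<^sub>0 complex) \<Rightarrow> 'v" where
  "lin_ext f x = (\<Oplus>k\<in>Poly_Mapping.keys x. Poly_Mapping.lookup x k \<odot> f k)"

lemma lin_ext_eq:
  assumes "finite A" "Poly_Mapping.keys x \<subseteq> A" "f \<in> A \<rightarrow> carrier V"
  shows "lin_ext f x = (\<Oplus>k\<in>A. Poly_Mapping.lookup x k \<odot> f k)"
  unfolding lin_ext_def using assms
  by (intro M.add.finprod_mono_neutral_cong_left) (auto simp: in_keys_iff Pi_iff)

lemma lin_ext_closed: "f \<in> Poly_Mapping.keys x \<rightarrow> carrier V \<Longrightarrow> lin_ext f x \<in> carrier V"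
  unfolding lin_ext_def by (rule M.finsum_closed) (auto simp: Pi_iff)

lemma lin_ext_zero [simp]: "lin_ext f 0 = \<zero>"
  by (simp add: lin_ext_def)

lemma lin_ext_single: "f k \<in> carrier V \<Longrightarrow> lin_ext f (Poly_Mapping.single k c) = c \<odot> f k"
  by (subst lin_ext_eq[of "{k}"]) auto

lemma lin_ext_add:
  assumes "f \<in> Poly_Mapping.keys x \<rightarrow> carrier V" "f \<in> Poly_Mapping.keys y \<rightarrow> carrier V"
  shows "lin_ext f (x + y) = lin_ext f x \<oplus> lin_ext f y"
proof -
  let ?A = "Poly_Mapping.keys x \<union> Poly_Mapping.keys y"
  have A: "Poly_Mapping.keys (x + y) \<subseteq> ?A" by (rule Poly_Mapping.keys_add)
  have f: "f \<in> ?A \<rightarrow> carrier V" using assms by auto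
  have "lin_ext f (x + y) = (\<Oplus>k\<in>?A. Poly_Mapping.lookup (x + y) k \<odot> f k)"
    using A f by (intro lin_ext_eq) auto
  also have "\<dots> = (\<Oplus>k\<in>?A. Poly_Mapping.lookup x k \<odot> f k \<oplus> Poly_Mapping.lookup y k \<odot> f k)"
    by (rule M.add.finprod_cong') (use f in \<open>auto simp: lookup_add sm_l_distr Pi_iff\<close>)
  also have "\<dots> = (\<Oplus>k\<in>?A. Poly_Mapping.lookup x k \<odot> f k) \<oplus> (\<Oplus>k\<in>?A. Poly_Mapping.lookup y k \<odot> f k)"
    using f by (intro M.finsum_addf) (auto simp: Pi_iff)
  finally show ?thesis
    using f by (subst (1 2) lin_ext_eq[of ?A]) (auto simp: Pi_iff)
qed

end

definition pm_scale :: "complex \<Rightarrow> ('k \<Rightarrow>\<^sub>0 complex) \<Rightarrow> ('k \<Rightarrow>\<^sub>0 complex)" where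
  "pm_scale c x = Poly_Mapping.map ((*) c) x"

lemma lookup_pm_scale [simp]: "Poly_Mapping.lookup (pm_scale c x) k = c * Poly_Mapping.lookup x k"
  by (simp add: pm_scale_def Poly_Mapping.map.rep_eq when_def)

lemma keys_pm_scale: "Poly_Mapping.keys (pm_scale c x) \<subseteq> Poly_Mapping.keys x"
  by (auto simp: in_keys_iff)

interpretation pm: complex_space "pm_scale :: complex \<Rightarrow> ('k \<Rightarrow>\<^sub>0 complex) \<Rightarrow> _"
  unfolding complex_space_def
  by (unfold_locales; rule poly_mapping_eqI; simp add: lookup_add algebra_simps)

context complex_module
begin

lemma lin_ext_scale:
  assumes "f \<in> Poly_Mapping.keys x \<rightarrow> carrier V"
  shows "lin_ext f (pm_scale c x) = c \<odot> lin_ext f x"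
proof -
  have "lin_ext f (pm_scale c x) = (\<Oplus>k\<in>Poly_Mapping.keys x. Poly_Mapping.lookup (pm_scale c x) k \<odot> f k)"
    using keys_pm_scale[of c x] assms by (intro lin_ext_eq) auto
  also have "\<dots> = (\<Oplus>k\<in>Poly_Mapping.keys x. c \<odot> (Poly_Mapping.lookup x k \<odot> f k))"
    by (rule M.add.finprod_cong') (use assms in \<open>auto simp: sm_assoc Pi_iff\<close>)
  also have "\<dots> = c \<odot> lin_ext f x"
    unfolding lin_ext_def using assms by (intro finsum_smult_ldistr[symmetric]) (auto simp: Pi_iff)
  finally show ?thesis .
qed

text \<open>
  A linear section of \<open>\<complex>\<^sup>(\<^sup>V\<^sup>) \<rightarrow> V \<rightarrow> V/U\<close> transfers questions about \<open>V/U\<close> to a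
  type of class \<open>ab_group_add\<close> with everywhere defined operations.
\<close>

definition eval_pm :: "('v \<Rightarrow>\<^sub>0 complex) \<Rightarrow> 'v" where
  "eval_pm = lin_ext (\<lambda>v. if v \<in> carrier V then v else \<zero>)"

lemma eval_pm_closed: "eval_pm x \<in> carrier V"
  unfolding eval_pm_def by (rule lin_ext_closed) auto

lemma eval_pm_add: "eval_pm (x + y) = eval_pm x \<oplus> eval_pm y"
  unfolding eval_pm_def by (rule lin_ext_add) auto

lemma eval_pm_scale: "eval_pm (pm_scale c x) = c \<odot> eval_pm x"
  unfolding eval_pm_def by (rule lin_ext_scale) auto

lemma eval_pm_single: "v \<in> carrier V \<Longrightarrow> eval_pm (Poly_Mapping.single v c) = c \<odot> v"
  unfolding eval_pm_def by (subst lin_ext_single) auto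

lemma eval_pm_zero: "eval_pm 0 = \<zero>"
  by (simp add: eval_pm_def)

lemma eval_pm_diff: "eval_pm (x - y) = eval_pm x \<ominus> eval_pm y"
proof -
  have "eval_pm (x - y) = eval_pm x \<oplus> eval_pm (pm_scale (-1) y)"
    using eval_pm_add[of x "- y"] pm.scale_minus_left[of 1 y] by simp
  then show ?thesis
    by (simp only: eval_pm_scale sm_neg_one[OF eval_pm_closed] a_minus_def)
qed

text \<open>\<open>N\<close> is the kernel of the composite map to V/U. A basis of \<open>N\<close>
  is extended to the whole space, and \<open>p\<close> kills the former and fixes the added vectors,
  so \<open>p\<close> has kernel \<open>N\<close> and \<open>p x - x\<close> lies in
  \<open>N\<close>. The section is \<open>p\<close> on the symbols of vectors; it is linear since
  the symbols are linear modulo \<open>N\<close>.\<close>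

theorem section_exists:
  assumes U: "submodule U complex_ring V"
  obtains s :: "'v \<Rightarrow> 'v \<Rightarrow>\<^sub>0 complex" where
    "\<And>v w. v \<in> carrier V \<Longrightarrow> w \<in> carrier V \<Longrightarrow> s (v \<oplus> w) = s v + s w"
    "\<And>v c. v \<in> carrier V \<Longrightarrow> s (c \<odot> v) = pm_scale c (s v)"
    "\<And>v. v \<in> carrier V \<Longrightarrow> s v = 0 \<longleftrightarrow> v \<in> U"
    "\<And>v. v \<in> carrier V \<Longrightarrow> eval_pm (s v) \<ominus> v \<in> U"
proof -
  note UE = submoduleE[OF U]
  define N where "N = {x. eval_pm x \<in> U}"
  have zeroU: "\<zero> \<in> U"
  proof -
    obtain u where "u \<in> U" using UE(2) by blast
    with UE(4)[of 0 u] UE(1) show ?thesis by auto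
  qed
  have N: "pm.subspace N"
    using UE zeroU by (auto simp: pm.subspace_def N_def eval_pm_zero eval_pm_add eval_pm_scale)
  obtain B where B: "B \<subseteq> N" "pm.independent B" "pm.span B = N"
    by (metis pm.basis_exists[of N] pm.span_subspace N)
  interpret P: vector_space_pair "pm_scale :: complex \<Rightarrow> ('v \<Rightarrow>\<^sub>0 complex) \<Rightarrow> _" "pm_scale :: complex \<Rightarrow> ('v \<Rightarrow>\<^sub>0 complex) \<Rightarrow> _" ..
  define E where "E = pm.extend_basis B"
  have E: "B \<subseteq> E" "pm.independent E" "pm.span E = UNIV"
    using B(2) pm.extend_basis_superset pm.independent_extend_basis pm.span_extend_basis by (auto simp: E_def)
  define p where "p = P.construct E (\<lambda>b. if b \<in> B then 0 else b)"
  have lin: "Vector_Spaces.linear pm_scale pm_scale p"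
    unfolding p_def by (rule P.linear_construct[OF E(2)])
  have lin_op: "pm.lin_op p"
    using P.linear_add[OF lin] P.linear_scale[OF lin] by (simp add: pm.lin_op_def)
  have p_basis: "p b = (if b \<in> B then 0 else b)" if "b \<in> E" for b
    unfolding p_def by (rule P.construct_basis[OF E(2) that])
  have pN: "p x = 0" if "x \<in> N" for x
  proof -
    have "p x \<in> {0}"
      by (rule pm.lin_op_span[where f = p and S = B, OF lin_op _ pm.subspace_single_0]) (use that p_basis E(1) B(3) in auto)
    then show ?thesis by simp
  qed
  have id: "p x - x \<in> N" for x
  proof (rule pm.lin_op_span[where f = "\<lambda>x. p x - x" and S = E])
    show "pm.lin_op (\<lambda>x. p x - x)"
      using lin_op by (simp add: pm.lin_op_def pm.scale_right_diff_distrib)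
    show "p x - x \<in> N" if "x \<in> E" for x
      using p_basis[OF that] B(1) pm.subspace_neg[OF N] pm.subspace_0[OF N] by auto
  qed (use N E in auto)
  have ker: "p x = 0 \<longleftrightarrow> x \<in> N" for x
    using pN[of x] id[of x] pm.subspace_neg[OF N, of "- x"] by auto
  have congr: "p x = p y" if "x - y \<in> N" for x y
    using ker[of "x - y"] that by (simp add: pm.lin_op_diff[OF lin_op])
  show ?thesis
  proof (rule that[of "\<lambda>v. p (Poly_Mapping.single v 1)"])
    fix v w c assume v: "v \<in> carrier V"
    show "p (Poly_Mapping.single v 1) = 0 \<longleftrightarrow> v \<in> U"
      using v by (simp add: ker N_def eval_pm_single)
    show "eval_pm (p (Poly_Mapping.single v 1)) \<ominus> v \<in> U"
      using id[of "Poly_Mapping.single v 1"] v by (simp add: N_def eval_pm_diff eval_pm_single)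
    have "p (Poly_Mapping.single (c \<odot> v) 1) = p (pm_scale c (Poly_Mapping.single v 1))"
      using v zeroU by (intro congr) (simp add: N_def eval_pm_diff eval_pm_single eval_pm_scale M.r_neg a_minus_def)
    then show "p (Poly_Mapping.single (c \<odot> v) 1) = pm_scale c (p (Poly_Mapping.single v 1))"
      by (simp add: pm.lin_op_scale[OF lin_op])
    assume w: "w \<in> carrier V"
    have "p (Poly_Mapping.single (v \<oplus> w) 1) = p (Poly_Mapping.single v 1 + Poly_Mapping.single w 1)"
      using v w zeroU by (intro congr) (simp add: N_def eval_pm_diff eval_pm_single eval_pm_add M.r_neg a_minus_def)
    then show "p (Poly_Mapping.single (v \<oplus> w) 1) = p (Poly_Mapping.single v 1) + p (Poly_Mapping.single w 1)"
      by (simp add: pm.lin_op_add[OF lin_op])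
  qed
qed

text \<open>Some coordinate of the section is nonzero at \<open>v\<close>, and all coordinates
  vanish on \<open>U\<close>.\<close>

lemma functional_exists:
  assumes "submodule U complex_ring V" "v \<in> carrier V" "v \<notin> U"
  obtains l :: "'v \<Rightarrow> complex" where
    "\<And>v w. v \<in> carrier V \<Longrightarrow> w \<in> carrier V \<Longrightarrow> l (v \<oplus> w) = l v + l w"
    "\<And>v c. v \<in> carrier V \<Longrightarrow> l (c \<odot> v) = c * l v"
    "\<And>u. u \<in> U \<Longrightarrow> l u = 0" "l v \<noteq> 0"
proof (rule section_exists[OF assms(1)])
  fix s :: "'v \<Rightarrow> 'v \<Rightarrow>\<^sub>0 complex"
  assume s: "\<And>v w. v \<in> carrier V \<Longrightarrow> w \<in> carrier V \<Longrightarrow> s (v \<oplus> w) = s v + s w"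
    "\<And>v c. v \<in> carrier V \<Longrightarrow> s (c \<odot> v) = pm_scale c (s v)"
    "\<And>v. v \<in> carrier V \<Longrightarrow> s v = 0 \<longleftrightarrow> v \<in> U"
  from s(3) assms(2,3) have "s v \<noteq> 0" by blast
  then obtain k where k: "Poly_Mapping.lookup (s v) k \<noteq> 0"
    by (metis poly_mapping_eqI lookup_zero)
  have "s u = 0" if "u \<in> U" for u
    using s(3)[of u] that submoduleE(1)[OF assms(1)] by blast
  then show ?thesis
    using s(1,2) k
    by (intro that[of "\<lambda>v. Poly_Mapping.lookup (s v) k"]) (auto simp: lookup_add)
qed

end

section \<open>Modules over the enveloping algebra\<close>

lemma free_alg_simps [simp]:
  "p \<in> carrier (free_alg S) \<longleftrightarrow> Poly_Mapping.keys p \<subseteq> lists S"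
  "p \<otimes>\<^bsub>free_alg S\<^esub> q = free_alg_mult p q" "p \<oplus>\<^bsub>free_alg S\<^esub> q = p + q"
  "\<zero>\<^bsub>free_alg S\<^esub> = 0" "\<one>\<^bsub>free_alg S\<^esub> = Poly_Mapping.single [] 1"
  by (simp_all add: free_alg_def)

lemma keys_add_subset: "Poly_Mapping.keys p \<subseteq> A \<Longrightarrow> Poly_Mapping.keys q \<subseteq> A \<Longrightarrow> Poly_Mapping.keys (p + q) \<subseteq> A"
  using Poly_Mapping.keys_add[of p q] by blast

lemma keys_induct [consumes 1, case_names zero single add]:
  fixes x :: "'b \<Rightarrow>\<^sub>0 'c::comm_monoid_add"
  assumes "Poly_Mapping.keys x \<subseteq> A" and "P 0"
    and "\<And>b c. b \<in> A \<Longrightarrow> P (Poly_Mapping.single b c)"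
    and add: "\<And>x y. Poly_Mapping.keys x \<subseteq> A \<Longrightarrow> Poly_Mapping.keys y \<subseteq> A \<Longrightarrow> P x \<Longrightarrow> P y \<Longrightarrow> P (x + y)"
  shows "P x"
proof -
  have "P (\<Sum>b\<in>B. Poly_Mapping.single b (Poly_Mapping.lookup x b)) \<and>
      Poly_Mapping.keys (\<Sum>b\<in>B. Poly_Mapping.single b (Poly_Mapping.lookup x b)) \<subseteq> A"
    if "finite B" "B \<subseteq> Poly_Mapping.keys x" for B
    using that
  proof (induction B)
    case (insert b B)
    then have b: "b \<in> A" using assms(1) by blast
    then have k: "Poly_Mapping.keys (Poly_Mapping.single b (Poly_Mapping.lookup x b)) \<subseteq> A" by simp
    have "B \<subseteq> Poly_Mapping.keys x" using insert.prems by simp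
    note IH = insert.IH[OF this]
    show ?case
      unfolding sum.insert[OF insert.hyps]
      by (intro conjI add keys_add_subset k assms(3) b IH[THEN conjunct1] IH[THEN conjunct2])
  qed (use assms(2) in simp)
  from this[of "Poly_Mapping.keys x"] show ?thesis by (simp add: sum_monomials)
qed

lemma single_uminus': "- Poly_Mapping.single k (c::complex) = Poly_Mapping.single k (- c)"
  by (rule poly_mapping_eqI) (simp add: lookup_single when_def)

section \<open>The enveloping algebra and its action on ungraded modules\<close>

locale enveloping = lie_superalgebra g for g :: "'g lie_superalgebra" (structure)

lemma (in lie_superalgebra) part_carrier: "x \<in> parity_part g i \<Longrightarrow> x \<in> carrier g"
  using submoduleE(1)[OF part_submodule] by blast

text \<open>A supermodule stripped of its grading. It has to cover \<open>functionals\<close>, which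
  gets no grading, and the induced module at a stage where its parity parts are not yet known to be
  independent.\<close>

locale lie_action = complex_module V + g: enveloping g
  for g :: "'g lie_superalgebra" and V :: "('g, 'v) supermodule" (structure) +
  assumes act_closed [simp]:
      "\<lbrakk>x \<in> carrier g; v \<in> carrier V\<rbrakk> \<Longrightarrow> act V x v \<in> carrier V"
    and act_add_left:
      "\<lbrakk>x \<in> carrier g; y \<in> carrier g; v \<in> carrier V\<rbrakk> \<Longrightarrow>
        act V (x \<oplus>\<^bsub>g\<^esub> y) v = act V x v \<oplus> act V y v"
    and act_add_right:
      "\<lbrakk>x \<in> carrier g; v \<in> carrier V; w \<in> carrier V\<rbrakk> \<Longrightarrow>
        act V x (v \<oplus> w) = act V x v \<oplus> act V x w"
    and act_smult_left:
      "\<lbrakk>x \<in> carrier g; v \<in> carrier V\<rbrakk> \<Longrightarrow> act V (c \<odot>\<^bsub>g\<^esub> x) v = c \<odot> act V x v"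
    and act_smult_right:
      "\<lbrakk>x \<in> carrier g; v \<in> carrier V\<rbrakk> \<Longrightarrow> act V x (c \<odot> v) = c \<odot> act V x v"
    and act_bracket:
      "\<lbrakk>x \<in> parity_part g i; y \<in> parity_part g j; v \<in> carrier V\<rbrakk> \<Longrightarrow>
        act V (bracket g x y) v =
          act V x (act V y v) \<ominus> koszul_sign i j \<odot> act V y (act V x v)"

lemma lie_actionI:
  assumes "lie_superalgebra g" "supermodule g V"
  shows "lie_action g V"
proof -
  interpret g: enveloping g by (rule enveloping.intro) fact
  interpret supermodule g V by fact
  show ?thesis
    by (intro lie_action.intro complex_module.intro lie_action_axioms.intro module_axioms g.enveloping_axioms;
        rule act_closed act_add_left act_add_right act_smult_left act_smult_right act_bracket; assumption)
qed

context lie_action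
begin

lemma g_simps [simp]: "x \<in> carrier g \<Longrightarrow> c \<odot>\<^bsub>g\<^esub> x \<in> carrier g"
  "x \<in> carrier g \<Longrightarrow> y \<in> carrier g \<Longrightarrow> bracket g x y \<in> carrier g"
  using g.smult_closed[of c x] g.bracket_closed by simp_all

lemma foldr_act_closed [simp]: "xs \<in> lists (carrier g) \<Longrightarrow> v \<in> carrier V \<Longrightarrow> foldr (act V) xs v \<in> carrier V"
  by (induction xs) auto

lemma foldr_act_add: "xs \<in> lists (carrier g) \<Longrightarrow> v \<in> carrier V \<Longrightarrow> w \<in> carrier V \<Longrightarrow>
    foldr (act V) xs (v \<oplus> w) = foldr (act V) xs v \<oplus> foldr (act V) xs w"
  by (induction xs) (auto simp: act_add_right)

lemma foldr_act_smult: "xs \<in> lists (carrier g) \<Longrightarrow> v \<in> carrier V \<Longrightarrow>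
    foldr (act V) xs (c \<odot> v) = c \<odot> foldr (act V) xs v"
  by (induction xs) (auto simp: act_smult_right)

lemma free_alg_act_eq: "free_alg_act V p v = lin_ext (\<lambda>xs. foldr (act V) xs v) p"
  by (simp add: free_alg_act_def lin_ext_def)

lemma fa_closed [simp]: "Poly_Mapping.keys p \<subseteq> lists (carrier g) \<Longrightarrow> v \<in> carrier V \<Longrightarrow> free_alg_act V p v \<in> carrier V"
  unfolding free_alg_act_eq by (rule lin_ext_closed, rule Pi_I, rule foldr_act_closed) blast+

lemma fa_zero [simp]: "free_alg_act V 0 v = \<zero>"
  by (simp add: free_alg_act_eq)

lemma fa_add: "Poly_Mapping.keys p \<subseteq> lists (carrier g) \<Longrightarrow> Poly_Mapping.keys q \<subseteq> lists (carrier g) \<Longrightarrow>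
    v \<in> carrier V \<Longrightarrow> free_alg_act V (p + q) v = free_alg_act V p v \<oplus> free_alg_act V q v"
  unfolding free_alg_act_eq by (rule lin_ext_add; rule Pi_I, rule foldr_act_closed) blast+

lemma fa_single: "xs \<in> lists (carrier g) \<Longrightarrow> v \<in> carrier V \<Longrightarrow>
    free_alg_act V (Poly_Mapping.single xs c) v = c \<odot> foldr (act V) xs v"
  unfolding free_alg_act_eq by (rule lin_ext_single) auto

lemma fa_add_right:
  assumes "Poly_Mapping.keys p \<subseteq> lists (carrier g)" "v \<in> carrier V" "w \<in> carrier V"
  shows "free_alg_act V p (v \<oplus> w) = free_alg_act V p v \<oplus> free_alg_act V p w"
  using assms(1)
  by (induction p rule: keys_induct)
    (use assms in \<open>simp_all add: fa_single foldr_act_add sm_r_distr fa_add M.a_ac\<close>)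

lemma fa_smult_right:
  assumes "Poly_Mapping.keys p \<subseteq> lists (carrier g)" "v \<in> carrier V"
  shows "free_alg_act V p (c \<odot> v) = c \<odot> free_alg_act V p v"
  using assms(1)
  by (induction p rule: keys_induct)
    (use assms in \<open>simp_all add: fa_single foldr_act_smult sm_r_distr fa_add mult.commute[of _ c] flip: sm_assoc\<close>)

lemma fa_zero_right:
  assumes "Poly_Mapping.keys p \<subseteq> lists (carrier g)"
  shows "free_alg_act V p \<zero> = \<zero>"
  using fa_smult_right[OF assms, of \<zero> 0] assms by simp

lemma fa_mult:
  assumes "Poly_Mapping.keys p \<subseteq> lists (carrier g)" "Poly_Mapping.keys q \<subseteq> lists (carrier g)" "v \<in> carrier V"
  shows "free_alg_act V (free_alg_mult p q) v = free_alg_act V p (free_alg_act V q v)"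
  using assms(1)
proof (induction p rule: keys_induct)
  case zero
  show ?case by (simp add: free_alg_mult_zero)
next
  case (add p p')
  then show ?case
    using assms by (simp add: free_alg_mult_add fa_add keys_free_alg_mult)
next
  case (single xs c)
  show ?case
    using assms(2)
  proof (induction q rule: keys_induct)
    case zero
    show ?case using single by (simp add: free_alg_mult_zero fa_zero_right)
  next
    case (add q q')
    then show ?case using single assms(3)
      by (simp add: free_alg_mult_add fa_add keys_free_alg_mult fa_add_right)
  next
    case (single ys e)
    then show ?case using \<open>xs \<in> _\<close> assms(3)
      by (simp add: free_alg_mult_single fa_single foldr_act_smult sm_assoc)
  qed
qed

lemma fa_relator:
  assumes r: "r \<in> uea_relators g" and v: "v \<in> carrier V"
  shows "free_alg_act V r v = \<zero>"
proof -
  have minus: "a \<oplus> ((-1) \<odot> b \<oplus> (-1) \<odot> c) = \<zero>" if "a = b \<oplus> c" "b \<in> carrier V" "c \<in> carrier V" for a b c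
    using that by (simp flip: sm_r_distr) (simp add: sm_neg_one M.r_neg)
  note fa = fa_add fa_single keys_add_subset
  from r consider x y where "x \<in> carrier g" "y \<in> carrier g"
      "r = Poly_Mapping.single [x \<oplus>\<^bsub>g\<^esub> y] 1 + (Poly_Mapping.single [x] (-1) + Poly_Mapping.single [y] (-1))"
    | c x where "x \<in> carrier g" "r = Poly_Mapping.single [c \<odot>\<^bsub>g\<^esub> x] 1 + Poly_Mapping.single [x] (- c)"
    | x y i j where "x \<in> parity_part g i" "y \<in> parity_part g j"
      "r = Poly_Mapping.single [x, y] 1 +
        (Poly_Mapping.single [y, x] (- koszul_sign i j) + Poly_Mapping.single [bracket g x y] (-1))"
    unfolding uea_relators_def by (auto simp: diff_conv_add_uminus single_uminus' add.assoc simp del: add_uminus_conv_diff)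
  then show ?thesis
  proof cases
    case 1
    then show ?thesis using v by (simp add: fa act_add_left minus)
  next
    case 2
    then show ?thesis using v by (simp add: fa act_smult_left sm_minus M.r_neg)
  next
    case 3
    then have c: "x \<in> carrier g" "y \<in> carrier g" by (auto intro: g.part_carrier)
    let ?a = "act V x (act V y v)" and ?b = "koszul_sign i j \<odot> act V y (act V x v)"
    have "free_alg_act V r v = ?a \<oplus> (\<ominus> ?b \<oplus> \<ominus> (?a \<ominus> ?b))"
      using 3 c v by (simp add: fa sm_minus sm_neg_one act_bracket)
    also have "\<dots> = \<zero>"
      using c v by (simp add: a_minus_def M.minus_add M.a_ac M.r_neg M.r_neg1 M.r_neg2)
    finally show ?thesis .
  qed
qed

text \<open>The annihilator of V in the free algebra is a two-sided ideal that contains the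
  relators. Hence \<open>uea_act\<close> is independent of the representative.\<close>

lemma fa_ideal:
  assumes "p \<in> uea_ideal g" "v \<in> carrier V"
  shows "free_alg_act V p v = \<zero>"
proof -
  let ?R = "free_alg (carrier g)"
  let ?J = "{p. Poly_Mapping.keys p \<subseteq> lists (carrier g) \<and> (\<forall>v\<in>carrier V. free_alg_act V p v = \<zero>)}"
  interpret FR: ring ?R by (rule free_alg_ring)
  have inv: "\<ominus>\<^bsub>?R\<^esub> p = - p" if "Poly_Mapping.keys p \<subseteq> lists (carrier g)" for p
    using that by (intro FR.minus_equality) auto
  have "ideal ?J ?R"
  proof (rule idealI[OF free_alg_ring])
    show "subgroup ?J (add_monoid ?R)"
    proof (rule FR.add.subgroupI)
      show "\<ominus>\<^bsub>?R\<^esub> p \<in> ?J" if "p \<in> ?J" for p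
      proof -
        have k: "Poly_Mapping.keys p \<subseteq> lists (carrier g)" using that by blast
        have "free_alg_act V (- p) v = \<zero>" if v: "v \<in> carrier V" for v
        proof -
          have k': "Poly_Mapping.keys (- p) \<subseteq> lists (carrier g)" using k by simp
          have "free_alg_act V p v = \<zero>" using \<open>p \<in> ?J\<close> v by blast
          then show ?thesis
            using fa_add[OF k k' v] fa_closed[OF k' v] by (simp del: in_lists_conv_set)
        qed
        then show ?thesis using k by (simp add: inv)
      qed
      show "p \<oplus>\<^bsub>?R\<^esub> q \<in> ?J" if "p \<in> ?J" "q \<in> ?J" for p q
        using that keys_add_subset[of p "lists (carrier g)" q] by (simp add: fa_add del: in_lists_conv_set)
    qed (auto intro!: exI[of _ 0])
    show "x \<otimes>\<^bsub>?R\<^esub> a \<in> ?J" "a \<otimes>\<^bsub>?R\<^esub> x \<in> ?J" if "a \<in> ?J" "x \<in> carrier ?R" for a x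
      using that keys_free_alg_mult[of x "carrier g" a] keys_free_alg_mult[of a "carrier g" x]
      by (auto simp: fa_mult fa_zero_right)
  qed
  moreover have "uea_relators g \<subseteq> ?J"
  proof
    fix r assume r: "r \<in> uea_relators g"
    then have "r \<in> carrier ?R" using uea_relators_closed[OF g.lie_superalgebra_axioms] by (rule subsetD[rotated])
    with fa_relator[OF r] show "r \<in> ?J" by simp
  qed
  ultimately have "uea_ideal g \<subseteq> ?J"
    unfolding uea_ideal_def by (rule FR.genideal_minimal)
  then show ?thesis using assms by blast
qed

end

context enveloping
begin

lemma uea_ideal: "ideal (uea_ideal g) (free_alg (carrier g))"
  unfolding uea_ideal_def
  by (intro ring.genideal_ideal free_alg_ring uea_relators_closed lie_superalgebra_axioms)

lemma uea_ideal_closed: "p \<in> uea_ideal g \<Longrightarrow> Poly_Mapping.keys p \<subseteq> lists (carrier g)"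
  using ideal.Icarr[OF uea_ideal] by simp

lemma uea_class_eq: "uea_class g p = (\<lambda>i. i + p) ` uea_ideal g"
  by (auto simp: uea_class_def a_r_coset_def')

lemma zero_in_uea_ideal: "0 \<in> uea_ideal g"
  using additive_subgroup.zero_closed[OF ideal.axioms(1)[OF uea_ideal]] by simp

lemma self_in_uea_class: "p \<in> uea_class g p"
  using zero_in_uea_ideal by (force simp: uea_class_eq)

lemma uea_class_cong:
  assumes "p - q \<in> uea_ideal g" "Poly_Mapping.keys p \<subseteq> lists (carrier g)" "Poly_Mapping.keys q \<subseteq> lists (carrier g)"
  shows "uea_class g p = uea_class g q"
proof -
  interpret I: ideal "uea_ideal g" "free_alg (carrier g)" by (rule uea_ideal)
  have "p \<in> uea_class g q" using assms(1) by (force simp: uea_class_eq)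
  then show ?thesis
    unfolding uea_class_def using assms(3) by (intro I.a_repr_independence[symmetric] I.a_subgroup) simp_all
qed

lemma carrier_uea: "carrier (uea g) = uea_class g ` {p. Poly_Mapping.keys p \<subseteq> lists (carrier g)}"
  by (auto simp: uea_def FactRing_def A_RCOSETS_def' uea_class_def)

lemma uea_class_closed [simp, intro]: "Poly_Mapping.keys p \<subseteq> lists (carrier g) \<Longrightarrow> uea_class g p \<in> carrier (uea g)"
  by (simp add: carrier_uea)

lemma uea_mult:
  assumes "Poly_Mapping.keys p \<subseteq> lists (carrier g)" "Poly_Mapping.keys q \<subseteq> lists (carrier g)"
  shows "uea_class g p \<otimes>\<^bsub>uea g\<^esub> uea_class g q = uea_class g (free_alg_mult p q)"
  using ideal.rcoset_mult_add[OF uea_ideal, of p q] assms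
  by (simp add: uea_def FactRing_def uea_class_def)

lemma uea_add:
  assumes "Poly_Mapping.keys p \<subseteq> lists (carrier g)" "Poly_Mapping.keys q \<subseteq> lists (carrier g)"
  shows "uea_class g p \<oplus>\<^bsub>uea g\<^esub> uea_class g q = uea_class g (p + q)"
  using ideal.a_rcos_sum[OF uea_ideal, of p q] assms
  by (simp add: uea_def FactRing_def uea_class_def)

lemma uea_one: "\<one>\<^bsub>uea g\<^esub> = uea_class g (Poly_Mapping.single [] 1)"
  by (simp add: uea_def FactRing_def uea_class_def)

text \<open>The elements of \<open>uea_ideal g\<close> supported on words over \<open>H\<close> form
  an ideal of the free algebra on \<open>H\<close> containing the relators of the subalgebra. So
  representatives that agree in U(h) agree in U(g), and \<open>the_elem\<close> has a single value
  to pick.\<close>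

lemma uea_incl_class:
  assumes H: "H \<subseteq> carrier g" and h: "lie_superalgebra (sub_superalgebra g H)"
    and p: "Poly_Mapping.keys p \<subseteq> lists H"
  shows "uea_incl (sub_superalgebra g H) g (uea_class (sub_superalgebra g H) p) = uea_class g p"
proof -
  let ?h = "sub_superalgebra g H"
  interpret h: enveloping ?h by (rule enveloping.intro) fact
  interpret FR: ring "free_alg H" by (rule free_alg_ring)
  interpret I: ideal "uea_ideal g" "free_alg (carrier g)" by (rule uea_ideal)
  have ch: "carrier ?h = H" by (simp add: sub_superalgebra_def)
  have lists: "lists H \<subseteq> lists (carrier g)" using H by auto
  have inv: "\<ominus>\<^bsub>free_alg S\<^esub> p = - p" if "Poly_Mapping.keys p \<subseteq> lists S" for p and S :: "'a set"
    using that by (intro abelian_group.minus_equality ring.is_abelian_group free_alg_ring) auto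
  let ?J = "{p. Poly_Mapping.keys p \<subseteq> lists H \<and> p \<in> uea_ideal g}"
  have "ideal ?J (free_alg H)"
  proof (rule idealI[OF free_alg_ring])
    show "subgroup ?J (add_monoid (free_alg H))"
    proof (rule FR.add.subgroupI)
      show "\<ominus>\<^bsub>free_alg H\<^esub> p \<in> ?J" if "p \<in> ?J" for p
      proof -
        have "Poly_Mapping.keys p \<subseteq> lists H" "Poly_Mapping.keys p \<subseteq> lists (carrier g)" "p \<in> uea_ideal g"
          using that lists by auto
        with subgroup.m_inv_closed[OF I.a_subgroup, of p, folded a_inv_def] inv[of p H] inv[of p "carrier g"]
        show ?thesis by simp
      qed
      show "p \<oplus>\<^bsub>free_alg H\<^esub> q \<in> ?J" if "p \<in> ?J" "q \<in> ?J" for p q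
        using that subgroup.m_closed[OF I.a_subgroup, of p q] keys_add_subset[of p "lists H" q] by (simp del: in_lists_conv_set)
    qed (use zero_in_uea_ideal in \<open>auto intro!: exI[of _ 0]\<close>)
    show "x \<otimes>\<^bsub>free_alg H\<^esub> a \<in> ?J" "a \<otimes>\<^bsub>free_alg H\<^esub> x \<in> ?J" if "a \<in> ?J" "x \<in> carrier (free_alg H)" for a x
    proof -
      have "Poly_Mapping.keys a \<subseteq> lists H" "Poly_Mapping.keys x \<subseteq> lists H"
        "Poly_Mapping.keys x \<subseteq> lists (carrier g)" "a \<in> uea_ideal g"
        using that lists by auto
      then show "x \<otimes>\<^bsub>free_alg H\<^esub> a \<in> ?J" "a \<otimes>\<^bsub>free_alg H\<^esub> x \<in> ?J"
        using I.I_l_closed[of a x] I.I_r_closed[of a x] keys_free_alg_mult[of x H a] keys_free_alg_mult[of a H x]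
        by simp_all
    qed
  qed
  moreover have "uea_relators ?h \<subseteq> ?J"
  proof -
    have "uea_relators ?h \<subseteq> uea_relators g"
      unfolding uea_relators_def sub_superalgebra_def using H by (simp, blast)
    moreover have "uea_relators g \<subseteq> uea_ideal g"
      using uea_relators_closed[OF lie_superalgebra_axioms]
        ring.genideal_self[OF free_alg_ring, of "uea_relators g" "carrier g"] by (simp add: uea_ideal_def)
    moreover have "p \<in> uea_relators ?h \<Longrightarrow> Poly_Mapping.keys p \<subseteq> lists H" for p
      using subsetD[OF uea_relators_closed[OF h], of p] by (simp add: ch)
    ultimately show ?thesis by blast
  qed
  ultimately have sub: "uea_ideal ?h \<subseteq> uea_ideal g"
    using FR.genideal_minimal[of ?J "uea_relators ?h"] unfolding uea_ideal_def[of ?h] ch by blast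
  have "uea_class g q = uea_class g p" if "q \<in> uea_class ?h p" for q
  proof -
    obtain i where i: "i \<in> uea_ideal ?h" "q = i + p" using \<open>q \<in> _\<close> by (auto simp: h.uea_class_eq)
    have "Poly_Mapping.keys i \<subseteq> lists (carrier g)" "Poly_Mapping.keys p \<subseteq> lists (carrier g)"
      using h.uea_ideal_closed[OF i(1)] p lists unfolding ch by (blast intro: order_trans)+
    moreover have "q - p \<in> uea_ideal g" using sub i by auto
    ultimately show ?thesis
      unfolding i(2) by (intro uea_class_cong keys_add_subset) simp_all
  qed
  then have "uea_class g ` uea_class ?h p = {uea_class g p}"
    using h.self_in_uea_class by blast
  then show ?thesis by (simp add: uea_incl_def)
qed

end

lemma (in lie_action) uea_act_class:
  assumes "Poly_Mapping.keys p \<subseteq> lists (carrier g)" "v \<in> carrier V"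
  shows "uea_act V (uea_class g p) v = free_alg_act V p v"
proof -
  have "(\<lambda>p. free_alg_act V p v) ` uea_class g p = {free_alg_act V p v}"
    using assms fa_ideal g.uea_ideal_closed g.zero_in_uea_ideal
    by (force simp: g.uea_class_eq fa_add image_iff)
  then show ?thesis by (simp add: uea_act_def)
qed

section \<open>Induced modules\<close>

lemma (in enveloping) g_add_closed: "x \<in> carrier g \<Longrightarrow> y \<in> carrier g \<Longrightarrow> x \<oplus> y \<in> carrier g"
  by (rule M.a_closed)

section \<open>The induced module, before its grading\<close>

locale induced = enveloping g for g :: "'g lie_superalgebra" +
  fixes H :: "'g set" and V :: "('g, 'v) supermodule"
  assumes H_sub: "H \<subseteq> carrier g"
    and lie_h: "lie_superalgebra (sub_superalgebra g H)"
    and supermodule_V: "supermodule (sub_superalgebra g H) V"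
begin

abbreviation "h \<equiv> sub_superalgebra g H"
abbreviation "UV \<equiv> carrier (uea g) \<times> carrier V"
abbreviation "FG \<equiv> free_Abelian_group UV"
abbreviation "K \<equiv> ind_kernel g h V"
abbreviation "ic \<equiv> ind_class g h V"
abbreviation "uc \<equiv> uea_class g"
abbreviation "M \<equiv> ind_module g h V"

sublocale V: lie_action h V
  by (rule lie_actionI[OF lie_h supermodule_V])

sublocale U: ring "uea g"
  by (rule uea_ring) (rule lie_superalgebra_axioms)

lemma carrier_h [simp]: "carrier h = H"
  by (simp add: sub_superalgebra_def)

lemma lists_H: "lists H \<subseteq> lists (carrier g)"
  using H_sub by auto

definition "rel = tensor_relators (uea h) (uea g) V (\<lambda>u a. u \<otimes>\<^bsub>uea g\<^esub> uea_incl h g a) (uea_act V)"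

lemma K_eq: "K = generate FG rel"
  by (simp add: ind_kernel_def tensor_kernel_def rel_def)

text \<open>Elements of U(h) are replaced by representatives in the free algebra, which removes
  \<open>uea_incl\<close> and \<open>uea_act\<close>, and with them both uses of
  \<open>the_elem\<close>, from the arguments that follow.\<close>

lemma rel_cases [consumes 1, case_names left right balanced]:
  assumes "r \<in> rel"
  obtains u u' v where "u \<in> carrier (uea g)" "u' \<in> carrier (uea g)" "v \<in> carrier V"
      "r = frag_of (u \<oplus>\<^bsub>uea g\<^esub> u', v) - frag_of (u, v) - frag_of (u', v)"
  | u v v' where "u \<in> carrier (uea g)" "v \<in> carrier V" "v' \<in> carrier V"
      "r = frag_of (u, v \<oplus>\<^bsub>V\<^esub> v') - frag_of (u, v) - frag_of (u, v')"
  | u p v where "u \<in> carrier (uea g)" "Poly_Mapping.keys p \<subseteq> lists H" "v \<in> carrier V"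
      "r = frag_of (u \<otimes>\<^bsub>uea g\<^esub> uc p, v) - frag_of (u, free_alg_act V p v)"
  using assms unfolding rel_def tensor_relators_def
proof (elim UnE CollectE exE conjE)
  fix u u' v assume "r = frag_of (u \<oplus>\<^bsub>uea g\<^esub> u', v) - frag_of (u, v) - frag_of (u', v)"
    "u \<in> carrier (uea g)" "u' \<in> carrier (uea g)" "v \<in> carrier V"
  then show ?thesis using that(1) by simp
next
  fix u v v' assume "r = frag_of (u, v \<oplus>\<^bsub>V\<^esub> v') - frag_of (u, v) - frag_of (u, v')"
    "u \<in> carrier (uea g)" "v \<in> carrier V" "v' \<in> carrier V"
  then show ?thesis using that(2) by simp
next
  fix u a v assume b: "r = frag_of (u \<otimes>\<^bsub>uea g\<^esub> uea_incl h g a, v) - frag_of (u, uea_act V a v)"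
    "u \<in> carrier (uea g)" "a \<in> carrier (uea h)" "v \<in> carrier V"
  from b(3) obtain p where p: "a = uea_class h p" "Poly_Mapping.keys p \<subseteq> lists H"
    unfolding V.g.carrier_uea carrier_h by blast
  have "r = frag_of (u \<otimes>\<^bsub>uea g\<^esub> uc p, v) - frag_of (u, free_alg_act V p v)"
    using b(1,4) p V.uea_act_class[of p v] uea_incl_class[OF H_sub lie_h p(2)]
    by (simp del: in_lists_conv_set)
  then show ?thesis by (rule that(3)[OF b(2) p(2) b(4)])
qed

lemma rel_left:
  assumes "u \<in> carrier (uea g)" "u' \<in> carrier (uea g)" "v \<in> carrier V"
  shows "frag_of (u \<oplus>\<^bsub>uea g\<^esub> u', v) - frag_of (u, v) - frag_of (u', v) \<in> K"
  unfolding K_eq rel_def tensor_relators_def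
  by (rule generate.incl, rule UnI1, rule UnI1) (use assms in blast)

lemma rel_right:
  assumes "u \<in> carrier (uea g)" "v \<in> carrier V" "v' \<in> carrier V"
  shows "frag_of (u, v \<oplus>\<^bsub>V\<^esub> v') - frag_of (u, v) - frag_of (u, v') \<in> K"
  unfolding K_eq rel_def tensor_relators_def
  by (rule generate.incl, rule UnI1, rule UnI2) (use assms in blast)

lemma rel_balanced:
  assumes "u \<in> carrier (uea g)" "Poly_Mapping.keys p \<subseteq> lists H" "v \<in> carrier V"
  shows "frag_of (u \<otimes>\<^bsub>uea g\<^esub> uc p, v) - frag_of (u, free_alg_act V p v) \<in> K"
proof -
  have "uea_class h p \<in> carrier (uea h)" using assms(2) by (intro V.g.uea_class_closed) simp
  then have "frag_of (u \<otimes>\<^bsub>uea g\<^esub> uea_incl h g (uea_class h p), v) - frag_of (u, uea_act V (uea_class h p) v) \<in> rel"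
    using assms unfolding rel_def tensor_relators_def by (intro UnI2 CollectI exI conjI) (rule refl | assumption)+
  then show ?thesis
    using V.uea_act_class[of p v] uea_incl_class[OF H_sub lie_h assms(2)] assms
    unfolding K_eq by (auto intro: generate.incl)
qed

lemma uc_lists_H: "Poly_Mapping.keys p \<subseteq> lists H \<Longrightarrow> uc p \<in> carrier (uea g)"
  using lists_H by (intro uea_class_closed) blast

lemma fa_closed: "Poly_Mapping.keys p \<subseteq> lists H \<Longrightarrow> v \<in> carrier V \<Longrightarrow> free_alg_act V p v \<in> carrier V"
  using V.fa_closed[of p v] by simp

lemma keys_diff_subset: "Poly_Mapping.keys p \<subseteq> A \<Longrightarrow> Poly_Mapping.keys q \<subseteq> A \<Longrightarrow> Poly_Mapping.keys (p - q) \<subseteq> A"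
  using keys_diff[of p q] by blast

lemma rel_closed: "rel \<subseteq> carrier FG"
proof
  fix r assume "r \<in> rel"
  then show "r \<in> carrier FG"
    unfolding carrier_free_Abelian_group_iff
    by (cases rule: rel_cases; hypsubst; intro keys_diff_subset; simp add: keys_frag_of uc_lists_H fa_closed)
qed

lemma subgroup_K: "subgroup K FG"
  unfolding K_eq by (rule group.generate_is_subgroup[OF group_free_Abelian_group rel_closed])

lemma K_closed: "f \<in> K \<Longrightarrow> Poly_Mapping.keys f \<subseteq> UV"
  using subgroup.mem_carrier[OF subgroup_K] by simp

lemma K_zero [simp]: "0 \<in> K"
  using subgroup.one_closed[OF subgroup_K] by simp

lemma K_add: "f \<in> K \<Longrightarrow> f' \<in> K \<Longrightarrow> f + f' \<in> K"
  using subgroup.m_closed[OF subgroup_K] by simp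

lemma K_minus: "f \<in> K \<Longrightarrow> - f \<in> K"
  using subgroup.m_inv_closed[OF subgroup_K, of f] K_closed[of f] by simp

lemma K_diff: "f \<in> K \<Longrightarrow> f' \<in> K \<Longrightarrow> f - f' \<in> K"
  using K_add[of f "- f'"] K_minus by simp

lemma K_induct [consumes 1, case_names zero rel minus add]:
  assumes "f \<in> K" "P 0" "\<And>r. r \<in> rel \<Longrightarrow> P r" "\<And>f. P f \<Longrightarrow> P (- f)" "\<And>f f'. P f \<Longrightarrow> P f' \<Longrightarrow> P (f + f')"
  shows "P f"
  using assms(1) unfolding K_eq
proof (induction rule: generate.induct)
  case (inv r)
  then have "inv\<^bsub>FG\<^esub> r = - r" using rel_closed by auto
  then show ?case using assms inv by simp
qed (use assms in auto)

lemma ic_eq_image: "ic f = (\<lambda>k. k + f) ` K"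
  by (auto simp: ind_class_def r_coset_def)

lemma ic_eq_iff: "ic f = ic f' \<longleftrightarrow> f - f' \<in> K"
proof
  assume "ic f = ic f'"
  moreover have "f \<in> ic f" using K_zero by (force simp: ic_eq_image)
  ultimately show "f - f' \<in> K" by (auto simp: ic_eq_image)
next
  assume k: "f - f' \<in> K"
  have sub: "ic f \<subseteq> ic f'" if "f - f' \<in> K" for f f'
  proof
    fix z assume "z \<in> ic f"
    then obtain k where "k \<in> K" "z = k + f" by (auto simp: ic_eq_image)
    then have "z = (k + (f - f')) + f'" "k + (f - f') \<in> K" using that K_add by auto
    then show "z \<in> ic f'" unfolding ic_eq_image by blast
  qed
  have "f' - f \<in> K" using K_minus[OF k] by simp
  then show "ic f = ic f'" using sub[OF k] sub[of f' f] by blast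
qed

lemma carrier_M: "carrier M = ic ` {f. Poly_Mapping.keys f \<subseteq> UV}"
  by (auto simp: ind_module_def ind_group_def tensor_group_def FactGroup_def RCOSETS_def ind_class_def ind_kernel_def)

lemma mult_ind_group: "ic f \<otimes>\<^bsub>ind_group g h V\<^esub> ic f' = ic (f + f')"
proof -
  have "ic f \<otimes>\<^bsub>ind_group g h V\<^esub> ic f' = {x + y | x y. x \<in> ic f \<and> y \<in> ic f'}"
    by (auto simp: ind_group_def tensor_group_def FactGroup_def set_mult_def)
  also have "\<dots> = ic (f + f')"
  proof (intro equalityI subsetI)
    fix z assume "z \<in> {x + y | x y. x \<in> ic f \<and> y \<in> ic f'}"
    then obtain k k' where "k \<in> K" "k' \<in> K" "z = (k + k') + (f + f')"
      by (auto simp: ic_eq_image ac_simps)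
    then show "z \<in> ic (f + f')" using K_add unfolding ic_eq_image by blast
  next
    fix z assume "z \<in> ic (f + f')"
    then obtain k where "k \<in> K" "z = (k + f) + (0 + f')" by (auto simp: ic_eq_image ac_simps)
    then show "z \<in> {x + y | x y. x \<in> ic f \<and> y \<in> ic f'}" using K_zero unfolding ic_eq_image by blast
  qed
  finally show ?thesis .
qed

lemma one_ind_group: "\<one>\<^bsub>ind_group g h V\<^esub> = ic 0"
  by (simp add: ind_group_def tensor_group_def FactGroup_def ic_eq_image ind_kernel_def)

lemma M_add: "ic f \<oplus>\<^bsub>M\<^esub> ic f' = ic (f + f')"
  by (simp add: ind_module_def mult_ind_group)

lemma M_zero: "\<zero>\<^bsub>M\<^esub> = ic 0"
  by (simp add: ind_module_def one_ind_group)

lemma carrier_M_cases: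
  assumes "z \<in> carrier M"
  obtains f where "z = ic f" "Poly_Mapping.keys f \<subseteq> UV"
  using assms by (auto simp: carrier_M)

lemma ic_closed: "Poly_Mapping.keys f \<subseteq> UV \<Longrightarrow> ic f \<in> carrier M"
  by (auto simp: carrier_M)

lemma abelian_group_M: "abelian_group M"
proof (rule abelian_groupI)
  show "\<exists>y\<in>carrier M. y \<oplus>\<^bsub>M\<^esub> x = \<zero>\<^bsub>M\<^esub>" if "x \<in> carrier M" for x
  proof -
    from that obtain f where "x = ic f" "Poly_Mapping.keys f \<subseteq> UV" by (rule carrier_M_cases)
    then show ?thesis by (intro bexI[of _ "ic (- f)"]) (auto simp: M_add M_zero intro!: ic_closed)
  qed
  show "\<zero>\<^bsub>M\<^esub> \<in> carrier M" by (simp add: M_zero ic_closed)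
qed (elim carrier_M_cases; simp add: M_add M_zero ac_simps ic_closed keys_add_subset)+

definition lm :: "('g list \<Rightarrow>\<^sub>0 complex) set \<Rightarrow> (('g list \<Rightarrow>\<^sub>0 complex) set \<times> 'v \<Rightarrow>\<^sub>0 int) \<Rightarrow> (('g list \<Rightarrow>\<^sub>0 complex) set \<times> 'v \<Rightarrow>\<^sub>0 int)" where
  "lm u = frag_extend (\<lambda>(w, v). frag_of (u \<otimes>\<^bsub>uea g\<^esub> w, v))"

lemma lm_simps [simp]: "lm u 0 = 0" "lm u (f + f') = lm u f + lm u f'" "lm u (f - f') = lm u f - lm u f'"
  "lm u (- f) = - lm u f" "lm u (frag_of (w, v)) = frag_of (u \<otimes>\<^bsub>uea g\<^esub> w, v)"
  by (simp_all add: lm_def frag_extend_add frag_extend_diff frag_extend_minus)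

lemma lm_closed: "u \<in> carrier (uea g) \<Longrightarrow> Poly_Mapping.keys f \<subseteq> UV \<Longrightarrow> Poly_Mapping.keys (lm u f) \<subseteq> UV"
  unfolding lm_def by (rule order_trans[OF keys_frag_extend]) (auto simp: keys_frag_of)

text \<open>Left multiplication commutes with the right action of U(h), so it turns relators into
  relators. This makes \<open>ind_lmult\<close> well defined on cosets.\<close>

lemma lm_K:
  assumes u: "u \<in> carrier (uea g)" and "f \<in> K"
  shows "lm u f \<in> K"
  using assms(2)
proof (induction rule: K_induct)
  case (rel r)
  from rel show ?case
  proof (cases rule: rel_cases)
    case (left w w' v)
    then show ?thesis using rel_left[of "u \<otimes>\<^bsub>uea g\<^esub> w" "u \<otimes>\<^bsub>uea g\<^esub> w'" v] u by (simp add: U.r_distr)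
  next
    case (right w v v')
    then show ?thesis using rel_right[of "u \<otimes>\<^bsub>uea g\<^esub> w" v v'] u by simp
  next
    case (balanced w p v)
    then show ?thesis
      using rel_balanced[of "u \<otimes>\<^bsub>uea g\<^esub> w" p v] u by (simp add: U.m_assoc uc_lists_H)
  qed
qed (auto intro: K_minus K_add)

lemma lmult_ic:
  assumes u: "u \<in> carrier (uea g)"
  shows "ind_lmult g h V u (ic f) = ic (lm u f)"
proof -
  have "ic (lm u f') = ic (lm u f)" if "f' \<in> ic f" for f'
  proof -
    from that obtain k where "k \<in> K" "f' = k + f" by (auto simp: ic_eq_image)
    then show ?thesis using lm_K[OF u] by (simp add: ic_eq_iff)
  qed
  moreover have "f \<in> ic f" using K_zero by (force simp: ic_eq_image)
  ultimately have "(\<lambda>f. ic (lm u f)) ` ic f = {ic (lm u f)}" by blast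
  then show ?thesis by (simp add: ind_lmult_def lm_def)
qed

text \<open>Additivity in \<open>u\<close> holds only modulo \<open>K\<close>, because distinct
  pairs are independent in the free abelian group; on a generator the defect is a relator.\<close>

lemma lm_add_left:
  assumes "u \<in> carrier (uea g)" "u' \<in> carrier (uea g)" "Poly_Mapping.keys f \<subseteq> UV"
  shows "lm (u \<oplus>\<^bsub>uea g\<^esub> u') f - lm u f - lm u' f \<in> K"
  using assms(3)
proof (induction f rule: frag_induction)
  case (diff a b)
  have "lm (u \<oplus>\<^bsub>uea g\<^esub> u') (a - b) - lm u (a - b) - lm u' (a - b) =
      (lm (u \<oplus>\<^bsub>uea g\<^esub> u') a - lm u a - lm u' a) - (lm (u \<oplus>\<^bsub>uea g\<^esub> u') b - lm u b - lm u' b)" by simp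
  then show ?case using K_diff diff by metis
next
  case (one x)
  then show ?case
    using rel_left[of "u \<otimes>\<^bsub>uea g\<^esub> fst x" "u' \<otimes>\<^bsub>uea g\<^esub> fst x" "snd x"] assms(1,2)
    by (cases x) (simp add: U.l_distr)
qed simp

lemma lm_mult:
  assumes "u \<in> carrier (uea g)" "u' \<in> carrier (uea g)" "Poly_Mapping.keys f \<subseteq> UV"
  shows "lm (u \<otimes>\<^bsub>uea g\<^esub> u') f = lm u (lm u' f)"
  using assms(3)
  by (induction f rule: frag_induction) (use assms(1,2) in \<open>auto simp: U.m_assoc\<close>)

lemma lm_one: "Poly_Mapping.keys f \<subseteq> UV \<Longrightarrow> lm \<one>\<^bsub>uea g\<^esub> f = f"
  by (induction f rule: frag_induction) auto

definition um where "um = ind_lmult g h V"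

lemma um_ic: "u \<in> carrier (uea g) \<Longrightarrow> um u (ic f) = ic (lm u f)"
  by (simp add: um_def lmult_ic)

lemma um_closed [simp]: "u \<in> carrier (uea g) \<Longrightarrow> z \<in> carrier M \<Longrightarrow> um u z \<in> carrier M"
  by (elim carrier_M_cases) (simp add: um_ic ic_closed lm_closed)

lemma um_add_right: "u \<in> carrier (uea g) \<Longrightarrow> z \<in> carrier M \<Longrightarrow> z' \<in> carrier M \<Longrightarrow>
    um u (z \<oplus>\<^bsub>M\<^esub> z') = um u z \<oplus>\<^bsub>M\<^esub> um u z'"
  by (auto elim!: carrier_M_cases simp: um_ic M_add)

lemma um_add_left: "u \<in> carrier (uea g) \<Longrightarrow> u' \<in> carrier (uea g) \<Longrightarrow> z \<in> carrier M \<Longrightarrow>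
    um (u \<oplus>\<^bsub>uea g\<^esub> u') z = um u z \<oplus>\<^bsub>M\<^esub> um u' z"
  by (elim carrier_M_cases) (simp add: um_ic M_add ic_eq_iff lm_add_left[unfolded diff_diff_add])

lemma um_mult: "u \<in> carrier (uea g) \<Longrightarrow> u' \<in> carrier (uea g) \<Longrightarrow> z \<in> carrier M \<Longrightarrow>
    um (u \<otimes>\<^bsub>uea g\<^esub> u') z = um u (um u' z)"
  by (auto elim!: carrier_M_cases simp: um_ic lm_mult)

lemma um_one: "z \<in> carrier M \<Longrightarrow> um \<one>\<^bsub>uea g\<^esub> z = z"
  by (auto elim!: carrier_M_cases simp: um_ic lm_one)

definition "sc c = uc (Poly_Mapping.single [] c)"
definition "gen x = uc (Poly_Mapping.single [x] 1)"

lemma M_smult: "c \<odot>\<^bsub>M\<^esub> z = um (sc c) z" and M_act: "act M x z = um (gen x) z"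
  by (simp_all add: ind_module_def um_def sc_def gen_def)

lemma sc_closed [simp]: "sc c \<in> carrier (uea g)" and gen_closed [simp]: "x \<in> carrier g \<Longrightarrow> gen x \<in> carrier (uea g)"
  by (auto simp: sc_def gen_def intro!: uea_class_closed)

lemma sc_add: "sc (a + b) = sc a \<oplus>\<^bsub>uea g\<^esub> sc b"
  unfolding sc_def by (subst uea_add) (auto simp: single_add)

lemma sc_mult: "sc (a * b) = sc a \<otimes>\<^bsub>uea g\<^esub> sc b"
  unfolding sc_def by (subst uea_mult) (auto simp: free_alg_mult_single)

lemma sc_one: "sc 1 = \<one>\<^bsub>uea g\<^esub>"
  by (simp add: sc_def uea_one)

lemma sc_commute: "x \<in> carrier g \<Longrightarrow> sc c \<otimes>\<^bsub>uea g\<^esub> gen x = gen x \<otimes>\<^bsub>uea g\<^esub> sc c"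
  unfolding sc_def gen_def by (subst (1 2) uea_mult) (auto simp: free_alg_mult_single)

lemma uc_relator:
  assumes "p - q \<in> uea_relators g" "Poly_Mapping.keys p \<subseteq> lists (carrier g)" "Poly_Mapping.keys q \<subseteq> lists (carrier g)"
  shows "uc p = uc q"
proof (rule uea_class_cong[OF _ assms(2,3)])
  show "p - q \<in> uea_ideal g"
    using assms(1) ring.genideal_self[OF free_alg_ring uea_relators_closed[OF lie_superalgebra_axioms]]
    unfolding uea_ideal_def by blast
qed

lemma gen_add:
  assumes "x \<in> carrier g" "y \<in> carrier g"
  shows "gen (x \<oplus>\<^bsub>g\<^esub> y) = gen x \<oplus>\<^bsub>uea g\<^esub> gen y"
proof -
  have "Poly_Mapping.single [x \<oplus>\<^bsub>g\<^esub> y] 1 - (Poly_Mapping.single [x] 1 + Poly_Mapping.single [y] 1) \<in> uea_relators g"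
    unfolding uea_relators_def diff_diff_add[symmetric] using assms by blast
  then have "uc (Poly_Mapping.single [x \<oplus>\<^bsub>g\<^esub> y] 1) = uc (Poly_Mapping.single [x] 1 + Poly_Mapping.single [y] 1)"
    using assms by (intro uc_relator keys_add_subset) (simp_all add: g_add_closed)
  then show ?thesis
    unfolding gen_def using assms by (simp add: uea_add)
qed

lemma gen_smult:
  assumes "x \<in> carrier g"
  shows "gen (c \<odot>\<^bsub>g\<^esub> x) = sc c \<otimes>\<^bsub>uea g\<^esub> gen x"
proof -
  have "Poly_Mapping.single [c \<odot>\<^bsub>g\<^esub> x] 1 - Poly_Mapping.single [x] c \<in> uea_relators g"
    unfolding uea_relators_def using assms by blast
  then have "uc (Poly_Mapping.single [c \<odot>\<^bsub>g\<^esub> x] 1) = uc (Poly_Mapping.single [x] c)"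
    using assms smult_closed[of c x] by (intro uc_relator) simp_all
  then show ?thesis
    unfolding gen_def sc_def using assms by (simp add: uea_mult free_alg_mult_single)
qed

lemma gen_bracket:
  assumes "x \<in> parity_part g i" "y \<in> parity_part g j"
  shows "gen (bracket g x y) = gen x \<otimes>\<^bsub>uea g\<^esub> gen y \<oplus>\<^bsub>uea g\<^esub> sc (- koszul_sign i j) \<otimes>\<^bsub>uea g\<^esub> (gen y \<otimes>\<^bsub>uea g\<^esub> gen x)"
proof -
  have c: "x \<in> carrier g" "y \<in> carrier g" "bracket g x y \<in> carrier g"
    using assms part_carrier bracket_closed by auto
  let ?q = "Poly_Mapping.single [x, y] 1 + Poly_Mapping.single [y, x] (- koszul_sign i j)"
  have "?q - Poly_Mapping.single [bracket g x y] 1 \<in> uea_relators g"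
    unfolding uea_relators_def single_uminus'[symmetric] add_uminus_conv_diff using assms by blast
  then have "uc ?q = gen (bracket g x y)"
    unfolding gen_def using c by (intro uc_relator keys_add_subset) simp_all
  moreover have "uc ?q = gen x \<otimes>\<^bsub>uea g\<^esub> gen y \<oplus>\<^bsub>uea g\<^esub> sc (- koszul_sign i j) \<otimes>\<^bsub>uea g\<^esub> (gen y \<otimes>\<^bsub>uea g\<^esub> gen x)"
    unfolding gen_def sc_def using c by (simp add: uea_mult uea_add free_alg_mult_single)
  ultimately show ?thesis by simp
qed

sublocale M: complex_module M
proof (rule complex_module.intro, rule moduleI)
  show "cring complex_ring" by (rule cring_from_type_algebra)
  show "abelian_group M" by (rule abelian_group_M)
qed (simp_all add: M_smult um_add_right um_add_left um_mult um_one sc_add sc_mult sc_one)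

sublocale M: lie_action g M
proof unfold_locales
  fix x y v i j assume x: "x \<in> parity_part g i" "y \<in> parity_part g j" and v: "v \<in> carrier M"
  then have c: "x \<in> carrier g" "y \<in> carrier g" using part_carrier by auto
  show "act M (bracket g x y) v = act M x (act M y v) \<ominus>\<^bsub>M\<^esub> koszul_sign i j \<odot>\<^bsub>M\<^esub> act M y (act M x v)"
    unfolding a_minus_def using c v
    by (subst M.sm_minus[symmetric]) (simp_all add: M_act M_smult gen_bracket[OF x] um_add_left um_mult)
qed (simp_all add: M_act M_smult um_add_right um_add_left um_mult gen_add gen_smult flip: um_mult sc_commute)

text \<open>Injectivity of this canonical map is the consequence of Poincare-Birkhoff-Witt that
  matters here; it is reached in \<open>\<iota>_eq_zero\<close>.\<close>

definition "\<iota> v = ic (frag_of (\<one>\<^bsub>uea g\<^esub>, v))"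

lemma \<iota>_closed [simp]: "v \<in> carrier V \<Longrightarrow> \<iota> v \<in> carrier M"
  unfolding \<iota>_def by (intro ic_closed) (simp add: keys_frag_of)

lemma \<iota>_add: "v \<in> carrier V \<Longrightarrow> w \<in> carrier V \<Longrightarrow> \<iota> (v \<oplus>\<^bsub>V\<^esub> w) = \<iota> v \<oplus>\<^bsub>M\<^esub> \<iota> w"
  using rel_right[of "\<one>\<^bsub>uea g\<^esub>" v w] by (simp add: \<iota>_def M_add ic_eq_iff diff_diff_add)

lemma um_\<iota>:
  assumes "Poly_Mapping.keys p \<subseteq> lists H" "v \<in> carrier V"
  shows "um (uc p) (\<iota> v) = \<iota> (free_alg_act V p v)"
  using rel_balanced[of "\<one>\<^bsub>uea g\<^esub>" p v] assms
  by (simp add: \<iota>_def um_ic uc_lists_H ic_eq_iff del: in_lists_conv_set)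

lemma \<iota>_smult: "v \<in> carrier V \<Longrightarrow> \<iota> (c \<odot>\<^bsub>V\<^esub> v) = c \<odot>\<^bsub>M\<^esub> \<iota> v"
  using um_\<iota>[of "Poly_Mapping.single [] c" v] V.fa_single[of "[]" v c] by (simp add: M_smult sc_def)

lemma \<iota>_act: "x \<in> H \<Longrightarrow> v \<in> carrier V \<Longrightarrow> \<iota> (act V x v) = act M x (\<iota> v)"
  using um_\<iota>[of "Poly_Mapping.single [x] 1" v] V.fa_single[of "[x]" v 1] V.act_closed[of x v]
  by (simp add: M_act gen_def)

lemma frag_uc: 
  assumes "Poly_Mapping.keys p \<subseteq> lists (carrier g)" "v \<in> carrier V"
  shows "ic (frag_of (uc p, v)) = um (uc p) (\<iota> v)"
  using assms by (simp add: \<iota>_def um_ic uea_class_closed del: in_lists_conv_set)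

lemma um_word:
  assumes "xs \<in> lists (carrier g)" "z \<in> carrier M"
  shows "um (uc (Poly_Mapping.single xs c)) z = c \<odot>\<^bsub>M\<^esub> foldr (act M) xs z"
  using assms(1)
proof (induction xs)
  case Nil
  then show ?case by (simp add: M_smult sc_def)
next
  case (Cons x xs)
  have "uc (Poly_Mapping.single (x # xs) c) = gen x \<otimes>\<^bsub>uea g\<^esub> uc (Poly_Mapping.single xs c)"
    unfolding gen_def using Cons.hyps Cons.prems by (subst uea_mult) (auto simp: free_alg_mult_single)
  then have "um (uc (Poly_Mapping.single (x # xs) c)) z = act M x (um (uc (Poly_Mapping.single xs c)) z)"
    using Cons.prems Cons.hyps assms(2) by (simp add: um_mult M_act uea_class_closed)
  then show ?case using Cons assms(2) by (simp add: M.act_smult_right)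
qed

text \<open>Every tensor is a sum of words in g applied to vectors \<open>\<iota> v\<close>, up to
  scalars, so the image of V generates the induced module.\<close>

theorem M_induct [consumes 1, case_names add smult act gen]:
  assumes z: "z \<in> carrier M"
    and add: "\<And>y z. y \<in> carrier M \<Longrightarrow> z \<in> carrier M \<Longrightarrow> P y \<Longrightarrow> P z \<Longrightarrow> P (y \<oplus>\<^bsub>M\<^esub> z)"
    and smult: "\<And>c z. z \<in> carrier M \<Longrightarrow> P z \<Longrightarrow> P (c \<odot>\<^bsub>M\<^esub> z)"
    and act: "\<And>x z. x \<in> carrier g \<Longrightarrow> z \<in> carrier M \<Longrightarrow> P z \<Longrightarrow> P (act M x z)"
    and gen: "\<And>v. v \<in> carrier V \<Longrightarrow> P (\<iota> v)"
  shows "P z"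
proof -
  obtain f where f: "z = ic f" "Poly_Mapping.keys f \<subseteq> UV" using z by (rule carrier_M_cases)
  have zero: "P \<zero>\<^bsub>M\<^esub>" using smult[of "\<iota> \<zero>\<^bsub>V\<^esub>" 0] gen[of "\<zero>\<^bsub>V\<^esub>"] by simp
  have words: "P (foldr (act M) xs (\<iota> v))" if "xs \<in> lists (carrier g)" "v \<in> carrier V" for xs v
    using that by (induction xs rule: lists.induct) (auto intro!: act gen M.foldr_act_closed)
  have pure: "P (um (uc p) (\<iota> v))" if "Poly_Mapping.keys p \<subseteq> lists (carrier g)" "v \<in> carrier V" for p v
    using that(1)
  proof (induction p rule: keys_induct)
    case zero
    have "um (uc 0) (\<iota> v) = \<zero>\<^bsub>M\<^esub>"
      using um_word[of "[]" "\<iota> v" 0] that(2) by simp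
    then show ?case using \<open>P \<zero>\<^bsub>M\<^esub>\<close> by simp
  next
    case (single xs c)
    then show ?case using that(2) by (simp add: um_word smult words)
  next
    case (add p q)
    then have "um (uc (p + q)) (\<iota> v) = um (uc p) (\<iota> v) \<oplus>\<^bsub>M\<^esub> um (uc q) (\<iota> v)"
      using that(2) by (simp add: um_add_left uea_class_closed flip: uea_add del: in_lists_conv_set)
    then show ?case using add that(2) \<open>\<And>y z. y \<in> carrier M \<Longrightarrow> z \<in> carrier M \<Longrightarrow> P y \<Longrightarrow> P z \<Longrightarrow> P (y \<oplus>\<^bsub>M\<^esub> z)\<close>
      by (simp add: uea_class_closed del: in_lists_conv_set)
  qed
  have "P (ic f) \<and> Poly_Mapping.keys f \<subseteq> UV"
    using f(2)
  proof (induction f rule: frag_induction)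
    case zero
    show ?case using \<open>P \<zero>\<^bsub>M\<^esub>\<close> by (simp add: M_zero)
  next
    case (one x)
    then obtain p v where x: "x = (uc p, v)" "Poly_Mapping.keys p \<subseteq> lists (carrier g)" "v \<in> carrier V"
      by (auto simp: carrier_uea simp del: in_lists_conv_set)
    then show ?case using pure[OF x(2,3)] one by (simp add: frag_uc keys_frag_of)
  next
    case (diff a b)
    then have b: "ic b \<in> carrier M" "ic a \<in> carrier M" by (auto intro!: ic_closed)
    have "ic (a - b) = ic a \<oplus>\<^bsub>M\<^esub> (-1) \<odot>\<^bsub>M\<^esub> ic b"
    proof -
      have "\<ominus>\<^bsub>M\<^esub> ic b = ic (- b)"
        using b diff by (intro M.M.minus_equality) (auto simp: M_add M_zero intro!: ic_closed)
      then show ?thesis using b by (simp add: M.sm_neg_one M_add)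
    qed
    then show ?case using diff b by (simp add: add smult keys_diff_subset)
  qed
  then show ?thesis using f(1) by simp
qed

end

section \<open>The parity grading of the induced module\<close>

context induced
begin

sublocale VS: supermodule h V
  by (rule supermodule_V)

lemma V_part: "v \<in> parity_part V i \<Longrightarrow> v \<in> carrier V"
  using V.submoduleE(1)[OF VS.part_submodule] by blast

abbreviation "IG \<equiv> ind_group g h V"

lemma group_IG: "group IG"
proof -
  have "normal K FG"
    using comm_group.normal_iff_subgroup[OF abelian_free_Abelian_group] subgroup_K by blast
  then have "group (FG Mod K)" by (rule normal.factorgroup_is_group)
  then show ?thesis by (simp add: ind_group_def tensor_group_def ind_kernel_def)
qed

lemma IG_simps [simp]: "carrier IG = carrier M" "y \<otimes>\<^bsub>IG\<^esub> z = y \<oplus>\<^bsub>M\<^esub> z" "\<one>\<^bsub>IG\<^esub> = \<zero>\<^bsub>M\<^esub>"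
  by (simp_all add: ind_module_def)

lemma IG_inv: "z \<in> carrier M \<Longrightarrow> inv\<^bsub>IG\<^esub> z = \<ominus>\<^bsub>M\<^esub> z"
  by (rule group.inv_equality[OF group_IG]) (simp_all add: M.M.l_neg)

definition "homogeneous_tensors k =
  {ic (frag_of (u, v)) | u v i j. u \<in> uea_part g i \<and> v \<in> parity_part V j \<and> i + j = k}"

lemma M_part: "parity_part M k = generate IG (homogeneous_tensors k)"
  unfolding homogeneous_tensors_def ind_module_def by (simp only: super_space.simps)

lemma word_closed:
  assumes "list_all2 (\<lambda>x j. x \<in> parity_part g j) xs js"
  shows "xs \<in> lists (carrier g)"
  using assms by (induction rule: list_all2_induct) (auto intro: part_carrier)

lemma word_uc_closed:
  assumes "list_all2 (\<lambda>x j. x \<in> parity_part g j) xs js"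
  shows "uc (Poly_Mapping.single xs c) \<in> carrier (uea g)"
  by (rule uea_class_closed) (use word_closed[OF assms] in \<open>simp del: in_lists_conv_set\<close>)

lemma uea_part_closed: "uea_part g i \<subseteq> carrier (uea g)"
proof -
  have "uea_part g i \<subseteq> carrier (add_monoid (uea g))"
    unfolding uea_part_def
    by (rule group.generate_incl[OF U.add.is_group]) (auto intro: word_uc_closed)
  then show ?thesis by simp
qed

lemma uea_part_word:
  assumes w: "list_all2 (\<lambda>x j. x \<in> parity_part g j) ys js" and u: "u \<in> uea_part g i"
  shows "uc (Poly_Mapping.single ys c) \<otimes>\<^bsub>uea g\<^esub> u \<in> uea_part g (sum_list js + i)"
proof -
  let ?y = "uc (Poly_Mapping.single ys c)"
  have y: "?y \<in> carrier (uea g)" by (rule word_uc_closed) (rule w)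
  have "?y \<otimes>\<^bsub>uea g\<^esub> u \<in> uea_part g (sum_list js + i) \<and> u \<in> carrier (uea g)"
    using u unfolding uea_part_def[of _ i]
  proof (induction rule: generate.induct)
    case one
    then show ?case using y generate.one[of "add_monoid (uea g)"] by (simp add: uea_part_def)
  next
    case (incl z)
    then obtain xs c' ks where z: "z = uc (Poly_Mapping.single xs c')" "list_all2 (\<lambda>x j. x \<in> parity_part g j) xs ks" "sum_list ks = i"
      by blast
    have "?y \<otimes>\<^bsub>uea g\<^esub> z = uc (Poly_Mapping.single (ys @ xs) (c * c'))"
      unfolding z using word_closed[OF w] word_closed[OF z(2)] by (subst uea_mult) (auto simp: free_alg_mult_single)
    moreover have "list_all2 (\<lambda>x j. x \<in> parity_part g j) (ys @ xs) (js @ ks)" "sum_list (js @ ks) = sum_list js + i"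
      using w z by (simp_all add: list_all2_appendI del: add_bit_eq_xor)
    ultimately have "?y \<otimes>\<^bsub>uea g\<^esub> z \<in> uea_part g (sum_list js + i)"
      unfolding uea_part_def by (intro generate.incl) blast
    moreover have "z \<in> carrier (uea g)" unfolding z(1) by (rule word_uc_closed) (rule z(2))
    ultimately show ?case by simp
  next
    case (inv z)
    then obtain xs c' ks where z: "z = uc (Poly_Mapping.single xs c')" "list_all2 (\<lambda>x j. x \<in> parity_part g j) xs ks" "sum_list ks = i"
      by blast
    have zc: "z \<in> carrier (uea g)" unfolding z(1) by (rule word_uc_closed) (rule z(2))
    have "?y \<otimes>\<^bsub>uea g\<^esub> z = uc (Poly_Mapping.single (ys @ xs) (c * c'))"
      unfolding z using word_closed[OF w] word_closed[OF z(2)] by (subst uea_mult) (auto simp: free_alg_mult_single)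
    moreover have "list_all2 (\<lambda>x j. x \<in> parity_part g j) (ys @ xs) (js @ ks)" "sum_list (js @ ks) = sum_list js + i"
      using w z by (simp_all add: list_all2_appendI del: add_bit_eq_xor)
    ultimately have "inv\<^bsub>add_monoid (uea g)\<^esub> (?y \<otimes>\<^bsub>uea g\<^esub> z) \<in> uea_part g (sum_list js + i)"
      unfolding uea_part_def by (intro generate.inv) blast
    then show ?case using zc y unfolding a_inv_def[symmetric] by (simp add: U.r_minus del: add_bit_eq_xor)
  next
    case (eng z z')
    then have "(?y \<otimes>\<^bsub>uea g\<^esub> z) \<oplus>\<^bsub>uea g\<^esub> (?y \<otimes>\<^bsub>uea g\<^esub> z') \<in> uea_part g (sum_list js + i)"
      using generate.eng[of _ "add_monoid (uea g)"] by (simp add: uea_part_def)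
    then show ?case using eng y by (simp add: U.r_distr)
  qed
  then show ?thesis by blast
qed

lemma tensor_closed: "u \<in> uea_part g i \<Longrightarrow> v \<in> parity_part V j \<Longrightarrow> ic (frag_of (u, v)) \<in> carrier M"
  using uea_part_closed V_part by (intro ic_closed) (auto simp: keys_frag_of)

lemma part_subgroup: "subgroup (parity_part M k) IG"
  unfolding M_part
  by (rule group.generate_is_subgroup[OF group_IG]) (auto simp: homogeneous_tensors_def intro!: tensor_closed)

lemma M_part_carrier: "z \<in> parity_part M k \<Longrightarrow> z \<in> carrier M"
  using subgroup.mem_carrier[OF part_subgroup] by simp

lemma M_part_add: "y \<in> parity_part M k \<Longrightarrow> z \<in> parity_part M k \<Longrightarrow> y \<oplus>\<^bsub>M\<^esub> z \<in> parity_part M k"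
  using subgroup.m_closed[OF part_subgroup] by simp

lemma M_part_zero: "\<zero>\<^bsub>M\<^esub> \<in> parity_part M k"
  using subgroup.one_closed[OF part_subgroup] by simp

lemma M_part_minus: "z \<in> parity_part M k \<Longrightarrow> \<ominus>\<^bsub>M\<^esub> z \<in> parity_part M k"
  using subgroup.m_inv_closed[OF part_subgroup, of z k] M_part_carrier[of z k] by (simp add: IG_inv)

lemma tensor_part: "u \<in> uea_part g i \<Longrightarrow> v \<in> parity_part V j \<Longrightarrow> ic (frag_of (u, v)) \<in> parity_part M (i + j)"
  unfolding M_part homogeneous_tensors_def by (intro generate.incl) blast

lemma M_part_induct [consumes 1, case_names zero tensor minus add]:
  assumes "z \<in> parity_part M k" and "P \<zero>\<^bsub>M\<^esub>"
    and tensor: "\<And>u v i j. u \<in> uea_part g i \<Longrightarrow> v \<in> parity_part V j \<Longrightarrow> i + j = k \<Longrightarrow> P (ic (frag_of (u, v)))"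
    and minus: "\<And>y. y \<in> carrier M \<Longrightarrow> P y \<Longrightarrow> P (\<ominus>\<^bsub>M\<^esub> y)"
    and add: "\<And>y z. y \<in> carrier M \<Longrightarrow> z \<in> carrier M \<Longrightarrow> P y \<Longrightarrow> P z \<Longrightarrow> P (y \<oplus>\<^bsub>M\<^esub> z)"
  shows "P z"
proof -
  have "P z \<and> z \<in> carrier M"
    using assms(1) unfolding M_part
  proof (induction rule: generate.induct)
    case one
    then show ?case using assms(2) by simp
  next
    case (incl y)
    then show ?case unfolding homogeneous_tensors_def using tensor tensor_closed by blast
  next
    case (inv y)
    then have "P y \<and> y \<in> carrier M" unfolding homogeneous_tensors_def using tensor tensor_closed by blast
    then show ?case using minus by (simp add: IG_inv)
  next
    case (eng y y')
    then show ?case using add by simp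
  qed
  then show ?thesis ..
qed

lemma um_word_part:
  assumes w: "list_all2 (\<lambda>x j. x \<in> parity_part g j) ys js" and z: "z \<in> parity_part M k"
  shows "um (uc (Poly_Mapping.single ys c)) z \<in> parity_part M (sum_list js + k)"
  using z
proof (induction rule: M_part_induct)
  let ?y = "uc (Poly_Mapping.single ys c)"
  have y: "?y \<in> carrier (uea g)" by (rule word_uc_closed) (rule w)
  have zero: "um ?y \<zero>\<^bsub>M\<^esub> = \<zero>\<^bsub>M\<^esub>" using y by (simp add: M_zero um_ic)
  show "um ?y \<zero>\<^bsub>M\<^esub> \<in> parity_part M (sum_list js + k)" by (simp add: zero M_part_zero)
  show "um ?y (ic (frag_of (u, v))) \<in> parity_part M (sum_list js + k)"
    if "u \<in> uea_part g i" "v \<in> parity_part V j" "i + j = k" for u v i j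
    using tensor_part[OF uea_part_word[OF w that(1), of c] that(2)] that(3) y
    by (simp add: um_ic add.assoc del: add_bit_eq_xor)
  show "um ?y (\<ominus>\<^bsub>M\<^esub> z) \<in> parity_part M (sum_list js + k)"
    if "z \<in> carrier M" "um ?y z \<in> parity_part M (sum_list js + k)" for z
  proof -
    have "um ?y (\<ominus>\<^bsub>M\<^esub> z) \<oplus>\<^bsub>M\<^esub> um ?y z = \<zero>\<^bsub>M\<^esub>"
      using that y zero by (simp add: M.M.l_neg flip: um_add_right)
    then have "um ?y (\<ominus>\<^bsub>M\<^esub> z) = \<ominus>\<^bsub>M\<^esub> um ?y z"
      using that y by (intro M.M.minus_equality[symmetric]) simp_all
    then show ?thesis using that M_part_minus by simp
  qed
  show "um ?y (z \<oplus>\<^bsub>M\<^esub> z') \<in> parity_part M (sum_list js + k)"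
    if "z \<in> carrier M" "z' \<in> carrier M" "um ?y z \<in> parity_part M (sum_list js + k)" "um ?y z' \<in> parity_part M (sum_list js + k)" for z z'
    using that y by (simp add: um_add_right M_part_add)
qed

lemma M_part_smult: "z \<in> parity_part M k \<Longrightarrow> c \<odot>\<^bsub>M\<^esub> z \<in> parity_part M k"
  using um_word_part[of "[]" "[]" z k c] by (simp add: M_smult sc_def del: add_bit_eq_xor)

lemma M_act_part: "x \<in> parity_part g i \<Longrightarrow> z \<in> parity_part M k \<Longrightarrow> act M x z \<in> parity_part M (i + k)"
  using um_word_part[of "[x]" "[i]" z k 1] by (simp add: M_act gen_def del: add_bit_eq_xor)

lemma M_part_submodule: "submodule (parity_part M k) complex_ring M"
  by (rule M.submoduleI) (auto simp: M_part_zero M_part_minus M_part_add M_part_smult M_part_carrier)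

lemma \<iota>_part: "v \<in> parity_part V j \<Longrightarrow> \<iota> v \<in> parity_part M j"
proof -
  assume v: "v \<in> parity_part V j"
  have "list_all2 (\<lambda>x j. x \<in> parity_part g j) [] []" "sum_list [] = (0::bit)" by simp_all
  then have "uc (Poly_Mapping.single [] 1) \<in> uea_part g 0"
    unfolding uea_part_def by (intro generate.incl) blast
  then show ?thesis using tensor_part[of _ 0 v j] v by (simp add: \<iota>_def uea_one del: add_bit_eq_xor)
qed

lemma M_part_sum:
  assumes "z \<in> carrier M"
  shows "\<exists>a\<in>parity_part M 0. \<exists>b\<in>parity_part M 1. z = a \<oplus>\<^bsub>M\<^esub> b"
  using assms
proof (induction rule: M_induct)
  case (add y z)
  then obtain a b a' b' where p: "a \<in> parity_part M 0" "b \<in> parity_part M 1" "y = a \<oplus>\<^bsub>M\<^esub> b"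
    "a' \<in> parity_part M 0" "b' \<in> parity_part M 1" "z = a' \<oplus>\<^bsub>M\<^esub> b'" by blast
  then have "y \<oplus>\<^bsub>M\<^esub> z = (a \<oplus>\<^bsub>M\<^esub> a') \<oplus>\<^bsub>M\<^esub> (b \<oplus>\<^bsub>M\<^esub> b')"
    by (simp add: M_part_carrier M.M.a_ac)
  then show ?case using p M_part_add by blast
next
  case (smult c z)
  then obtain a b where p: "a \<in> parity_part M 0" "b \<in> parity_part M 1" "z = a \<oplus>\<^bsub>M\<^esub> b" by blast
  then have "c \<odot>\<^bsub>M\<^esub> z = c \<odot>\<^bsub>M\<^esub> a \<oplus>\<^bsub>M\<^esub> c \<odot>\<^bsub>M\<^esub> b"
    by (simp add: M_part_carrier M.sm_r_distr)
  then show ?case using p M_part_smult by blast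
next
  case (act x z)
  then obtain a b where p: "a \<in> parity_part M 0" "b \<in> parity_part M 1" "z = a \<oplus>\<^bsub>M\<^esub> b" by blast
  obtain x0 x1 where x: "x0 \<in> parity_part g 0" "x1 \<in> parity_part g 1" "x = x0 \<oplus>\<^bsub>g\<^esub> x1"
    using part_decomp[OF act(1)] by (auto dest!: ex1_implies_ex)
  have c: "a \<in> carrier M" "b \<in> carrier M" "x0 \<in> carrier g" "x1 \<in> carrier g"
    using p x M_part_carrier part_carrier by auto
  have "act M x z = (act M x0 a \<oplus>\<^bsub>M\<^esub> act M x1 b) \<oplus>\<^bsub>M\<^esub> (act M x0 b \<oplus>\<^bsub>M\<^esub> act M x1 a)"
    using c by (simp add: p(3) x(3) M.act_add_left M.act_add_right g_add_closed M.M.a_ac)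
  moreover have "act M x0 a \<oplus>\<^bsub>M\<^esub> act M x1 b \<in> parity_part M 0" "act M x0 b \<oplus>\<^bsub>M\<^esub> act M x1 a \<in> parity_part M 1"
    using M_act_part[OF x(1) p(1)] M_act_part[OF x(2) p(2)] M_act_part[OF x(1) p(2)] M_act_part[OF x(2) p(1)]
    by (auto intro!: M_part_add)
  ultimately show ?case by blast
next
  case (gen v)
  then obtain v0 v1 where v: "v0 \<in> parity_part V 0" "v1 \<in> parity_part V 1" "v = v0 \<oplus>\<^bsub>V\<^esub> v1"
    using VS.part_decomp[OF gen] by (auto dest!: ex1_implies_ex)
  then have "\<iota> v = \<iota> v0 \<oplus>\<^bsub>M\<^esub> \<iota> v1" using V_part by (simp add: \<iota>_add)
  then show ?case using v \<iota>_part by blast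
qed

text \<open>All axioms except directness of the grading follow from the generators of the parity
  parts. Directness needs the descent and is supplied by \<open>M_part_disjoint\<close>.\<close>

theorem M_supermodule:
  assumes disjoint: "\<And>z. z \<in> parity_part M 0 \<Longrightarrow> z \<in> parity_part M 1 \<Longrightarrow> z = \<zero>\<^bsub>M\<^esub>"
  shows "supermodule g M"
proof (intro supermodule.intro super_space.intro super_space_axioms.intro supermodule_axioms.intro M.module_axioms)
  show "submodule (parity_part M i) complex_ring M" for i
    by (rule M_part_submodule)
  show "\<exists>!p. p \<in> parity_part M 0 \<times> parity_part M 1 \<and> x = fst p \<oplus>\<^bsub>M\<^esub> snd p" if "x \<in> carrier M" for x
  proof -
    from M_part_sum[OF that] obtain a b
      where ab: "a \<in> parity_part M 0" "b \<in> parity_part M 1" "x = a \<oplus>\<^bsub>M\<^esub> b" by blast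
    have uniq: "a' = a \<and> b' = b" if "a' \<in> parity_part M 0" "b' \<in> parity_part M 1" "x = a' \<oplus>\<^bsub>M\<^esub> b'" for a' b'
    proof -
      have c: "a \<in> carrier M" "b \<in> carrier M" "a' \<in> carrier M" "b' \<in> carrier M"
        using ab that M_part_carrier by auto
      have e: "a' \<oplus>\<^bsub>M\<^esub> b' = a \<oplus>\<^bsub>M\<^esub> b" using ab(3) that(3) by simp
      have "a' \<oplus>\<^bsub>M\<^esub> \<ominus>\<^bsub>M\<^esub> a = (a' \<oplus>\<^bsub>M\<^esub> b') \<oplus>\<^bsub>M\<^esub> (\<ominus>\<^bsub>M\<^esub> b' \<oplus>\<^bsub>M\<^esub> \<ominus>\<^bsub>M\<^esub> a)"
        using c by (simp add: M.M.a_assoc M.M.r_neg1 M.M.r_neg2)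
      also have "\<dots> = b \<oplus>\<^bsub>M\<^esub> \<ominus>\<^bsub>M\<^esub> b'"
      proof -
        have "(a' \<oplus>\<^bsub>M\<^esub> b') \<oplus>\<^bsub>M\<^esub> (\<ominus>\<^bsub>M\<^esub> b' \<oplus>\<^bsub>M\<^esub> \<ominus>\<^bsub>M\<^esub> a) =
            (b \<oplus>\<^bsub>M\<^esub> \<ominus>\<^bsub>M\<^esub> b') \<oplus>\<^bsub>M\<^esub> (a \<oplus>\<^bsub>M\<^esub> \<ominus>\<^bsub>M\<^esub> a)"
          unfolding e by (simp only: M.M.a_ac M.M.a_closed M.M.a_inv_closed c)
        then show ?thesis using c by (simp add: M.M.r_neg)
      qed
      finally have d: "a' \<oplus>\<^bsub>M\<^esub> \<ominus>\<^bsub>M\<^esub> a = b \<oplus>\<^bsub>M\<^esub> \<ominus>\<^bsub>M\<^esub> b'" .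
      have "a' \<oplus>\<^bsub>M\<^esub> \<ominus>\<^bsub>M\<^esub> a \<in> parity_part M 0" using ab that by (intro M_part_add M_part_minus)
      moreover have "b \<oplus>\<^bsub>M\<^esub> \<ominus>\<^bsub>M\<^esub> b' \<in> parity_part M 1" using ab that by (intro M_part_add M_part_minus)
      ultimately have "a' \<oplus>\<^bsub>M\<^esub> \<ominus>\<^bsub>M\<^esub> a = \<zero>\<^bsub>M\<^esub>" using disjoint d by metis
      then have "a' = a" using c by (metis M.M.minus_equality M.M.minus_minus M.M.a_inv_closed)
      moreover have "b' = b" using e c \<open>a' = a\<close> by simp
      ultimately show ?thesis by simp
    qed
    show ?thesis
    proof (rule ex1I[of _ "(a, b)"])
      fix p assume "p \<in> parity_part M 0 \<times> parity_part M 1 \<and> x = fst p \<oplus>\<^bsub>M\<^esub> snd p"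
      then show "p = (a, b)" using uniq[of "fst p" "snd p"] by (metis mem_Times_iff prod.collapse)
    qed (use ab in simp)
  qed
  show "act M x v \<in> parity_part M (i + j)" if "x \<in> parity_part g i" "v \<in> parity_part M j" for x v i j
    using that by (rule M_act_part)
qed (rule M.act_closed M.act_add_left M.act_add_right M.act_smult_left M.act_smult_right M.act_bracket; assumption)+

end

section \<open>The universal property, dually\<close>

lemma lin_osr_scale: "lin (osr_scale c x) f = c * lin x f"
  by (subst lin_eq_sum[OF _ keys_osr_scale]) (simp_all add: lin_def sum_distrib_left mult.assoc)

lemma lin_osr_bracket: "lin (osr_bracket x y) f = lin x (\<lambda>a. lin y (\<lambda>b. lin (osr_basis_bracket a b) f))"
proof (induction x rule: poly_mapping_induct_single)
  case (single a c)
  show ?case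
    by (induction y rule: poly_mapping_induct_single)
      (simp_all add: osr_bracket_add_right lin_add osr_bracket_single lin_osr_scale distrib_left mult.assoc)
qed (simp_all add: osr_bracket_add_left lin_add)

text \<open>The residue modulo 5 separates the five kinds of basis elements. This order is for
  straightening only and is unrelated to the layers W, G, L of the descent.\<close>

fun osr_index :: "osr_basis \<Rightarrow> int" where
  "osr_index (Lgen i) = 5 * i"
| "osr_index (Wgen i) = 5 * i + 1"
| "osr_index (Ggen i) = 5 * i + 2"
| "osr_index Cgen1 = 3"
| "osr_index Cgen2 = 4"

lemma osr_index_inj: "osr_index a = osr_index b \<Longrightarrow> a = b"
  by (cases a; cases b; simp; presburger)

text \<open>The basis elements outside \<open>T\<^sub>d\<close> come first, so that ordered words end with a word in \<open>T\<^sub>d\<close>.\<close>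

definition osr_less :: "nat \<Rightarrow> osr_basis \<Rightarrow> osr_basis \<Rightarrow> bool" where
  "osr_less d a b \<longleftrightarrow> a \<notin> osr_T_basis d \<and> b \<in> osr_T_basis d \<or>
     (a \<in> osr_T_basis d \<longleftrightarrow> b \<in> osr_T_basis d) \<and> osr_index a < osr_index b"

lemma osr_super_basis: "super_basis osr_basis_bracket osr_basis_parity (osr_less d)"
proof
  fix a b c :: osr_basis and f :: "osr_basis \<Rightarrow> complex"
  show "\<not> osr_less d a a" by (simp add: osr_less_def)
  show "osr_less d a b \<Longrightarrow> osr_less d b c \<Longrightarrow> osr_less d a c" by (auto simp: osr_less_def)
  show "a \<noteq> b \<Longrightarrow> osr_less d a b \<or> osr_less d b a"
    using osr_index_inj[of a b] by (auto simp: osr_less_def)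
  show "c \<in> Poly_Mapping.keys (osr_basis_bracket a b) \<Longrightarrow> osr_basis_parity c = osr_basis_parity a + osr_basis_parity b"
    using osr_basis_bracket_part[of a b] by (simp add: osr_homogeneous_def del: add_bit_eq_xor)
  show "lin (osr_basis_bracket a b) f =
      - koszul_sign (osr_basis_parity a) (osr_basis_parity b) * lin (osr_basis_bracket b a) f"
    by (subst osr_basis_bracket_skew) (simp only: lin_osr_scale)
  show "lin (osr_basis_bracket b c) (\<lambda>e. lin (osr_basis_bracket a e) f) =
      lin (osr_basis_bracket a b) (\<lambda>e. lin (osr_basis_bracket e c) f) +
      koszul_sign (osr_basis_parity a) (osr_basis_parity b) * lin (osr_basis_bracket a c) (\<lambda>e. lin (osr_basis_bracket b e) f)"
    using arg_cong[OF osr_basis_jacobi[of a b c], of "\<lambda>x. lin x f"]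
    by (simp add: lin_add lin_osr_scale lin_osr_bracket)
qed

context super_basis
begin

text \<open>Straightening is linear in the functional at every step. This is what makes
  \<open>hom\<close> linear in the vector.\<close>

lemma nf_lincomb: "nf (\<lambda>w. c * \<phi> w + \<phi>' w) w = c * nf \<phi> w + nf \<phi>' w"
proof (induction w rule: nf_induct)
  case (sorted w)
  then show ?case by (simp add: nf_sorted)
next
  case (split u a b v)
  have *: "nf \<phi> (u @ [a, b] @ v) = rewrite (\<lambda>z. nf \<phi> (u @ z @ v)) a b" for \<phi>
    using split.hyps by (intro nf_split) (auto simp: splits_def)
  have "nf (\<lambda>w. c * \<phi> w + \<phi>' w) (u @ [a, b] @ v) = rewrite (\<lambda>z. c * nf \<phi> (u @ z @ v) + nf \<phi>' (u @ z @ v)) a b"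
    unfolding * using split.IH by (intro rewrite_cong) simp_all
  also have "\<dots> = c * nf \<phi> (u @ [a, b] @ v) + nf \<phi>' (u @ [a, b] @ v)"
    unfolding * by (simp add: rewrite_def lin_add_fun lin_scale_fun algebra_simps add_divide_distrib)
  finally show ?case .
qed

end

text \<open>These are the linear functionals on U(S), recorded by their values on products of basis
  elements.\<close>

definition word_relations :: "(osr_basis list \<Rightarrow> complex) \<Rightarrow> bool" where
  "word_relations F \<longleftrightarrow> (\<forall>u a b v. F (u @ [a, b] @ v) =
     koszul_sign (osr_basis_parity a) (osr_basis_parity b) * F (u @ [b, a] @ v) +
     lin (osr_basis_bracket a b) (\<lambda>c. F (u @ [c] @ v)))"

text \<open>The functionals on \<open>U(S)\<close>, with the action transposed from right multiplication.\<close>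

definition functionals :: "(osr_basis \<Rightarrow>\<^sub>0 complex, osr_basis list \<Rightarrow> complex) supermodule" where
  "functionals = \<lparr>carrier = {F. word_relations F}, monoid.mult = undefined, one = undefined,
     ring.zero = (\<lambda>_. 0), add = (\<lambda>F G w. F w + G w), module.smult = (\<lambda>c F w. c * F w),
     parity_part = undefined, act = (\<lambda>x F w. lin x (\<lambda>b. F (w @ [b])))\<rparr>"

lemma functionals_simps [simp]:
  "F \<in> carrier functionals \<longleftrightarrow> word_relations F" "\<zero>\<^bsub>functionals\<^esub> = (\<lambda>_. 0)"
  "F \<oplus>\<^bsub>functionals\<^esub> G = (\<lambda>w. F w + G w)" "c \<odot>\<^bsub>functionals\<^esub> F = (\<lambda>w. c * F w)"
  "act functionals x F = (\<lambda>w. lin x (\<lambda>b. F (w @ [b])))"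
  by (simp_all add: functionals_def)

lemma osr_algebra_simps [simp]:
  "x \<in> carrier osr_algebra" "x \<oplus>\<^bsub>osr_algebra\<^esub> y = x + y" "c \<odot>\<^bsub>osr_algebra\<^esub> x = osr_scale c x"
  "bracket osr_algebra = osr_bracket" "parity_part osr_algebra = osr_homogeneous"
  by (simp_all add: osr_algebra_def)

lemma word_relations_lincomb: "word_relations F \<Longrightarrow> word_relations G \<Longrightarrow> word_relations (\<lambda>w. c * F w + G w)"
proof -
  assume FG: "word_relations F" "word_relations G"
  show ?thesis
    unfolding word_relations_def
  proof (intro allI)
    fix u a b v
    let ?k = "koszul_sign (osr_basis_parity a) (osr_basis_parity b)"
    have e: "F (u @ [a, b] @ v) = ?k * F (u @ [b, a] @ v) + lin (osr_basis_bracket a b) (\<lambda>c. F (u @ [c] @ v))"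
      "G (u @ [a, b] @ v) = ?k * G (u @ [b, a] @ v) + lin (osr_basis_bracket a b) (\<lambda>c. G (u @ [c] @ v))"
      using FG unfolding word_relations_def by blast+
    show "c * F (u @ [a, b] @ v) + G (u @ [a, b] @ v) = ?k * (c * F (u @ [b, a] @ v) + G (u @ [b, a] @ v)) +
        lin (osr_basis_bracket a b) (\<lambda>e. c * F (u @ [e] @ v) + G (u @ [e] @ v))"
      unfolding e lin_add_fun lin_scale_fun by (simp add: distrib_left mult.left_commute)
  qed
qed

lemma word_relations_zero: "word_relations (\<lambda>w. 0)"
  by (simp add: word_relations_def)

lemma word_relations_act:
  assumes "word_relations F" shows "word_relations (\<lambda>w. lin x (\<lambda>b. F (w @ [b])))"
  unfolding word_relations_def
proof (intro allI)
  fix u a b v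
  have "F (u @ [a, b] @ (v @ [e])) = koszul_sign (osr_basis_parity a) (osr_basis_parity b) * F (u @ [b, a] @ (v @ [e])) +
      lin (osr_basis_bracket a b) (\<lambda>c. F (u @ [c] @ (v @ [e])))" for e
    using assms unfolding word_relations_def by blast
  then show "lin x (\<lambda>e. F ((u @ [a, b] @ v) @ [e])) =
      koszul_sign (osr_basis_parity a) (osr_basis_parity b) * lin x (\<lambda>e. F ((u @ [b, a] @ v) @ [e])) +
      lin (osr_basis_bracket a b) (\<lambda>c. lin x (\<lambda>e. F ((u @ [c] @ v) @ [e])))"
    by (simp add: lin_add_fun lin_scale_fun lin_swap[of "osr_basis_bracket a b"])
qed

text \<open>Since (x F)(w) = F(w x), acting by y and then by x evaluates F at w x y. So the
  transpose of right multiplication is a left action, and no extra Koszul sign is involved.\<close>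

lemma functionals_lie_action: "lie_action osr_algebra functionals"
proof (intro lie_action.intro complex_module.intro lie_action_axioms.intro enveloping.intro
    osr_algebra_lie_superalgebra moduleI cring_from_type_algebra abelian_groupI)
  note lc = word_relations_lincomb[of _ _ 1, simplified] word_relations_lincomb[OF _ word_relations_zero, simplified]
  show "\<exists>G\<in>carrier functionals. G \<oplus>\<^bsub>functionals\<^esub> F = \<zero>\<^bsub>functionals\<^esub>" if "F \<in> carrier functionals" for F
    using lc(2)[of F "-1"] that by (intro bexI[of _ "\<lambda>w. - F w"]) auto
  show "c \<odot>\<^bsub>functionals\<^esub> F \<in> carrier functionals" if "F \<in> carrier functionals" for c F
    using lc(2) that by simp
  show "F \<oplus>\<^bsub>functionals\<^esub> G \<in> carrier functionals" if "F \<in> carrier functionals" "G \<in> carrier functionals" for F G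
    using lc(1) that by simp
  show "act functionals (bracket osr_algebra x y) F =
      act functionals x (act functionals y F) \<ominus>\<^bsub>functionals\<^esub> koszul_sign i j \<odot>\<^bsub>functionals\<^esub> act functionals y (act functionals x F)"
    if x: "x \<in> parity_part osr_algebra i" and y: "y \<in> parity_part osr_algebra j" and F: "F \<in> carrier functionals" for x y F i j
  proof -
    let ?k = "koszul_sign i j"
    have *: "F (w @ [a, b]) = ?k * F (w @ [b, a]) + lin (osr_basis_bracket a b) (\<lambda>c. F (w @ [c]))"
      if "a \<in> Poly_Mapping.keys x" "b \<in> Poly_Mapping.keys y" for a b w
    proof -
      have "osr_basis_parity a = i" "osr_basis_parity b = j" using x y that by (auto simp: osr_homogeneous_def)
      then show ?thesis
        using F[unfolded functionals_simps word_relations_def, THEN spec[of _ w], THEN spec[of _ a], THEN spec[of _ b], THEN spec[of _ "[]"]]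
        unfolding append_Nil2 by blast
    qed
    have eq: "lin x (\<lambda>a. lin y (\<lambda>b. F (w @ [a, b]))) = ?k * lin y (\<lambda>b. lin x (\<lambda>a. F (w @ [b, a]))) +
        lin (osr_bracket x y) (\<lambda>c. F (w @ [c]))" for w
    proof -
      have "lin x (\<lambda>a. lin y (\<lambda>b. F (w @ [a, b]))) =
          lin x (\<lambda>a. lin y (\<lambda>b. ?k * F (w @ [b, a]) + lin (osr_basis_bracket a b) (\<lambda>c. F (w @ [c]))))"
        by (intro lin_cong *)
      then show ?thesis by (simp add: lin_add_fun lin_scale_fun lin_osr_bracket lin_swap[of y x])
    qed
    have ag: "abelian_group functionals"
    proof (rule abelian_groupI)
      show "\<exists>G\<in>carrier functionals. G \<oplus>\<^bsub>functionals\<^esub> F = \<zero>\<^bsub>functionals\<^esub>" if "F \<in> carrier functionals" for F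
        using lc(2)[of F "-1"] that by (intro bexI[of _ "\<lambda>w. - F w"]) auto
    qed (auto simp: lc word_relations_zero)
    have neg: "\<ominus>\<^bsub>functionals\<^esub> G = (\<lambda>w. - G w)" if "word_relations G" for G
      using lc(2)[of G "-1"] that by (intro abelian_group.minus_equality[OF ag]) auto
    have "word_relations (\<lambda>w. ?k * lin y (\<lambda>b. lin x (\<lambda>a. F ((w @ [b]) @ [a]))))"
      using F word_relations_act[OF word_relations_act[of F x], of y] lc(2) by simp
    from neg[OF this] show ?thesis
      unfolding a_minus_def functionals_simps osr_algebra_simps by (simp add: eq)
  qed
qed (auto simp: word_relations_zero word_relations_act lin_add lin_add_fun lin_scale_fun lin_osr_scale algebra_simps)

locale osr_induced = induced osr_algebra "{x. Poly_Mapping.keys x \<subseteq> osr_T_basis d}" V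
  for d :: nat and V :: "(osr_basis \<Rightarrow>\<^sub>0 complex, 'v) supermodule"
begin

abbreviation "T \<equiv> osr_T_basis d"

sublocale sb: super_basis osr_basis_bracket osr_basis_parity "osr_less d"
  by (rule osr_super_basis)

sublocale R: lie_action osr_algebra functionals
  by (rule functionals_lie_action)

lemma h_simps [simp]: "x \<oplus>\<^bsub>h\<^esub> y = x + y" "c \<odot>\<^bsub>h\<^esub> x = osr_scale c x" "bracket h = osr_bracket"
  "parity_part h i = osr_homogeneous i \<inter> {x. Poly_Mapping.keys x \<subseteq> T}"
  by (simp_all add: sub_superalgebra_def)

definition bact :: "osr_basis \<Rightarrow> 'v \<Rightarrow> 'v" where "bact b = act V (Poly_Mapping.single b 1)"

lemma bact_closed [simp]: "b \<in> T \<Longrightarrow> v \<in> carrier V \<Longrightarrow> bact b v \<in> carrier V"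
  unfolding bact_def by (rule V.act_closed) simp_all

lemma word_bact_closed: "set w \<subseteq> T \<Longrightarrow> v \<in> carrier V \<Longrightarrow> foldr bact w v \<in> carrier V"
  by (induction w) auto

lemma bact_part: "b \<in> T \<Longrightarrow> v \<in> parity_part V k \<Longrightarrow> bact b v \<in> parity_part V (osr_basis_parity b + k)"
  unfolding bact_def using osr_homogeneous_single[of b 1] by (intro VS.act_part) auto

lemma word_bact_part: "set w \<subseteq> T \<Longrightarrow> v \<in> parity_part V k \<Longrightarrow>
    foldr bact w v \<in> parity_part V ((\<Sum>b\<leftarrow>w. osr_basis_parity b) + k)"
  by (induction w) (auto simp: add.assoc simp del: add_bit_eq_xor intro: bact_part)

end

text \<open>\<open>l\<close> is a test functional: it vanishes on one parity part of V, and it is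
  used to detect vectors outside that part.\<close>

locale osr_functional = osr_induced d V
  for d :: nat and V :: "(osr_basis \<Rightarrow>\<^sub>0 complex, 'v) supermodule" +
  fixes l :: "'v \<Rightarrow> complex" and j :: bit
  assumes l_add: "v \<in> carrier V \<Longrightarrow> w \<in> carrier V \<Longrightarrow> l (v \<oplus>\<^bsub>V\<^esub> w) = l v + l w"
    and l_smult: "v \<in> carrier V \<Longrightarrow> l (c \<odot>\<^bsub>V\<^esub> v) = c * l v"
    and l_part: "v \<in> parity_part V j \<Longrightarrow> l v = 0"
begin

lemma functional_act:
  assumes \<phi>: "\<And>v w. v \<in> carrier V \<Longrightarrow> w \<in> carrier V \<Longrightarrow> \<phi> (v \<oplus>\<^bsub>V\<^esub> w) = \<phi> v + \<phi> w"
    "\<And>v c. v \<in> carrier V \<Longrightarrow> \<phi> (c \<odot>\<^bsub>V\<^esub> v) = c * (\<phi> v :: complex)"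
    and x: "Poly_Mapping.keys x \<subseteq> T" and v: "v \<in> carrier V"
  shows "\<phi> (act V x v) = lin x (\<lambda>b. \<phi> (bact b v))"
  using x
proof (induction x rule: keys_induct)
  case zero
  have "act V (osr_scale 0 0) v = 0 \<odot>\<^bsub>V\<^esub> act V 0 v"
    using V.act_smult_left[of 0 v 0] v by simp
  then show ?case using \<phi>(2)[of "act V 0 v" 0] V.act_closed[of 0 v] v by (simp add: osr_scale_linear)
next
  case (single b c)
  have "act V (osr_scale c (Poly_Mapping.single b 1)) v = c \<odot>\<^bsub>V\<^esub> bact b v"
    using V.act_smult_left[of "Poly_Mapping.single b 1" v c] v single by (simp add: bact_def)
  then show ?case using \<phi>(2)[of "bact b v" c] v single by (simp add: osr_scale_linear)
next
  case (add x y)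
  then show ?case using V.act_add_left[of x y v] v by (simp add: \<phi>(1) lin_add)
qed

definition \<psi> :: "'v \<Rightarrow> osr_basis list \<Rightarrow> complex" where "\<psi> v w = l (foldr bact w v)"

text \<open>A functional on U(S) that restricts to w -> l (w v) on U(T_d). The resulting map from V
  to the functionals is equivariant for T_d, and such a map is what a functional on the induced
  module amounts to.\<close>

definition hom :: "'v \<Rightarrow> osr_basis list \<Rightarrow> complex" where "hom v = sb.nf (sb.restrict_to T (\<psi> v))"

lemma bact_add: "b \<in> T \<Longrightarrow> v \<in> carrier V \<Longrightarrow> v' \<in> carrier V \<Longrightarrow> bact b (v \<oplus>\<^bsub>V\<^esub> v') = bact b v \<oplus>\<^bsub>V\<^esub> bact b v'"
  unfolding bact_def by (rule V.act_add_right) simp_all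

lemma bact_smult: "b \<in> T \<Longrightarrow> v \<in> carrier V \<Longrightarrow> bact b (c \<odot>\<^bsub>V\<^esub> v) = c \<odot>\<^bsub>V\<^esub> bact b v"
  unfolding bact_def by (rule V.act_smult_right) simp_all

lemma word_bact_add: "set w \<subseteq> T \<Longrightarrow> v \<in> carrier V \<Longrightarrow> v' \<in> carrier V \<Longrightarrow>
    foldr bact w (v \<oplus>\<^bsub>V\<^esub> v') = foldr bact w v \<oplus>\<^bsub>V\<^esub> foldr bact w v'"
  by (induction w) (simp_all add: bact_add word_bact_closed)

lemma word_bact_smult: "set w \<subseteq> T \<Longrightarrow> v \<in> carrier V \<Longrightarrow> foldr bact w (c \<odot>\<^bsub>V\<^esub> v) = c \<odot>\<^bsub>V\<^esub> foldr bact w v"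
  by (induction w) (simp_all add: bact_smult word_bact_closed)

lemma \<psi>_add: "set w \<subseteq> T \<Longrightarrow> v \<in> carrier V \<Longrightarrow> v' \<in> carrier V \<Longrightarrow> \<psi> (v \<oplus>\<^bsub>V\<^esub> v') w = \<psi> v w + \<psi> v' w"
  by (simp add: \<psi>_def word_bact_add l_add word_bact_closed)

lemma \<psi>_smult: "set w \<subseteq> T \<Longrightarrow> v \<in> carrier V \<Longrightarrow> \<psi> (c \<odot>\<^bsub>V\<^esub> v) w = c * \<psi> v w"
  by (simp add: \<psi>_def word_bact_smult l_smult word_bact_closed)

lemma hom_add: "v \<in> carrier V \<Longrightarrow> v' \<in> carrier V \<Longrightarrow> hom (v \<oplus>\<^bsub>V\<^esub> v') = (\<lambda>w. hom v w + hom v' w)"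
proof
  fix w assume v: "v \<in> carrier V" "v' \<in> carrier V"
  have "sb.restrict_to T (\<psi> (v \<oplus>\<^bsub>V\<^esub> v')) = (\<lambda>w. 1 * sb.restrict_to T (\<psi> v) w + sb.restrict_to T (\<psi> v') w)"
    using \<psi>_add v by (auto simp: sb.restrict_to_def fun_eq_iff)
  then show "hom (v \<oplus>\<^bsub>V\<^esub> v') w = hom v w + hom v' w"
    unfolding hom_def using sb.nf_lincomb[of 1 "sb.restrict_to T (\<psi> v)" "sb.restrict_to T (\<psi> v')" w] by simp
qed

lemma hom_smult: "v \<in> carrier V \<Longrightarrow> hom (c \<odot>\<^bsub>V\<^esub> v) = (\<lambda>w. c * hom v w)"
proof
  fix w assume v: "v \<in> carrier V"
  have zero: "sb.nf (\<lambda>_. 0) w = 0" using sb.nf_lincomb[of 1 "\<lambda>_. 0" "\<lambda>_. 0" w] by simp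
  have "sb.restrict_to T (\<psi> (c \<odot>\<^bsub>V\<^esub> v)) = (\<lambda>w. c * sb.restrict_to T (\<psi> v) w + 0)"
    using \<psi>_smult v by (auto simp: sb.restrict_to_def fun_eq_iff)
  then show "hom (c \<odot>\<^bsub>V\<^esub> v) w = c * hom v w"
    unfolding hom_def using sb.nf_lincomb[of c "sb.restrict_to T (\<psi> v)" "\<lambda>_. 0" w] zero by simp
qed

lemma hom_closed: "word_relations (hom v)"
  using sb.nf_relation unfolding word_relations_def hom_def sb.relation_at_def by blast

lemma T_bracket: "a \<in> T \<Longrightarrow> b \<in> T \<Longrightarrow> Poly_Mapping.keys (osr_basis_bracket a b) \<subseteq> T"
  using osr_T_bracket_closed[of "Poly_Mapping.single a 1" d "Poly_Mapping.single b 1"]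
  by (simp add: osr_bracket_single osr_scale_linear)

lemma \<psi>_relation:
  assumes "set (u @ [a, b] @ v') \<subseteq> T" "v \<in> carrier V"
  shows "sb.relation_at (\<lambda>z. \<psi> v (u @ z @ v')) a b"
proof -
  define z where "z = foldr bact v' v"
  have z: "z \<in> carrier V" using assms by (simp add: z_def word_bact_closed)
  have ab: "a \<in> T" "b \<in> T" and u: "set u \<subseteq> T" using assms by auto
  define \<phi> where "\<phi> x = l (foldr bact u x)" for x
  have \<phi>: "\<phi> (x \<oplus>\<^bsub>V\<^esub> y) = \<phi> x + \<phi> y" "\<phi> (c \<odot>\<^bsub>V\<^esub> x) = c * \<phi> x" if "x \<in> carrier V" "y \<in> carrier V" for x y c
    using that u by (simp_all add: \<phi>_def word_bact_add word_bact_smult l_add l_smult word_bact_closed)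
  let ?k = "koszul_sign (osr_basis_parity a) (osr_basis_parity b)"
  have "act V (osr_basis_bracket a b) z = bact a (bact b z) \<ominus>\<^bsub>V\<^esub> ?k \<odot>\<^bsub>V\<^esub> bact b (bact a z)"
    using V.act_bracket[of "Poly_Mapping.single a 1" "osr_basis_parity a" "Poly_Mapping.single b 1" "osr_basis_parity b" z]
      ab z osr_homogeneous_single[of a 1] osr_homogeneous_single[of b 1]
    by (simp add: bact_def osr_bracket_single osr_scale_linear)
  also have "\<dots> = bact a (bact b z) \<oplus>\<^bsub>V\<^esub> (- ?k) \<odot>\<^bsub>V\<^esub> bact b (bact a z)"
    using ab z by (simp add: a_minus_def V.sm_minus)
  finally have "\<phi> (act V (osr_basis_bracket a b) z) = \<phi> (bact a (bact b z)) - ?k * \<phi> (bact b (bact a z))"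
    using ab z by (simp add: \<phi>)
  moreover have "\<phi> (act V (osr_basis_bracket a b) z) = lin (osr_basis_bracket a b) (\<lambda>c. \<phi> (bact c z))"
    using z T_bracket[OF ab] by (intro functional_act) (auto simp: \<phi>)
  ultimately have "\<phi> (bact a (bact b z)) = ?k * \<phi> (bact b (bact a z)) + lin (osr_basis_bracket a b) (\<lambda>c. \<phi> (bact c z))"
    by (metis add.commute diff_add_cancel)
  then show ?thesis
    by (simp add: sb.relation_at_def \<psi>_def \<phi>_def z_def)
qed

lemma T_low: "a \<notin> T \<Longrightarrow> b \<in> T \<Longrightarrow> osr_less d a b"
  by (simp add: osr_less_def)

text \<open>Equivariance on basis elements: acting on \<open>v\<close> is the same as appending a
  letter on the right, and \<open>nf_snoc\<close> carries this through the straightening.\<close>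

lemma hom_bact: "b \<in> T \<Longrightarrow> v \<in> carrier V \<Longrightarrow> hom (bact b v) w = hom v (w @ [b])"
  unfolding hom_def
  using sb.nf_snoc[of T "\<psi> v" b w, OF T_low T_bracket \<psi>_relation] by (simp add: \<psi>_def[abs_def])

lemma hom_act: "Poly_Mapping.keys x \<subseteq> T \<Longrightarrow> v \<in> carrier V \<Longrightarrow> hom (act V x v) = act functionals x (hom v)"
proof
  fix w assume x: "Poly_Mapping.keys x \<subseteq> T" and v: "v \<in> carrier V"
  have "hom (act V x v) w = lin x (\<lambda>b. hom (bact b v) w)"
    using x v by (intro functional_act) (simp_all add: hom_add hom_smult)
  also have "\<dots> = lin x (\<lambda>b. hom v (w @ [b]))"
    using x v by (intro lin_cong hom_bact) auto
  finally show "hom (act V x v) w = act functionals x (hom v) w" by simp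
qed

lemma hom_free_alg_act:
  assumes "Poly_Mapping.keys p \<subseteq> lists {x. Poly_Mapping.keys x \<subseteq> T}" and v: "v \<in> carrier V"
  shows "hom (free_alg_act V p v) = free_alg_act functionals p (hom v)"
  using assms(1)
proof (induction p rule: keys_induct)
  case zero
  show ?case using hom_smult[of "\<zero>\<^bsub>V\<^esub>" 0] by simp
next
  case (single xs c)
  have "foldr (act V) xs v \<in> carrier V \<and> hom (foldr (act V) xs v) = foldr (act functionals) xs (hom v)"
    using single v by (induction xs rule: lists.induct) (auto simp: hom_act V.act_closed simp del: functionals_simps(5))
  moreover have "xs \<in> lists (carrier osr_algebra)" by auto
  ultimately show ?case
    using single v V.fa_single[of xs v c] R.fa_single[of xs "hom v" c] hom_closed
    by (simp add: hom_smult)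
next
  case (add p q)
  have "Poly_Mapping.keys p' \<subseteq> lists (carrier osr_algebra)" for p' :: "(osr_basis \<Rightarrow>\<^sub>0 complex) list \<Rightarrow>\<^sub>0 complex" by auto
  with add show ?case
    using v V.fa_add[of p q v] R.fa_add[of p q "hom v"] hom_closed fa_closed[OF add(1) v] fa_closed[OF add(2) v]
    by (simp add: hom_add)
qed

text \<open>As the action is transposed from right multiplication, evaluating the result at the
  empty word yields the value of \<open>hom v\<close> at \<open>u\<close>.\<close>

definition pairing :: "((osr_basis \<Rightarrow>\<^sub>0 complex) list \<Rightarrow>\<^sub>0 complex) set \<times> 'v \<Rightarrow> complex" where
  "pairing = (\<lambda>(u, v). uea_act functionals u (hom v) [])"

text \<open>The pairing extended additively to formal sums. It kills the tensor relators, the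
  balanced ones by equivariance of \<open>hom\<close>, and so induces a functional on the induced
  module.\<close>

definition \<Lambda> :: "(((osr_basis \<Rightarrow>\<^sub>0 complex) list \<Rightarrow>\<^sub>0 complex) set \<times> 'v \<Rightarrow>\<^sub>0 int) \<Rightarrow> complex" where
  "\<Lambda> f = (\<Sum>k\<in>Poly_Mapping.keys f. of_int (Poly_Mapping.lookup f k) * pairing k)"

lemma \<Lambda>_eq: "finite A \<Longrightarrow> Poly_Mapping.keys f \<subseteq> A \<Longrightarrow> \<Lambda> f = (\<Sum>k\<in>A. of_int (Poly_Mapping.lookup f k) * pairing k)"
  unfolding \<Lambda>_def by (intro sum.mono_neutral_left) (auto simp: in_keys_iff)

lemma \<Lambda>_add: "\<Lambda> (f + f') = \<Lambda> f + \<Lambda> f'"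
proof -
  let ?A = "Poly_Mapping.keys f \<union> Poly_Mapping.keys f'"
  have "Poly_Mapping.keys (f + f') \<subseteq> ?A" by (rule Poly_Mapping.keys_add)
  then show ?thesis by (subst (1 2 3) \<Lambda>_eq[of ?A]) (auto simp: lookup_add distrib_right sum.distrib)
qed

lemma \<Lambda>_minus: "\<Lambda> (- f) = - \<Lambda> f"
  by (simp add: \<Lambda>_def sum_negf)

lemma \<Lambda>_diff: "\<Lambda> (f - f') = \<Lambda> f - \<Lambda> f'"
  using \<Lambda>_add[of f "- f'"] by (simp add: \<Lambda>_minus)

lemma \<Lambda>_zero [simp]: "\<Lambda> 0 = 0"
  by (simp add: \<Lambda>_def)

lemma \<Lambda>_frag_of [simp]: "\<Lambda> (frag_of k) = pairing k"
  by (subst \<Lambda>_eq[of "{k}"]) (auto simp: keys_frag_of)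

lemma lists_UNIV': "Poly_Mapping.keys (p :: (osr_basis \<Rightarrow>\<^sub>0 complex) list \<Rightarrow>\<^sub>0 complex) \<subseteq> lists (carrier osr_algebra)"
  by auto

lemma pairing_uc: "pairing (uc p, v) = free_alg_act functionals p (hom v) []"
  unfolding pairing_def using R.uea_act_class[OF lists_UNIV', of "hom v" p] hom_closed by simp

lemma carrier_uea_cases:
  assumes "u \<in> carrier (uea osr_algebra)" obtains p where "u = uc p"
  using assms unfolding carrier_uea by blast

lemma \<Lambda>_rel:
  assumes "r \<in> rel" shows "\<Lambda> r = 0"
  using assms
proof (cases rule: rel_cases)
  case (left u u' v)
  obtain p p' where "u = uc p" "u' = uc p'" using left by (auto elim!: carrier_uea_cases)
  then show ?thesis
    using left hom_closed
    by (simp add: \<Lambda>_diff pairing_uc uea_add[OF lists_UNIV' lists_UNIV'] R.fa_add[OF lists_UNIV' lists_UNIV'])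
next
  case (right u v v')
  obtain p where "u = uc p" using right by (auto elim!: carrier_uea_cases)
  then show ?thesis
    using right hom_closed R.fa_add_right[OF lists_UNIV', of "hom v" "hom v'" p]
    by (simp add: \<Lambda>_diff pairing_uc hom_add)
next
  case (balanced u p v)
  obtain q where "u = uc q" using balanced by (auto elim!: carrier_uea_cases)
  then show ?thesis
    using balanced hom_closed R.fa_mult[OF lists_UNIV' lists_UNIV', of "hom v" q p]
    by (simp add: \<Lambda>_diff pairing_uc uea_mult[OF lists_UNIV' lists_UNIV'] hom_free_alg_act)
qed

lemma \<Lambda>_K: "f \<in> K \<Longrightarrow> \<Lambda> f = 0"
  by (induction f rule: K_induct) (simp_all add: \<Lambda>_rel \<Lambda>_minus \<Lambda>_add)

lemma hom_parity:
  assumes "v \<in> parity_part V k" "(\<Sum>b\<leftarrow>w. osr_basis_parity b) + k = j"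
  shows "hom v w = 0"
  unfolding hom_def
proof (rule sb.nf_parity)
  \<comment> \<open>In the two-element field, a word of parity p has p + k = j exactly if p differs
    from j + k + 1. So \<open>hom v\<close> is supported on words of parity j + k + 1.\<close>
  show "(\<Sum>b\<leftarrow>w. osr_basis_parity b) \<noteq> j + k + 1"
    using assms(2) by (cases "\<Sum>b\<leftarrow>w. osr_basis_parity b"; cases k; cases j) auto
  show "sb.restrict_to T (\<psi> v) w = 0" if "(\<Sum>b\<leftarrow>w. osr_basis_parity b) \<noteq> j + k + 1" for w
  proof -
    have "(\<Sum>b\<leftarrow>w. osr_basis_parity b) + k = j"
      using that by (cases "\<Sum>b\<leftarrow>w. osr_basis_parity b"; cases k; cases j) auto
    then have "\<psi> v w = 0" if "set w \<subseteq> T"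
      using word_bact_part[OF that assms(1)] l_part by (simp add: \<psi>_def del: add_bit_eq_xor)
    then show ?thesis by (simp add: sb.restrict_to_def)
  qed
qed

lemma word_act_parity:
  assumes "list_all2 (\<lambda>x i. x \<in> osr_homogeneous i) xs js"
    and F: "\<And>w. (\<Sum>b\<leftarrow>w. osr_basis_parity b) = s \<Longrightarrow> F w = 0"
    and "(\<Sum>b\<leftarrow>w. osr_basis_parity b) = sum_list js + s"
  shows "foldr (act functionals) xs F w = 0"
  using assms(1,3)
proof (induction arbitrary: w rule: list_all2_induct)
  case Nil
  then show ?case using F by simp
next
  case (Cons x xs i js)
  have "foldr (act functionals) xs F (w @ [b]) = 0" if "b \<in> Poly_Mapping.keys x" for b
  proof (rule Cons.IH)
    have "osr_basis_parity b = i" using Cons.hyps(1) that by (auto simp: osr_homogeneous_def)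
    then show "(\<Sum>b\<leftarrow>w @ [b]. osr_basis_parity b) = sum_list js + s"
      using Cons.prems by (cases "sum_list js"; cases s; cases i) auto
  qed
  then have "lin x (\<lambda>b. foldr (act functionals) xs F (w @ [b])) = lin x (\<lambda>b. 0)" by (intro lin_cong)
  moreover have "foldr (act functionals) (x # xs) F w = act functionals x (foldr (act functionals) xs F) w"
    by (simp only: foldr.simps comp_apply)
  moreover have "\<dots> = lin x (\<lambda>b. foldr (act functionals) xs F (w @ [b]))"
    by (rule fun_cong[OF functionals_simps(5)])
  ultimately show ?case by (simp only: lin_zero_fun)
qed

text \<open>\<open>hom v\<close> vanishes on words of parity j + k, and that is i. The claim
  therefore holds for the homogeneous words that generate the part of U(S).\<close>

lemma pairing_part:
  assumes "u \<in> uea_part osr_algebra i" "v \<in> parity_part V k" "i + k = j"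
  shows "pairing (u, v) = 0"
proof -
  have v: "word_relations (hom v)" by (rule hom_closed)
  have word: "pairing (uc (Poly_Mapping.single xs c), v) = 0"
    if "list_all2 (\<lambda>x j. x \<in> parity_part osr_algebra j) xs js" "sum_list js = i" for xs c js
  proof -
    have "foldr (act functionals) xs (hom v) [] = 0"
    proof (rule word_act_parity[where s = "j + k"])
      show "hom v w = 0" if "(\<Sum>b\<leftarrow>w. osr_basis_parity b) = j + k" for w
        using that assms(2) by (intro hom_parity[where k = k]) (cases j; cases k; auto)+
      show "(\<Sum>b\<leftarrow>[]. osr_basis_parity b) = sum_list js + (j + k)"
        using that(2) assms(3) by (cases j; cases k; cases i) auto
    qed (use that(1) in simp)
    moreover have "xs \<in> lists (carrier osr_algebra)" by auto
    ultimately show ?thesis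
      unfolding pairing_uc using R.fa_single[of xs "hom v" c] v by simp
  qed
  have pairing_zero: "pairing (\<zero>\<^bsub>uea osr_algebra\<^esub>, v) = 0"
    using \<Lambda>_K[OF rel_left[of "\<zero>\<^bsub>uea osr_algebra\<^esub>" "\<zero>\<^bsub>uea osr_algebra\<^esub>" v]] V_part[OF assms(2)]
    by (simp add: \<Lambda>_minus)
  have "pairing (u, v) = 0 \<and> u \<in> carrier (uea osr_algebra)"
    using assms(1) unfolding uea_part_def
  proof (induction rule: generate.induct)
    case one
    show ?case using pairing_zero by simp
  next
    case (incl u)
    then show ?case using word word_uc_closed by blast
  next
    case (inv u)
    then have u: "pairing (u, v) = 0" "u \<in> carrier (uea osr_algebra)" using word word_uc_closed by blast+
    have "\<Lambda> (frag_of (u \<oplus>\<^bsub>uea osr_algebra\<^esub> \<ominus>\<^bsub>uea osr_algebra\<^esub> u, v) - frag_of (u, v) - frag_of (\<ominus>\<^bsub>uea osr_algebra\<^esub> u, v)) = 0"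
      using u V_part[OF assms(2)] by (intro \<Lambda>_K rel_left) auto
    then show ?case using u pairing_zero unfolding a_inv_def[symmetric] by (simp add: \<Lambda>_diff U.r_neg)
  next
    case (eng u u')
    then show ?case
      using \<Lambda>_K[OF rel_left[of u u' v]] V_part[OF assms(2)] by (simp add: \<Lambda>_diff)
  qed
  then show ?thesis ..
qed

text \<open>One representative suffices, because \<open>\<Lambda>\<close> is constant on cosets of
  \<open>K\<close>.\<close>

lemma part_pairing:
  assumes "z \<in> parity_part M j"
  shows "\<exists>f. Poly_Mapping.keys f \<subseteq> UV \<and> z = ic f \<and> \<Lambda> f = 0"
  using assms
proof (induction rule: M_part_induct)
  case zero
  show ?case by (intro exI[of _ 0]) (simp add: M_zero)
next
  case (tensor u v i k)
  then show ?case
    using uea_part_closed V_part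
    by (intro exI[of _ "frag_of (u, v)"]) (auto simp: keys_frag_of pairing_part)
next
  case (minus y)
  then obtain f where f: "Poly_Mapping.keys f \<subseteq> UV" "y = ic f" "\<Lambda> f = 0" by blast
  have "\<ominus>\<^bsub>M\<^esub> y = ic (- f)"
    using f by (intro M.M.minus_equality) (auto simp: M_add M_zero intro!: ic_closed)
  then show ?case using f by (intro exI[of _ "- f"]) (simp add: \<Lambda>_minus)
next
  case (add y z)
  then obtain f f' where f: "Poly_Mapping.keys f \<subseteq> UV" "y = ic f" "\<Lambda> f = 0"
    "Poly_Mapping.keys f' \<subseteq> UV" "z = ic f'" "\<Lambda> f' = 0" by blast
  then show ?case by (intro exI[of _ "f + f'"]) (simp add: M_add \<Lambda>_add keys_add_subset)
qed

text \<open>The induced functional has the value l v at \<open>\<iota> v\<close>, since the empty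
  word is ordered and \<open>hom v\<close> takes the value l v there; on the part \<open>j\<close>
  it is zero.\<close>

lemma functional_zero:
  assumes v: "v \<in> carrier V" and "\<iota> v \<in> parity_part M j"
  shows "l v = 0"
proof -
  obtain f where f: "Poly_Mapping.keys f \<subseteq> UV" "\<iota> v = ic f" "\<Lambda> f = 0"
    using part_pairing[OF assms(2)] by blast
  then have "frag_of (\<one>\<^bsub>uea osr_algebra\<^esub>, v) - f \<in> K" by (simp add: \<iota>_def ic_eq_iff)
  from \<Lambda>_K[OF this] have "pairing (\<one>\<^bsub>uea osr_algebra\<^esub>, v) = 0" using f(3) by (simp add: \<Lambda>_diff)
  then have "hom v [] = 0"
    using R.fa_single[of "[]" "hom v" 1] hom_closed by (simp add: uea_one pairing_uc)
  moreover have "hom v [] = l v"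
    unfolding hom_def by (subst sb.nf_sorted) (simp_all add: sb.splits_def sb.restrict_to_def \<psi>_def)
  ultimately show ?thesis by simp
qed

end

text \<open>If \<open>v\<close> were outside the part, some functional would vanish on the part but
  not at \<open>v\<close>, contrary to \<open>functional_zero\<close>. Used for both parities at
  once, this also yields injectivity of \<iota>.\<close>

theorem (in osr_induced) \<iota>_part_iff:
  assumes "v \<in> carrier V" "\<iota> v \<in> parity_part M j"
  shows "v \<in> parity_part V j"
proof (rule ccontr)
  assume "v \<notin> parity_part V j"
  show False
  proof (rule V.functional_exists[OF VS.part_submodule assms(1) \<open>v \<notin> _\<close>])
    fix l :: "'v \<Rightarrow> complex"
    assume "\<And>v w. v \<in> carrier V \<Longrightarrow> w \<in> carrier V \<Longrightarrow> l (v \<oplus>\<^bsub>V\<^esub> w) = l v + l w"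
      "\<And>v c. v \<in> carrier V \<Longrightarrow> l (c \<odot>\<^bsub>V\<^esub> v) = c * l v" "\<And>u. u \<in> parity_part V j \<Longrightarrow> l u = 0" "l v \<noteq> 0"
    then interpret osr_functional d V l j by unfold_locales
    show False using functional_zero[OF assms] \<open>l v \<noteq> 0\<close> by simp
  qed
qed

section \<open>Simplicity of the induced module\<close>

locale osr_situation = osr_induced d V for d :: nat and V :: "(osr_basis \<Rightarrow>\<^sub>0 complex, 'v) supermodule" +
  fixes t :: nat and c2 :: complex
  assumes simple: "simple_supermodule h V"
    and C2_V: "v \<in> carrier V \<Longrightarrow> bact Cgen2 v = c2 \<odot>\<^bsub>V\<^esub> v"
    and W_inj: "t > 0 \<Longrightarrow> v \<in> carrier V \<Longrightarrow> bact (Wgen (int t)) v = \<zero>\<^bsub>V\<^esub> \<Longrightarrow> v = \<zero>\<^bsub>V\<^esub>"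
    and c2_nonzero: "t = 0 \<Longrightarrow> c2 \<noteq> 0"
    and W_V: "i > int t \<Longrightarrow> v \<in> carrier V \<Longrightarrow> bact (Wgen i) v = \<zero>\<^bsub>V\<^esub>"
    and L_V: "i > int t + int d \<Longrightarrow> v \<in> carrier V \<Longrightarrow> bact (Lgen i) v = \<zero>\<^bsub>V\<^esub>"
begin

lemma mem_T: "Lgen i \<in> T \<longleftrightarrow> i \<ge> 0" "Wgen i \<in> T \<longleftrightarrow> i \<ge> - int d" "Ggen i \<in> T \<longleftrightarrow> i \<ge> 1" "Cgen1 \<in> T" "Cgen2 \<in> T"
  by (auto simp: osr_T_basis_def intro: exI[of _ "i + int d"])

lemma part_sum_zero:
  assumes "a \<in> parity_part V 0" "b \<in> parity_part V 1" "a \<oplus>\<^bsub>V\<^esub> b = \<zero>\<^bsub>V\<^esub>"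
  shows "a = \<zero>\<^bsub>V\<^esub>" "b = \<zero>\<^bsub>V\<^esub>"
proof -
  have zero: "\<zero>\<^bsub>V\<^esub> \<in> parity_part V i" for i
    using V.submoduleE(2,4)[OF VS.part_submodule[of i]] V_part[of _ i]
    by (metis V.sm_zero(1) complex_ring_simps(1) ex_in_conv)
  have "\<exists>!p. p \<in> parity_part V 0 \<times> parity_part V 1 \<and> \<zero>\<^bsub>V\<^esub> = fst p \<oplus>\<^bsub>V\<^esub> snd p"
    by (rule VS.part_decomp) simp
  from ex1_implies_ex[OF this] this have "(a, b) = (\<zero>\<^bsub>V\<^esub>, \<zero>\<^bsub>V\<^esub>)"
    by (elim ex1E) (metis (no_types, lifting) V.M.l_zero V.M.zero_closed SigmaI assms fst_conv snd_conv zero)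
  then show "a = \<zero>\<^bsub>V\<^esub>" "b = \<zero>\<^bsub>V\<^esub>" by simp_all
qed

lemma part_disjoint:
  assumes "v \<in> parity_part V 0" "v \<in> parity_part V 1" shows "v = \<zero>\<^bsub>V\<^esub>"
proof -
  have "\<ominus>\<^bsub>V\<^esub> v \<in> parity_part V 1" using V.submoduleE(3)[OF VS.part_submodule] assms(2) by blast
  from part_sum_zero(1)[OF assms(1) this] V_part[OF assms(1)] show ?thesis by (simp add: V.M.r_neg)
qed

lemma act_single: "b \<in> T \<Longrightarrow> v \<in> carrier V \<Longrightarrow> act V (Poly_Mapping.single b c) v = c \<odot>\<^bsub>V\<^esub> bact b v"
  using V.act_smult_left[of "Poly_Mapping.single b 1" v c] by (simp add: bact_def osr_scale_linear)

lemma act_zero: "v \<in> carrier V \<Longrightarrow> act V 0 v = \<zero>\<^bsub>V\<^esub>"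
  using V.act_smult_left[of 0 v 0] V.act_closed[of 0 v] by (simp add: osr_scale_linear)

lemma bact_bracket:
  assumes "a \<in> T" "b \<in> T" "v \<in> carrier V"
  shows "bact a (bact b v) = koszul_sign (osr_basis_parity a) (osr_basis_parity b) \<odot>\<^bsub>V\<^esub> bact b (bact a v) \<oplus>\<^bsub>V\<^esub>
    act V (osr_basis_bracket a b) v"
proof -
  have "act V (osr_basis_bracket a b) v =
      bact a (bact b v) \<ominus>\<^bsub>V\<^esub> koszul_sign (osr_basis_parity a) (osr_basis_parity b) \<odot>\<^bsub>V\<^esub> bact b (bact a v)"
    using V.act_bracket[of "Poly_Mapping.single a 1" "osr_basis_parity a" "Poly_Mapping.single b 1" "osr_basis_parity b" v]
      assms osr_homogeneous_single[of a 1] osr_homogeneous_single[of b 1]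
    by (simp add: bact_def osr_bracket_single osr_scale_linear)
  then show ?thesis using assms by (simp add: a_minus_def V.M.a_ac V.M.r_neg V.M.r_neg1 V.M.r_neg2)
qed

lemma bact_zero: "b \<in> T \<Longrightarrow> bact b \<zero>\<^bsub>V\<^esub> = \<zero>\<^bsub>V\<^esub>"
  unfolding bact_def using V.act_smult_right[of "Poly_Mapping.single b 1" "\<zero>\<^bsub>V\<^esub>" 0] by simp

text \<open>The bracket is a multiple of \<open>Wgen (i + k - 1)\<close>, whose index is at least i
  and hence exceeds t, so it acts by zero; as the index is positive, C_2 does not occur.\<close>

lemma G_G_V:
  assumes "i > int t" "k \<ge> 1" "v \<in> carrier V"
  shows "bact (Ggen i) (bact (Ggen k) v) = (-1) \<odot>\<^bsub>V\<^esub> bact (Ggen k) (bact (Ggen i) v)"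
proof -
  have i: "i + k - 1 > int t" "i + k - 1 \<noteq> 0" "Ggen i \<in> T" "Ggen k \<in> T" "Wgen (i + k - 1) \<in> T"
    using assms by (auto simp: mem_T)
  have "act V (osr_basis_bracket (Ggen i) (Ggen k)) v = \<zero>\<^bsub>V\<^esub>"
    using i assms W_V[OF i(1)] by (simp add: act_single)
  with bact_bracket[OF i(3,4) assms(3)] show ?thesis using assms i by (simp add: koszul_sign_def)
qed

text \<open>\<open>Ggen i\<close> is obtained by bracketing an L that kills V with
  \<open>Ggen ?k\<close>, which lies in T_d. The coefficient \<open>of_int ?k - 1 / 2\<close> is not
  zero because \<open>?k\<close> is an integer.\<close>

lemma G_V_large:
  assumes "i > int t + int d + 1" "v \<in> carrier V"
  shows "bact (Ggen i) v = \<zero>\<^bsub>V\<^esub>"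
proof -
  let ?m = "int t + int d + 1"
  let ?k = "i - ?m"
  have T: "Lgen ?m \<in> T" "Ggen ?k \<in> T" "Ggen i \<in> T" using assms by (auto simp: mem_T)
  have "bact (Lgen ?m) (bact (Ggen ?k) v) = \<zero>\<^bsub>V\<^esub>" "bact (Lgen ?m) v = \<zero>\<^bsub>V\<^esub>"
    using T assms by (auto intro!: L_V)
  then have "(of_int ?k - 1 / 2) \<odot>\<^bsub>V\<^esub> bact (Ggen i) v = \<zero>\<^bsub>V\<^esub>"
    using bact_bracket[OF T(1,2) assms(2)] T assms(2) by (simp add: bact_zero act_single)
  moreover have "x = \<zero>\<^bsub>V\<^esub>" if "c \<odot>\<^bsub>V\<^esub> x = \<zero>\<^bsub>V\<^esub>" "c \<noteq> 0" "x \<in> carrier V" for c x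
    using V.sm_assoc[of x "1 / c" c] that by simp
  moreover have "(of_int k :: complex) - 1 / 2 \<noteq> 0" for k :: int
  proof
    assume "(of_int k :: complex) - 1 / 2 = 0"
    then have "(of_int k :: complex) = 1 / 2" by simp
    then have "(of_int (2 * k) :: complex) = of_int 1" by (simp add: field_simps)
    then have "2 * k = 1" by (simp only: of_int_eq_iff)
    then show False by presburger
  qed
  ultimately show ?thesis using bact_closed[OF T(3) assms(2)] by blast
qed

lemma V_simple:
  assumes N: "N \<subseteq> carrier V" "\<And>v w. v \<in> N \<Longrightarrow> w \<in> N \<Longrightarrow> v \<oplus>\<^bsub>V\<^esub> w \<in> N" "\<And>v c. v \<in> N \<Longrightarrow> c \<odot>\<^bsub>V\<^esub> v \<in> N"
    and act: "\<And>v b. v \<in> N \<Longrightarrow> b \<in> T \<Longrightarrow> bact b v \<in> N"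
    and graded: "\<And>v0 v1. v0 \<in> parity_part V 0 \<Longrightarrow> v1 \<in> parity_part V 1 \<Longrightarrow> v0 \<oplus>\<^bsub>V\<^esub> v1 \<in> N \<Longrightarrow> v0 \<in> N \<and> v1 \<in> N"
    and v: "v \<in> N" "v \<noteq> \<zero>\<^bsub>V\<^esub>"
  shows "N = carrier V"
proof -
  have zero: "\<zero>\<^bsub>V\<^esub> \<in> N" using N(3)[OF v(1), of 0] N(1) v(1) by auto
  have "submodule N complex_ring V"
  proof (rule V.submoduleI)
    show "\<ominus>\<^bsub>V\<^esub> a \<in> N" if "a \<in> N" for a
      using N(3)[OF that, of "-1"] N(1) that by (auto simp: V.sm_neg_one)
  qed (use N zero in auto)
  moreover have "act V x v \<in> N" if "Poly_Mapping.keys x \<subseteq> T" "v \<in> N" for x v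
    using that(1)
  proof (induction x rule: keys_induct)
    case zero
    show ?case using \<open>\<zero>\<^bsub>V\<^esub> \<in> N\<close> act_zero[of v] that(2) N(1) by auto
  next
    case (single b c)
    then have "act V (Poly_Mapping.single b c) v = c \<odot>\<^bsub>V\<^esub> bact b v" using that(2) N(1) by (intro act_single) auto
    then show ?case using N(3) act[OF that(2) single] by simp
  next
    case (add x y)
    have "act V (x + y) v = act V x v \<oplus>\<^bsub>V\<^esub> act V y v"
      using V.act_add_left[of x y v] add that(2) N(1) by auto
    then show ?case using N(2) add by simp
  qed
  ultimately have "sub_supermodule h V N"
    unfolding sub_supermodule_def using graded by auto
  then show ?thesis using simple v unfolding simple_supermodule_def by auto
qed

text \<open>If the next G does not kill \<open>v\<close>, replace \<open>v\<close> by its image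
  under that G. The earlier ones still kill the image because they anticommute with the new one, and
  the new one kills it because its square is zero on V.\<close>

lemma G_V_nonzero_vector:
  "\<exists>v\<in>carrier V. v \<noteq> \<zero>\<^bsub>V\<^esub> \<and> (\<forall>i. int t < i \<and> i \<le> int t + int n \<longrightarrow> bact (Ggen i) v = \<zero>\<^bsub>V\<^esub>)"
proof (induction n)
  case 0
  have "carrier V \<noteq> {\<zero>\<^bsub>V\<^esub>}" using simple by (simp add: simple_supermodule_def)
  then show ?case using V.M.zero_closed by auto
next
  case (Suc n)
  then obtain v where v: "v \<in> carrier V" "v \<noteq> \<zero>\<^bsub>V\<^esub>" and n: "\<And>i. int t < i \<Longrightarrow> i \<le> int t + int n \<Longrightarrow> bact (Ggen i) v = \<zero>\<^bsub>V\<^esub>"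
    by blast
  let ?k = "int t + int n + 1"
  have k: "?k \<ge> 1" "?k > int t" "Ggen ?k \<in> T" by (auto simp: mem_T)
  have range: "i \<le> int t + int n \<or> i = ?k" if "i \<le> int t + int (Suc n)" for i using that by auto
  show ?case
  proof (cases "bact (Ggen ?k) v = \<zero>\<^bsub>V\<^esub>")
    case True
    then show ?thesis using v n range by blast
  next
    case False
    let ?w = "bact (Ggen ?k) v"
    have w: "?w \<in> carrier V" using k v by simp
    have "bact (Ggen i) ?w = \<zero>\<^bsub>V\<^esub>" if "int t < i" "i \<le> int t + int (Suc n)" for i
      using range[OF that(2)]
    proof
      assume "i \<le> int t + int n"
      then show ?thesis using G_G_V[OF that(1) k(1) v(1)] n[OF that(1)] k by (simp add: bact_zero)
    next
      assume i: "i = ?k"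
      have x: "bact (Ggen ?k) ?w \<in> carrier V" using w k by simp
      have "bact (Ggen ?k) ?w = \<ominus>\<^bsub>V\<^esub> bact (Ggen ?k) ?w"
        using G_G_V[OF k(2,1) v(1)] x by (simp add: V.sm_neg_one)
      then have "bact (Ggen ?k) ?w \<oplus>\<^bsub>V\<^esub> bact (Ggen ?k) ?w = \<zero>\<^bsub>V\<^esub>"
        using x by (metis V.M.r_neg)
      then have "(1/2) \<odot>\<^bsub>V\<^esub> (bact (Ggen ?k) ?w \<oplus>\<^bsub>V\<^esub> bact (Ggen ?k) ?w) = \<zero>\<^bsub>V\<^esub>" by simp
      then show ?thesis using x i by (simp add: V.sm_r_distr flip: V.sm_l_distr)
    qed
    then show ?thesis using w False by blast
  qed
qed

text \<open>The vectors killed by all these G form a graded submodule, which is nonzero by the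
  preceding lemmas; simplicity of V does the rest.\<close>

theorem G_V:
  assumes "i > int t" "v \<in> carrier V"
  shows "bact (Ggen i) v = \<zero>\<^bsub>V\<^esub>"
proof -
  let ?N = "{v \<in> carrier V. \<forall>i > int t. bact (Ggen i) v = \<zero>\<^bsub>V\<^esub>}"
  have GT: "Ggen i \<in> T" if "i > int t" for i using that by (auto simp: mem_T)
  \<comment> \<open>The bound \<open>d + 1\<close> leaves precisely the indices treated in
    \<open>G_V_large\<close>.\<close>
  obtain v0 where v0: "v0 \<in> carrier V" "v0 \<noteq> \<zero>\<^bsub>V\<^esub>"
    "\<forall>i. int t < i \<and> i \<le> int t + int (d + 1) \<longrightarrow> bact (Ggen i) v0 = \<zero>\<^bsub>V\<^esub>"
    using G_V_nonzero_vector by blast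
  have "bact (Ggen i) v0 = \<zero>\<^bsub>V\<^esub>" if "i > int t" for i
  proof (cases "i \<le> int t + int (d + 1)")
    case False
    then show ?thesis using v0(1) by (intro G_V_large) simp_all
  qed (use v0(3) that in blast)
  then have "v0 \<in> ?N" using v0(1) by simp
  have "?N = carrier V"
  proof (rule V_simple[OF _ _ _ _ _ \<open>v0 \<in> ?N\<close> v0(2)])
    show "bact b v \<in> ?N" if "v \<in> ?N" "b \<in> T" for v b
    proof -
      have v: "v \<in> carrier V" "\<And>i. i > int t \<Longrightarrow> bact (Ggen i) v = \<zero>\<^bsub>V\<^esub>" using that(1) by auto
      have "bact (Ggen i) (bact b v) = \<zero>\<^bsub>V\<^esub>" if i: "i > int t" for i
      proof -
        \<comment> \<open>With L_m, m nonnegative, the bracket is a multiple of a G whose index is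
          no smaller; with a G in T_d, of a W of index above t; otherwise it is zero. All of these
          kill \<open>v\<close>.\<close>
        have "act V (osr_basis_bracket (Ggen i) b) v = \<zero>\<^bsub>V\<^esub>"
        proof (cases b)
          case (Lgen m)
          then have "m + i > int t" "Ggen (m + i) \<in> T" using \<open>b \<in> T\<close> i by (auto simp: mem_T)
          then show ?thesis using v Lgen by (simp add: act_single single_uminus')
        next
          case (Ggen k)
          then have "i + k - 1 > int t" "i + k - 1 \<noteq> 0" "Wgen (i + k - 1) \<in> T" using \<open>b \<in> T\<close> i by (auto simp: mem_T)
          then show ?thesis using v Ggen W_V by (simp add: act_single)
        qed (simp_all add: act_zero v)
        then show ?thesis
          using bact_bracket[OF GT[OF i] \<open>b \<in> T\<close> v(1)] v(2)[OF i] \<open>b \<in> T\<close> by (simp add: bact_zero)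
      qed
      then show ?thesis using v \<open>b \<in> T\<close> by simp
    qed
    fix a b assume ab: "a \<in> parity_part V 0" "b \<in> parity_part V 1" "a \<oplus>\<^bsub>V\<^esub> b \<in> ?N"
    have c: "a \<in> carrier V" "b \<in> carrier V" using ab V_part by auto
    have "bact (Ggen i) a = \<zero>\<^bsub>V\<^esub> \<and> bact (Ggen i) b = \<zero>\<^bsub>V\<^esub>" if i: "i > int t" for i
    proof -
      \<comment> \<open>An odd operator exchanges the parity parts, so the images of the two
        components lie in different parts and vanish separately.\<close>
      have "bact (Ggen i) a \<in> parity_part V 1" "bact (Ggen i) b \<in> parity_part V 0"
        using bact_part[OF GT[OF i] ab(1)] bact_part[OF GT[OF i] ab(2)] by simp_all
      moreover have "bact (Ggen i) b \<oplus>\<^bsub>V\<^esub> bact (Ggen i) a = \<zero>\<^bsub>V\<^esub>"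
        using ab(3) i c GT[OF i] V.act_add_right[of "Poly_Mapping.single (Ggen i) 1" a b]
        by (simp add: bact_def V.M.a_comm)
      ultimately show ?thesis using part_sum_zero by blast
    qed
    then show "a \<in> ?N \<and> b \<in> ?N" using c by simp
  next
    show "v \<oplus>\<^bsub>V\<^esub> w \<in> ?N" if "v \<in> ?N" "w \<in> ?N" for v w
      using that GT V.act_add_right[of "Poly_Mapping.single (Ggen _) 1" v w] by (auto simp: bact_def)
    show "c \<odot>\<^bsub>V\<^esub> v \<in> ?N" if "v \<in> ?N" for c v
      using that GT V.act_smult_right[of "Poly_Mapping.single (Ggen _) 1" v c] by (auto simp: bact_def)
  qed auto
  then show ?thesis using assms by blast
qed

lemma \<iota>_zero: "\<iota> \<zero>\<^bsub>V\<^esub> = \<zero>\<^bsub>M\<^esub>"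
  using \<iota>_smult[of "\<zero>\<^bsub>V\<^esub>" 0] by simp

text \<open>Zero lies in both parity parts of the induced module, so \<open>v\<close> lies in both
  parity parts of V, which meet in zero.\<close>

lemma \<iota>_eq_zero:
  assumes "v \<in> carrier V" "\<iota> v = \<zero>\<^bsub>M\<^esub>"
  shows "v = \<zero>\<^bsub>V\<^esub>"
  using assms by (intro part_disjoint \<iota>_part_iff) (simp_all add: M_part_zero)

definition mact where "mact b = act M (Poly_Mapping.single b 1)"

lemma mact_closed [simp]: "z \<in> carrier M \<Longrightarrow> mact b z \<in> carrier M"
  unfolding mact_def by (rule M.act_closed) simp_all

lemma word_mact_closed: "z \<in> carrier M \<Longrightarrow> foldr mact w z \<in> carrier M"
  by (induction w) auto

lemma \<iota>_bact: "b \<in> T \<Longrightarrow> v \<in> carrier V \<Longrightarrow> mact b (\<iota> v) = \<iota> (bact b v)"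
  unfolding bact_def mact_def by (rule \<iota>_act[symmetric]) simp_all

text \<open>The section for the zero submodule embeds the induced module linearly into a type with
  total operations, with \<open>eval_pm\<close> as left inverse. There \<open>word_descent\<close>
  applies, and its result is carried back.\<close>

theorem word_descent_M:
  assumes z: "z \<in> carrier M" "z \<noteq> \<zero>\<^bsub>M\<^esub>"
  obtains w v where "v \<in> carrier V" "v \<noteq> \<zero>\<^bsub>V\<^esub>" "foldr mact w z = \<iota> v"
proof (rule M.section_exists[of "{\<zero>\<^bsub>M\<^esub>}"])
  show "submodule {\<zero>\<^bsub>M\<^esub>} complex_ring M" by (rule M.submoduleI) simp_all
next
  fix s :: "_ \<Rightarrow> _ \<Rightarrow>\<^sub>0 complex"
  assume s_add: "\<And>v w. v \<in> carrier M \<Longrightarrow> w \<in> carrier M \<Longrightarrow> s (v \<oplus>\<^bsub>M\<^esub> w) = s v + s w"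
    and s_smult: "\<And>v c. v \<in> carrier M \<Longrightarrow> s (c \<odot>\<^bsub>M\<^esub> v) = pm_scale c (s v)"
    and s_zero: "\<And>v. v \<in> carrier M \<Longrightarrow> s v = 0 \<longleftrightarrow> v \<in> {\<zero>\<^bsub>M\<^esub>}"
    and s_eval: "\<And>v. v \<in> carrier M \<Longrightarrow> M.eval_pm (s v) \<ominus>\<^bsub>M\<^esub> v \<in> {\<zero>\<^bsub>M\<^esub>}"
  have eval: "M.eval_pm (s v) = v" if "v \<in> carrier M" for v
  proof -
    have "M.eval_pm (s v) = (M.eval_pm (s v) \<ominus>\<^bsub>M\<^esub> v) \<oplus>\<^bsub>M\<^esub> v"
      using that M.eval_pm_closed[of "s v"] by (simp add: a_minus_def M.M.a_assoc M.M.l_neg)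
    with s_eval[OF that] that show ?thesis by simp
  qed
  \<comment> \<open>Composition with \<open>eval_pm\<close> makes the operators total. The bracket
    relations then hold for every \<open>e\<close>, since \<open>eval_pm e\<close> always lies in
    the module.\<close>
  define opr where "opr b e = s (mact b (M.eval_pm e))" for b e
  have mact_s: "s (act M x y) = (\<Sum>c\<in>Poly_Mapping.keys x. pm_scale (Poly_Mapping.lookup x c) (s (mact c y)))"
    if y: "y \<in> carrier M" for x y
  proof -
    have zero: "s (act M 0 y) = 0"
      using s_smult[of "act M 0 y" 0] M.act_smult_left[of 0 y 0] y M.act_closed[of 0 y] by (simp add: osr_scale_linear)
    have "s (act M (\<Sum>c\<in>A. Poly_Mapping.single c (Poly_Mapping.lookup x c)) y) =
        (\<Sum>c\<in>A. pm_scale (Poly_Mapping.lookup x c) (s (mact c y)))" if "finite A" for A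
      using that
    proof (induction A)
      case (insert a A)
      have "act M (Poly_Mapping.single a (Poly_Mapping.lookup x a)) y = Poly_Mapping.lookup x a \<odot>\<^bsub>M\<^esub> mact a y"
        using M.act_smult_left[of "Poly_Mapping.single a 1" y "Poly_Mapping.lookup x a"] y
        by (simp add: mact_def osr_scale_linear)
      then show ?case using insert y M.act_add_left[of "Poly_Mapping.single a (Poly_Mapping.lookup x a)" _ y]
        by (simp add: s_add s_smult)
    qed (simp add: zero)
    from this[of "Poly_Mapping.keys x"] show ?thesis by (simp add: sum_monomials)
  qed
  define B0 where "B0 = (\<lambda>v. s (\<iota> v)) ` carrier V"
  have opr_s: "opr b (s y) = s (mact b y)" if "y \<in> carrier M" for b y
    using eval[OF that] by (simp add: opr_def)
  have opr_\<iota>: "opr b (s (\<iota> v)) = s (\<iota> (bact b v))" if "b \<in> T" "v \<in> carrier V" for b v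
    using that by (simp add: opr_s \<iota>_bact)
  have s_\<iota>_zero: "s (\<iota> v) = 0 \<longleftrightarrow> v = \<zero>\<^bsub>V\<^esub>" if "v \<in> carrier V" for v
    using s_zero[of "\<iota> v"] that \<iota>_eq_zero \<iota>_zero by auto
  interpret D: osr_operators pm_scale opr B0 d t c2
  proof
    show "pm.lin_op (opr a)" for a
      unfolding pm.lin_op_def opr_def mact_def
      by (simp add: M.eval_pm_add M.eval_pm_scale M.act_add_right M.act_smult_right M.eval_pm_closed s_add s_smult)
    show "opr a (opr b e) = pm_scale (koszul_sign (osr_basis_parity a) (osr_basis_parity b)) (opr b (opr a e)) +
        (\<Sum>c\<in>Poly_Mapping.keys (osr_basis_bracket a b). pm_scale (Poly_Mapping.lookup (osr_basis_bracket a b) c) (opr c e))" for a b e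
    proof -
      let ?z = "M.eval_pm e" and ?k = "koszul_sign (osr_basis_parity a) (osr_basis_parity b)"
      have z: "?z \<in> carrier M" by (rule M.eval_pm_closed)
      have "act M (osr_basis_bracket a b) ?z = mact a (mact b ?z) \<ominus>\<^bsub>M\<^esub> ?k \<odot>\<^bsub>M\<^esub> mact b (mact a ?z)"
        using M.act_bracket[of "Poly_Mapping.single a 1" "osr_basis_parity a" "Poly_Mapping.single b 1" "osr_basis_parity b" ?z]
          z osr_homogeneous_single[of a 1] osr_homogeneous_single[of b 1]
        by (simp add: mact_def osr_bracket_single osr_scale_linear)
      also have "\<dots> = mact a (mact b ?z) \<oplus>\<^bsub>M\<^esub> (- ?k) \<odot>\<^bsub>M\<^esub> mact b (mact a ?z)"
        using z by (simp add: a_minus_def M.sm_minus)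
      finally have "s (act M (osr_basis_bracket a b) ?z) = s (mact a (mact b ?z)) - pm_scale ?k (s (mact b (mact a ?z)))"
        using z by (simp add: s_add s_smult)
      then show ?thesis
        using z by (simp add: mact_s opr_def eval)
    qed
    show "pm.subspace B0"
    proof (rule pm.subspaceI)
      show "0 \<in> B0" unfolding B0_def using s_\<iota>_zero[of "\<zero>\<^bsub>V\<^esub>"] by (intro image_eqI[of _ _ "\<zero>\<^bsub>V\<^esub>"]) simp_all
      show "x + y \<in> B0" if "x \<in> B0" "y \<in> B0" for x y
        using that by (auto simp: B0_def image_iff s_add[symmetric] \<iota>_add[symmetric])
      show "pm_scale c x \<in> B0" if "x \<in> B0" for c x
        using that by (auto simp: B0_def image_iff s_smult[symmetric] \<iota>_smult[symmetric])
    qed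
    show "opr a b \<in> B0" if "a \<in> T" "b \<in> B0" for a b
      using that by (auto simp: B0_def opr_\<iota>)
    show "opr (Wgen i) b = 0" if "i > int t" "b \<in> B0" for i b
      using that by (auto simp: B0_def opr_\<iota> mem_T W_V s_\<iota>_zero)
    show "opr (Lgen i) b = 0" if "i > int t + int d" "b \<in> B0" for i b
      using that by (auto simp: B0_def opr_\<iota> mem_T L_V s_\<iota>_zero)
    show "opr (Ggen i) b = 0" if "i > int t" "b \<in> B0" for i b
      using that by (auto simp: B0_def opr_\<iota> mem_T G_V s_\<iota>_zero)
    show "opr Cgen2 b = pm_scale c2 b" if "b \<in> B0" for b
      using that by (auto simp: B0_def opr_\<iota> mem_T C2_V \<iota>_smult s_smult)
    show "b = 0" if "t > 0" "b \<in> B0" "opr (Wgen (int t)) b = 0" for b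
      using that W_inj by (auto simp: B0_def opr_\<iota> mem_T s_\<iota>_zero)
    show "t = 0 \<Longrightarrow> c2 \<noteq> 0" by (rule c2_nonzero)
  qed
  have "s z \<in> U" if U: "pm.subspace U" "B0 \<subseteq> U" "\<And>b x. x \<in> U \<Longrightarrow> opr b x \<in> U" for U
    using z(1)
  proof (induction z rule: M_induct)
    case (add y z)
    then show ?case using pm.subspace_add[OF U(1)] by (simp add: s_add)
  next
    case (smult c z)
    then show ?case using pm.subspace_scale[OF U(1)] by (simp add: s_smult)
  next
    case (act x z)
    then have "s (mact c z) \<in> U" for c using U(3)[of "s z" c] by (simp add: opr_s)
    then show ?case using act by (simp add: mact_s pm.subspace_sum[OF U(1)] pm.subspace_scale[OF U(1)])
  next
    case (gen v)
    then show ?case using U(2) by (auto simp: B0_def)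
  qed
  moreover have "s z \<noteq> 0" using s_zero[OF z(1)] z(2) by simp
  ultimately obtain w where w: "foldr opr w (s z) \<in> B0" "foldr opr w (s z) \<noteq> 0"
    by (rule D.word_descent)
  have word: "foldr opr w (s z) = s (foldr mact w z)"
    using z(1) by (induction w) (simp_all add: opr_s word_mact_closed)
  then obtain v where v: "v \<in> carrier V" "s (foldr mact w z) = s (\<iota> v)" using w(1) by (auto simp: B0_def)
  then have "foldr mact w z = \<iota> v"
    using eval[of "\<iota> v"] eval[of "foldr mact w z"] z(1) word_mact_closed by simp
  moreover have "v \<noteq> \<zero>\<^bsub>V\<^esub>" using w(2) v word s_\<iota>_zero by simp
  ultimately show thesis using v(1) that by blast
qed

text \<open>Homogeneous operators map the intersection of the two parts into itself. A nonzero
  \<open>z\<close> in it would thus descend to a nonzero \<open>v\<close> with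
  \<open>\<iota> v\<close> in both parts, and \<open>v\<close> would lie in both parts of V.\<close>

lemma M_part_disjoint:
  assumes "z \<in> parity_part M 0" "z \<in> parity_part M 1"
  shows "z = \<zero>\<^bsub>M\<^esub>"
proof (rule ccontr)
  assume "z \<noteq> \<zero>\<^bsub>M\<^esub>"
  then obtain w v where v: "v \<in> carrier V" "v \<noteq> \<zero>\<^bsub>V\<^esub>" "foldr mact w z = \<iota> v"
    using M_part_carrier[OF assms(1)] by (elim word_descent_M)
  have "foldr mact w z \<in> parity_part M k" for k
  proof (induction w arbitrary: k)
    case Nil
    show ?case using assms by (cases k) auto
  next
    case (Cons b w)
    \<comment> \<open>The letter shifts parity by its own, so the induction hypothesis is taken at
      the parity shifted in advance; the two shifts cancel modulo 2.\<close>
    have "mact b (foldr mact w z) \<in> parity_part M (osr_basis_parity b + (osr_basis_parity b + k))"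
      unfolding mact_def using osr_homogeneous_single[of b 1] Cons
      by (intro M_act_part) (auto simp: mact_def)
    moreover have "osr_basis_parity b + (osr_basis_parity b + k) = k"
      by (cases "osr_basis_parity b"; cases k) auto
    ultimately show ?case by simp
  qed
  then show False using part_disjoint[of v] \<iota>_part_iff[OF v(1)] v by metis
qed

theorem M_simple: "simple_supermodule osr_algebra M"
  unfolding simple_supermodule_def
proof (intro conjI allI impI)
  show "supermodule osr_algebra M" by (rule M_supermodule) (rule M_part_disjoint)
  obtain x v where x: "x \<in> carrier h" "v \<in> carrier V" "act V x v \<noteq> \<zero>\<^bsub>V\<^esub>"
    using simple unfolding simple_supermodule_def by blast
  \<comment> \<open>Non-triviality is inherited from V, as \<iota> is equivariant for T_d and
    injective.\<close>
  then have "act M x (\<iota> v) \<noteq> \<zero>\<^bsub>M\<^esub>" "\<iota> v \<in> carrier M"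
    using \<iota>_act[of x v] \<iota>_eq_zero[of "act V x v"] V.act_closed[of x v] by auto
  then show "\<exists>x\<in>carrier osr_algebra. \<exists>v\<in>carrier M. act M x v \<noteq> \<zero>\<^bsub>M\<^esub>" by auto
  show "carrier M \<noteq> {\<zero>\<^bsub>M\<^esub>}"
  proof
    assume "carrier M = {\<zero>\<^bsub>M\<^esub>}"
    moreover have "act M x (\<iota> v) \<in> carrier M" using x by (intro M.act_closed) simp_all
    ultimately show False using \<open>act M x (\<iota> v) \<noteq> \<zero>\<^bsub>M\<^esub>\<close> by simp
  qed
  fix N assume N: "sub_supermodule osr_algebra M N"
  then have sub: "submodule N complex_ring M" and act: "\<And>x z. z \<in> N \<Longrightarrow> act M x z \<in> N"
    and graded: "\<And>a b. a \<in> parity_part M 0 \<Longrightarrow> b \<in> parity_part M 1 \<Longrightarrow> a \<oplus>\<^bsub>M\<^esub> b \<in> N \<Longrightarrow> a \<in> N \<and> b \<in> N"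
    unfolding sub_supermodule_def by auto
  note NE = M.submoduleE[OF sub]
  show "N = {\<zero>\<^bsub>M\<^esub>} \<or> N = carrier M"
  proof (cases "N \<subseteq> {\<zero>\<^bsub>M\<^esub>}")
    case True
    then show ?thesis using NE(2) by blast
  next
    case False
    then obtain z where z: "z \<in> N" "z \<noteq> \<zero>\<^bsub>M\<^esub>" by blast
    then have "z \<in> carrier M" using NE(1) by blast
    then obtain w v where v: "v \<in> carrier V" "v \<noteq> \<zero>\<^bsub>V\<^esub>" "foldr mact w z = \<iota> v"
      by (rule word_descent_M[OF _ z(2)])
    have "foldr mact w z \<in> N" using z(1) act by (induction w) (auto simp: mact_def)
    then have \<iota>v: "v \<in> {v \<in> carrier V. \<iota> v \<in> N}" using v by simp
    \<comment> \<open>The preimage of \<open>N\<close> in V is graded because \<iota> preserves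
      parity, and the descent has just produced a nonzero vector in it.\<close>
    have "{v \<in> carrier V. \<iota> v \<in> N} = carrier V"
    proof (rule V_simple[OF _ _ _ _ _ \<iota>v v(2)])
      show "bact b u \<in> {v \<in> carrier V. \<iota> v \<in> N}" if "u \<in> {v \<in> carrier V. \<iota> v \<in> N}" "b \<in> T" for u b
        using that act[of "\<iota> u" "Poly_Mapping.single b 1"] by (auto simp: mact_def simp flip: \<iota>_bact)
      fix a b assume ab: "a \<in> parity_part V 0" "b \<in> parity_part V 1" "a \<oplus>\<^bsub>V\<^esub> b \<in> {v \<in> carrier V. \<iota> v \<in> N}"
      then have c: "a \<in> carrier V" "b \<in> carrier V" using V_part by auto
      then have "\<iota> a \<in> N \<and> \<iota> b \<in> N"
        using ab graded[OF \<iota>_part[OF ab(1)] \<iota>_part[OF ab(2)]] by (simp add: \<iota>_add)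
      then show "a \<in> {v \<in> carrier V. \<iota> v \<in> N} \<and> b \<in> {v \<in> carrier V. \<iota> v \<in> N}" using c by simp
    qed (auto simp: \<iota>_add \<iota>_smult NE)
    then have \<iota>N: "\<iota> u \<in> N" if "u \<in> carrier V" for u using that by blast
    have "z \<in> N" if "z \<in> carrier M" for z
      using that by (induction rule: M_induct) (auto simp: NE act \<iota>N)
    then show ?thesis using NE(1) by blast
  qed
qed

end

theorem theorem4p1:
  fixes d t :: nat and c1 c2 :: complex
    and V :: "(osr_basis \<Rightarrow>\<^sub>0 complex, 'v) supermodule"
  assumes simple: "simple_supermodule (osr_T d) V"
    and C1_scalar: "\<forall>v\<in>carrier V. act V osr_C1 v = c1 \<odot>\<^bsub>V\<^esub> v"
    and C2_scalar: "\<forall>v\<in>carrier V. act V osr_C2 v = c2 \<odot>\<^bsub>V\<^esub> v"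
    and cond_a_pos: "t > 0 \<Longrightarrow> inj_on (act V (osr_W (int t))) (carrier V)"
    and cond_a_zero: "t = 0 \<Longrightarrow> c2 \<noteq> 0"
    and cond_b_W: "\<forall>i. i > int t \<longrightarrow> (\<forall>v\<in>carrier V. act V (osr_W i) v = \<zero>\<^bsub>V\<^esub>)"
    and cond_b_L: "\<forall>j. j > int t + int d \<longrightarrow> (\<forall>v\<in>carrier V. act V (osr_L j) v = \<zero>\<^bsub>V\<^esub>)"
  shows "(\<forall>i. i > int t \<longrightarrow> (\<forall>v\<in>carrier V. act V (osr_G i) v = \<zero>\<^bsub>V\<^esub>)) \<and>
         simple_supermodule osr_algebra (ind_module osr_algebra (osr_T d) V)"
proof -
  have super: "supermodule (osr_T d) V" using simple by (simp add: simple_supermodule_def)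
  interpret osr_induced d V
    by (intro osr_induced.intro induced.intro induced_axioms.intro enveloping.intro osr_algebra_lie_superalgebra)
      (use osr_T_lie_superalgebra[of d] super in \<open>auto simp: osr_T_def\<close>)
  have "Wgen (int t) \<in> osr_T_basis d" by (auto simp: osr_T_basis_def intro: exI[of _ "int t + int d"])
  then have zero: "act V (osr_W (int t)) \<zero>\<^bsub>V\<^esub> = \<zero>\<^bsub>V\<^esub>"
    using V.act_smult_right[of "osr_W (int t)" "\<zero>\<^bsub>V\<^esub>" 0] by simp
  interpret osr_situation d V t c2
  proof
    show "v = \<zero>\<^bsub>V\<^esub>" if "t > 0" "v \<in> carrier V" "bact (Wgen (int t)) v = \<zero>\<^bsub>V\<^esub>" for v
      using inj_onD[OF cond_a_pos[OF that(1)], of v "\<zero>\<^bsub>V\<^esub>"] that zero by (simp add: bact_def)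
  qed (use simple C2_scalar cond_a_zero cond_b_W cond_b_L in \<open>auto simp: bact_def osr_T_def\<close>)
  show ?thesis using G_V M_simple by (simp add: bact_def osr_T_def)
qed

end
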